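(* Let $-A$ be the generator of a bounded $C_0$-semigroup $(T(t))_{t\ge 0}$ on a Hilbert space $H$, and put $M:=\sup_{t\ge 0}\|T(t)\|$. Then the following assertions hold. (a) For each $\omega<0$ there is a function $c:(0,\infty)\to[0,\infty)$ with $c(\tau)=O(|\log\tau|)$ as $\tau\searrow 0$ and $c(\tau)=O(1)$ as $\tau\to\infty$, such that for all $\tau>0$ and all $f\in \mathrm{H}^\infty(\mathrm{R}_\omega)$ one has $f(A)T(\tau)\in\mathcal{L}(H)$ with $$\|f(A)T(\tau)\|\le c(\tau)\,M^2\,\|f\|_{\mathrm{H}^\infty(\mathrm{R}_\omega)} .$$ (b) For $\omega<0<\alpha$ and $\lambda\in\mathbb{C}$ with $\operatorname{Re}\lambda<0$ there is $C\ge 0$ such that $$\|f(A)(A-\lambda)^{-\alpha}\|\le C M^2\|f\|_{\mathrm{H}^\infty(\mathrm{R}_\omega)}\qquad\text{for all } f\in\mathrm{H}^\infty(\mathrm{R}_\omega).$$ In particular, $\operatorname{dom}(A^\alpha)\subseteq\operatorname{dom}(f(A))$. (c) $A$ has a strong $m$-bounded $\mathrm{H}^\infty$-calculus of type $0$ for each $m\in\mathbb{N}=\{1,2,\dots\}$.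
   Context: $\mathcal{L}(X)$ denotes the bounded linear operators on a Banach space $X$. For $\omega\in\mathbb{R}$, $\mathrm{R}_\omega:=\{z\in\mathbb{C}:\operatorname{Re}z>\omega\}$, and $\mathrm{H}^\infty(\mathrm{R}_\omega)$ is the Banach algebra of bounded holomorphic functions on $\mathrm{R}_\omega$ with the supremum norm. Generator convention: $-A$ generates $(T(t))_{t\ge0}$ if $(\mu+A)^{-1}x=\int_0^\infty e^{-\mu t}T(t)x\,dt$ for all $x$ and $\operatorname{Re}\mu$ large. Functional calculus (Hille–Phillips calculus) for a bounded semigroup: for a complex Borel measure $\mu$ on $[0,\infty)$ let $\widehat\mu(z)=\int_0^\infty e^{-zs}\mu(ds)$ and set $\widehat\mu(A)x:=\int_0^\infty T(t)x\,\mu(dt)$. For other functions $f$, $f(A):=e(A)^{-1}(ef)(A)$ whenever there is a Laplace transform $e$ of a complex Borel measure on $[0,\infty)$ with $e(A)$ injective and such that $ef$ is also (on $\mathrm{R}_0$) such a Laplace transform; this is a closed, in general unbounded, operator independent of $e$. For $\omega<0$ every $f\in \mathrm{H}^\infty(\mathrm{R}_{\omega})$ is covered, using $e(z)=(z-\mu)^{-1}$ with $\operatorname{Re}\mu<\omega$. Fractional powers: for $\operatorname{Re}\lambda<0<\alpha$, $(A-\lambda)^{-\alpha}x=\frac1{\Gamma(\alpha)}\int_0^\infty t^{\alpha-1}e^{\lambda t}T(t)x\,dt$; $A^\alpha$ is the usual fractional power of the sectorial operator $A$ and $\operatorname{dom}(A^\alpha)=\operatorname{ran}((A-\lambda)^{-\alpha})$.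 $A$ has a strong $m$-bounded $\mathrm{H}^\infty$-calculus of type $0$ if there is a constant $C\ge0$ such that for every $\omega<0$ and every $f\in \mathrm{H}^\infty(\mathrm{R}_\omega)$ one has $f^{(m)}(A)\in\mathcal{L}(X)$ with $\|f^{(m)}(A)\|\le \frac{C}{|\omega|^m}\|f\|_{\mathrm{H}^\infty(\mathrm{R}_\omega)}$, where $f^{(m)}$ is the $m$-th derivative (which is bounded on $\mathrm{R}_{\omega'}$ for every $\omega'>\omega$, so that $f^{(m)}(A)$ is defined). *)

theory Defs
  imports
    "HOL-Analysis.Analysis"
    "HOL-Complex_Analysis.Complex_Analysis"
    "HOL-Library.Landau_Symbols"
begin

section \<open>Complex Hilbert spaces\<close>

class complex_vector = real_vector +
  fixes scaleC :: "complex \<Rightarrow> 'a \<Rightarrow> 'a"  (infixr "*\<^sub>C" 75)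
  assumes scaleC_add_right: "c *\<^sub>C (x + y) = c *\<^sub>C x + c *\<^sub>C y"
    and scaleC_add_left: "(c + d) *\<^sub>C x = c *\<^sub>C x + d *\<^sub>C x"
    and scaleC_scaleC: "c *\<^sub>C d *\<^sub>C x = (c * d) *\<^sub>C x"
    and scaleC_of_real: "of_real r *\<^sub>C x = r *\<^sub>R x"

text \<open>The inner product is linear in the first argument. Definiteness and positivity follow
  from the last axiom, since \<open>norm\<close> is already a norm.\<close>

class complex_inner = complex_vector + real_normed_vector +
  fixes cinner :: "'a \<Rightarrow> 'a \<Rightarrow> complex"
  assumes cinner_commute: "cinner x y = cnj (cinner y x)"
    and cinner_add_left: "cinner (x + y) z = cinner x z + cinner y z"
    and cinner_scaleC_left: "cinner (c *\<^sub>C x) y = c * cinner x y"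
    and cinner_self: "cinner x x = of_real ((norm x)\<^sup>2)"

class chilbert_space = complex_inner + banach


section \<open>Operators\<close>

definition bounded_clinear :: "('a::chilbert_space \<Rightarrow> 'a) \<Rightarrow> bool" where
  "bounded_clinear S \<longleftrightarrow> bounded_linear S \<and> (\<forall>c x. S (c *\<^sub>C x) = c *\<^sub>C S x)"

text \<open>Unbounded operators are represented by their graphs, so that \<open>Domain G\<close> is the domain
  and \<open>graph S O G\<close> is the operator product \<open>G S\<close> with its natural domain.\<close>

definition graph :: "('a \<Rightarrow> 'b) \<Rightarrow> ('a \<times> 'b) set" where
  "graph S = {(x, S x) | x. True}"

definition in_L :: "('a::chilbert_space \<times> 'a) set \<Rightarrow> bool" where
  "in_L G \<longleftrightarrow> (\<exists>S. bounded_clinear S \<and> G = graph S)"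

text \<open>The operator norm; meaningful for \<open>in_L G\<close>.\<close>

definition op_norm :: "('a::chilbert_space \<times> 'a) set \<Rightarrow> real" where
  "op_norm G = onorm (\<lambda>x. THE y. (x, y) \<in> G)"


section \<open>Semigroups and generators\<close>

definition C0_semigroup :: "(real \<Rightarrow> 'a::chilbert_space \<Rightarrow> 'a) \<Rightarrow> bool" where
  "C0_semigroup T \<longleftrightarrow>
     (\<forall>t\<ge>0. bounded_clinear (T t)) \<and>
     T 0 = id \<and>
     (\<forall>s\<ge>0. \<forall>t\<ge>0. T (s + t) = T s \<circ> T t) \<and>
     (\<forall>x. ((\<lambda>t. T t x) \<longlongrightarrow> x) (at_right 0))"

definition bounded_C0_semigroup :: "(real \<Rightarrow> 'a::chilbert_space \<Rightarrow> 'a) \<Rightarrow> bool" where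
  "bounded_C0_semigroup T \<longleftrightarrow> C0_semigroup T \<and> bounded ((\<lambda>t. onorm (T t)) ` {0..})"

text \<open>\<open>neg_generates A T\<close>: the operator \<open>-A\<close> generates \<open>T\<close>. The left-hand side of the equation
  is the graph of the inverse of \<open>\<mu> + A\<close>.\<close>

definition neg_generates ::
    "('a::chilbert_space \<times> 'a) set \<Rightarrow> (real \<Rightarrow> 'a \<Rightarrow> 'a) \<Rightarrow> bool" where
  "neg_generates A T \<longleftrightarrow> (\<exists>w::real. \<forall>\<mu>. Re \<mu> > w \<longrightarrow>
     (\<forall>x. (\<lambda>t. exp (- \<mu> * of_real t) *\<^sub>C T t x) integrable_on {0..}) \<and>
     {(\<mu> *\<^sub>C x + y, x) | x y. (x, y) \<in> A} =
       graph (\<lambda>x. integral {0..} (\<lambda>t. exp (- \<mu> * of_real t) *\<^sub>C T t x)))"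

text \<open>The bounded semigroup generated by \<open>-A\<close>. By uniqueness of Laplace transforms it is
  determined by \<open>A\<close> at all \<open>t \<ge> 0\<close>; values at \<open>t < 0\<close> are never used.\<close>

definition semigroup_of :: "('a::chilbert_space \<times> 'a) set \<Rightarrow> real \<Rightarrow> 'a \<Rightarrow> 'a" where
  "semigroup_of A = (SOME T. bounded_C0_semigroup T \<and> neg_generates A T)"


section \<open>Integration against complex Borel measures on the half-line\<close>

text \<open>The library's \<open>has_bochner_integral\<close> is confined to second-countable codomains. This is
  the same definition without that restriction, since the Hilbert space may be non-separable.\<close>

definition has_vec_integral ::
    "'b measure \<Rightarrow> ('b \<Rightarrow> 'a::real_normed_vector) \<Rightarrow> 'a \<Rightarrow> bool" where
  "has_vec_integral m g y \<longleftrightarrow> g \<in> borel_measurable m \<and>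
     (\<exists>s. (\<forall>i. Bochner_Integration.simple_bochner_integrable m (s i)) \<and>
          (\<lambda>i. \<integral>\<^sup>+t. ennreal (norm (g t - s i t)) \<partial>m) \<longlonglongrightarrow> 0 \<and>
          (\<lambda>i::nat. Bochner_Integration.simple_bochner_integral m (s i)) \<longlonglongrightarrow> y)"

definition vec_integral :: "'b measure \<Rightarrow> ('b \<Rightarrow> 'a::real_normed_vector) \<Rightarrow> 'a" where
  "vec_integral m g = (THE y. has_vec_integral m g y)"

text \<open>The quadruple \<open>(m1, m2, m3, m4)\<close> of finite positive measures stands for the complex
  measure \<open>m1 - m2 + \<i> (m3 - m4)\<close>; by the Jordan decomposition every complex Borel measure on
  \<open>{0..}\<close> is of this form. The integrals below depend only on the complex measure
  and not on the chosen quadruple.\<close>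

type_synonym cmeasure = "real measure \<times> real measure \<times> real measure \<times> real measure"

definition half_line_measure :: "real measure \<Rightarrow> bool" where
  "half_line_measure m \<longleftrightarrow> finite_measure m \<and> sets m = sets (restrict_space borel {0..})"

fun complex_borel_measure :: "cmeasure \<Rightarrow> bool" where
  "complex_borel_measure (m1, m2, m3, m4) \<longleftrightarrow>
     half_line_measure m1 \<and> half_line_measure m2 \<and> half_line_measure m3 \<and> half_line_measure m4"

fun laplace :: "cmeasure \<Rightarrow> complex \<Rightarrow> complex" where
  "laplace (m1, m2, m3, m4) z =
     (let I = (\<lambda>m. \<integral>s. exp (- z * of_real s) \<partial>m)
      in I m1 - I m2 + \<i> * (I m3 - I m4))"


section \<open>Hille-Phillips calculus\<close>

fun hp_measure :: "('a::chilbert_space \<times> 'a) set \<Rightarrow> cmeasure \<Rightarrow> 'a \<Rightarrow> 'a" where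
  "hp_measure A (m1, m2, m3, m4) x =
     (let I = (\<lambda>m. vec_integral m (\<lambda>t. semigroup_of A t x))
      in I m1 - I m2 + \<i> *\<^sub>C (I m3 - I m4))"

definition right_half_plane :: "real \<Rightarrow> complex set" where
  "right_half_plane w = {z. Re z > w}"

text \<open>The graph of \<open>f(A)\<close>, i.e. of the inverse of \<open>e(A)\<close> composed with \<open>(e f)(A)\<close>, where \<open>e\<close> and
  \<open>e f\<close> are the Laplace transforms of \<open>\<mu>\<close> and \<open>\<nu>\<close>. Since the operator does not depend on \<open>e\<close>, the
  existential quantifier just selects any admissible \<open>e\<close>. Only the values of \<open>f\<close> on
  \<open>right_half_plane 0\<close> matter.\<close>

definition hp_calc :: "('a::chilbert_space \<times> 'a) set \<Rightarrow> (complex \<Rightarrow> complex) \<Rightarrow> ('a \<times> 'a) set" where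
  "hp_calc A f = {(x, y). \<exists>\<mu> \<nu>.
     complex_borel_measure \<mu> \<and> complex_borel_measure \<nu> \<and>
     inj (hp_measure A \<mu>) \<and>
     (\<forall>z\<in>right_half_plane 0. laplace \<mu> z * f z = laplace \<nu> z) \<and>
     hp_measure A \<mu> y = hp_measure A \<nu> x}"

text \<open>\<open>resolvent_power A \<kappa> \<alpha>\<close> is \<open>A - \<kappa>\<close> raised to the power \<open>-\<alpha>\<close>, for \<open>Re \<kappa> < 0 < \<alpha>\<close>.\<close>

definition resolvent_power ::
    "('a::chilbert_space \<times> 'a) set \<Rightarrow> complex \<Rightarrow> real \<Rightarrow> 'a \<Rightarrow> 'a" where
  "resolvent_power A \<kappa> \<alpha> x = (1 / Gamma \<alpha>) *\<^sub>R
     integral {0..} (\<lambda>t. (of_real (t powr (\<alpha> - 1)) * exp (\<kappa> * of_real t)) *\<^sub>C semigroup_of A t x)"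

text \<open>The fractional power of the sectorial operator \<open>A\<close>: the principal branch of the \<open>\<alpha>\<close>-th power,
  inserted into the calculus (regularised, e.g., by a high power of \<open>z \<mapsto> 1 / (1 + z)\<close>).\<close>

definition frac_power :: "('a::chilbert_space \<times> 'a) set \<Rightarrow> real \<Rightarrow> ('a \<times> 'a) set" where
  "frac_power A \<alpha> = hp_calc A (\<lambda>z. z powr of_real \<alpha>)"


section \<open>Bounded holomorphic functions\<close>

definition Hinf :: "real \<Rightarrow> (complex \<Rightarrow> complex) set" where
  "Hinf w = {f. f holomorphic_on right_half_plane w \<and> bounded (f ` right_half_plane w)}"

definition Hinf_norm :: "real \<Rightarrow> (complex \<Rightarrow> complex) \<Rightarrow> real" where
  "Hinf_norm w f = (SUP z\<in>right_half_plane w. norm (f z))"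

definition strong_m_bounded_calculus :: "nat \<Rightarrow> ('a::chilbert_space \<times> 'a) set \<Rightarrow> bool" where
  "strong_m_bounded_calculus m A \<longleftrightarrow> (\<exists>C\<ge>0. \<forall>w<0. \<forall>f\<in>Hinf w.
     in_L (hp_calc A ((deriv ^^ m) f)) \<and>
     op_norm (hp_calc A ((deriv ^^ m) f)) \<le> C / \<bar>w\<bar> ^ m * Hinf_norm w f)"

end

theory Submission
  imports Defs "HOL-Real_Asymp.Real_Asymp"
begin

text \<open>A function \<open>G\<close> that is holomorphic and quadratically decaying on a half-plane \<open>Re z > - a'\<close> with
  \<open>a' > a > 0\<close> is the Laplace transform of a kernel \<open>k\<close>, which the inversion formula recovers from any
  line \<open>Re z = x \<ge> - a\<close>. Since \<open>t T(t)\<close> is the integral of \<open>T(s) T(t - s)\<close> over \<open>s \<in> [0, t]\<close>, Bessel's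
  inequality for Hilbert space valued Fourier integrals (used twice) bounds the norm of
  \<open>\<integral> t k(t) exp (- r t) T(t) dt\<close> by \<open>M\<^sup>2 / (2 b)\<close> times the supremum of \<open>|G|\<close> on \<open>Re z = r - b\<close>.
  Writing \<open>1 = \<integral> 2 t exp (- 2 s t) ds\<close> over \<open>s \<ge> 0\<close> and taking \<open>r = 2 s\<close>, \<open>b = s + a\<close> yields
  \<open>\<parallel>G(A)\<parallel> \<le> M\<^sup>2 \<integral> E(s) / (s + a) ds\<close>, where \<open>E(s)\<close> is the supremum of \<open>|G|\<close> on \<open>Re z = s - a\<close>. All three
  norm estimates are this one, for \<open>f(z) exp (- \<tau> z)\<close>, \<open>f(z) (z - \<kappa>)\<^sup>-\<^sup>\<alpha>\<close> and the \<open>m\<close>-th derivative of \<open>f\<close>,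
  each multiplied by \<open>(n / (n + z))\<^sup>2\<close> to enforce decay; then \<open>n \<rightarrow> \<infinity>\<close>.\<close>

section \<open>Complex Hilbert spaces\<close>

text \<open>Everything hinges on the integrability of \<open>E s / (s + a)\<close> at infinity. For
  f alone \<open>E\<close> is constant and the integral diverges logarithmically; each assertion
  supplies its own decay. The factor exp(- \<tau> s) leaves a logarithm in \<tau>, while (s + a)^(-
  \<alpha>) and the Cauchy estimate (s + a)^(- m) give convergent powers. Bessel's inequality on a
  single line controls only the kernel t k(t), that is, the derivative of G; integrating over all
  vertical lines recovers G itself. The square of M reflects T(t) = T(s) T(t - s), where each factor
  costs one M. The second obstacle is that H may be non-separable. Operators are therefore handled
  through the scalar functions t -> \<open>cinner (T t x) y\<close>, and identities between
  operators are read off from their Laplace transforms. Uniqueness of these transforms is also what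
  makes f(A) independent of the regulariser and identifies the chosen semigroup with the given
  one.\<close>

lemma scaleC_0_right [simp]: "c *\<^sub>C (0::'a::complex_vector) = 0"
  using scaleC_add_right[of c "0::'a" 0] by simp

lemma scaleC_0_left [simp]: "0 *\<^sub>C (x::'a::complex_vector) = 0"
  using scaleC_add_left[of 0 0 x] by simp

lemma scaleC_1 [simp]: "1 *\<^sub>C (x::'a::complex_vector) = x"
  using scaleC_of_real[of 1 x] by simp

lemma scaleC_minus_right: "c *\<^sub>C (- x::'a::complex_vector) = - (c *\<^sub>C x)"
  using scaleC_add_right[of c x "-x"] by (simp add: eq_neg_iff_add_eq_0 add.commute)

lemma scaleC_diff_right: "c *\<^sub>C (x - y::'a::complex_vector) = c *\<^sub>C x - c *\<^sub>C y"
  using scaleC_add_right[of c x "-y"] by (simp add: scaleC_minus_right)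

lemma scaleC_scaleR: "c *\<^sub>C (r *\<^sub>R x) = r *\<^sub>R (c *\<^sub>C (x::'a::complex_vector))"
  by (simp add: scaleC_of_real[symmetric] scaleC_scaleC mult.commute)

lemma scaleR_scaleC_left: "(r *\<^sub>R c) *\<^sub>C x = r *\<^sub>R (c *\<^sub>C (x::'a::complex_vector))"
  by (simp add: scaleC_of_real[symmetric] scaleC_scaleC scaleR_conv_of_real)

lemma cinner_0_left [simp]: "cinner 0 (y::'a::complex_inner) = 0"
  using cinner_add_left[of "0::'a" 0 y] by simp

lemma cinner_0_right [simp]: "cinner (x::'a::complex_inner) 0 = 0"
  by (subst cinner_commute) simp

lemma cinner_add_right: "cinner (x::'a::complex_inner) (y + z) = cinner x y + cinner x z"
  by (metis cinner_add_left cinner_commute complex_cnj_add)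

lemma cinner_minus_left: "cinner (- x) (y::'a::complex_inner) = - cinner x y"
  using cinner_add_left[of x "-x" y] by (simp add: eq_neg_iff_add_eq_0 add.commute)

lemma cinner_diff_left: "cinner (x - z) (y::'a::complex_inner) = cinner x y - cinner z y"
  using cinner_add_left[of x "-z" y] by (simp add: cinner_minus_left)

lemma cinner_diff_right: "cinner y (x - z) = cinner y x - cinner (y::'a::complex_inner) z"
  by (metis cinner_diff_left cinner_commute complex_cnj_diff)

lemma cinner_scaleC_right: "cinner x (c *\<^sub>C y) = cnj c * cinner (x::'a::complex_inner) y"
  by (metis cinner_commute cinner_scaleC_left complex_cnj_mult)

lemma cinner_scaleR_left: "cinner (r *\<^sub>R x) (y::'a::complex_inner) = r *\<^sub>R cinner x y"
  by (simp add: scaleC_of_real[symmetric] cinner_scaleC_left scaleR_conv_of_real)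

lemma cinner_scaleR_right: "cinner x (r *\<^sub>R y) = r *\<^sub>R cinner (x::'a::complex_inner) y"
  by (simp add: scaleC_of_real[symmetric] cinner_scaleC_right scaleR_conv_of_real)

text \<open>The class axioms make the norm homogeneous for real scalars only; complex homogeneity
  comes out of \<open>cinner_self\<close>.\<close>

lemma norm_scaleC: "norm (c *\<^sub>C (x::'a::complex_inner)) = cmod c * norm x"
proof -
  have "complex_of_real ((norm (c *\<^sub>C x))\<^sup>2) = c * cnj c * cinner x x"
    by (simp only: cinner_self[symmetric] cinner_scaleC_left cinner_scaleC_right mult_ac)
  also have "\<dots> = of_real ((cmod c * norm x)\<^sup>2)"
    by (simp add: cinner_self complex_norm_square[symmetric] power_mult_distrib)
  finally have "(norm (c *\<^sub>C x))\<^sup>2 = (cmod c * norm x)\<^sup>2"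
    unfolding of_real_eq_iff .
  then show ?thesis by (rule power2_eq_imp_eq) simp_all
qed

lemma power2_norm_diff: "(norm (x - y))\<^sup>2 = (norm x)\<^sup>2 - 2 * Re (cinner x y) + (norm (y::'a::complex_inner))\<^sup>2"
proof -
  have "complex_of_real ((norm (x - y))\<^sup>2) = of_real ((norm x)\<^sup>2) - (cinner x y + cnj (cinner x y)) + of_real ((norm y)\<^sup>2)"
    by (simp only: cinner_self[symmetric] cinner_diff_left cinner_diff_right cinner_commute[of y x])
      simp
  also have "\<dots> = of_real ((norm x)\<^sup>2 - 2 * Re (cinner x y) + (norm y)\<^sup>2)"
    by (simp add: complex_add_cnj)
  finally show ?thesis using of_real_eq_iff by blast
qed

lemma Re_cinner_le: "Re (cinner x y) \<le> norm x * norm (y::'a::complex_inner)"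
proof (cases "x = 0 \<or> y = 0")
  case False
  \<comment> \<open>This vector vanishes exactly in the case of equality; its squared norm is the
    gap in the inequality times a positive factor.\<close>
  have "(norm (norm y *\<^sub>R x - norm x *\<^sub>R y))\<^sup>2 = 2 * (norm x * norm y) * (norm x * norm y - Re (cinner x y))"
    unfolding power2_norm_diff cinner_scaleR_left cinner_scaleR_right
    by (simp add: power2_eq_square) (simp add: algebra_simps)
  then have "0 \<le> 2 * (norm x * norm y) * (norm x * norm y - Re (cinner x y))"
    by (metis zero_le_power2)
  with False show ?thesis
    by (metis diff_ge_0_iff_ge less_eq_real_def mult_pos_pos norm_ge_zero norm_eq_zero zero_le_mult_iff
        not_le zero_less_numeral)
qed auto

lemma norm_cinner_le: "norm (cinner x y) \<le> norm x * norm (y::'a::complex_inner)"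
proof (cases "cinner x y = 0")
  case False
  \<comment> \<open>The unimodular factor that rotates \<open>cinner x y\<close> onto its modulus,
    which reduces the claim to the real part.\<close>
  define c where "c = cnj (sgn (cinner x y))"
  have "Re (c * cinner x y) = norm (cinner x y)"
    using False by (simp add: c_def sgn_eq complex_norm_square[symmetric] mult.commute
        flip: power2_eq_square) (simp add: power2_eq_square)
  moreover have "Re (c * cinner x y) \<le> norm (c *\<^sub>C x) * norm y"
    using Re_cinner_le[of "c *\<^sub>C x" y] by (simp add: cinner_scaleC_left)
  moreover have "norm c = 1" using False by (simp add: c_def norm_sgn)
  ultimately show ?thesis by (simp add: norm_scaleC)
qed simp

lemma bounded_bilinear_scaleC: "bounded_bilinear ((*\<^sub>C) :: complex \<Rightarrow> 'a::complex_inner \<Rightarrow> 'a)"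
  by (standard) (auto simp: scaleC_add_left scaleC_add_right scaleR_scaleC_left scaleC_scaleR
      norm_scaleC intro!: exI[of _ 1])

lemma bounded_bilinear_cinner: "bounded_bilinear (cinner :: 'a::complex_inner \<Rightarrow> 'a \<Rightarrow> complex)"
  by (standard) (auto simp: cinner_add_left cinner_add_right cinner_scaleR_left cinner_scaleR_right
      norm_cinner_le intro!: exI[of _ 1])

lemmas continuous_on_scaleC [continuous_intros] = bounded_bilinear.continuous_on[OF bounded_bilinear_scaleC]
lemmas continuous_on_cinner [continuous_intros] = bounded_bilinear.continuous_on[OF bounded_bilinear_cinner]
lemmas bounded_linear_scaleC_right = bounded_bilinear.bounded_linear_right[OF bounded_bilinear_scaleC]
lemmas bounded_linear_scaleC_left = bounded_bilinear.bounded_linear_left[OF bounded_bilinear_scaleC]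
lemmas bounded_linear_cinner_left = bounded_bilinear.bounded_linear_left[OF bounded_bilinear_cinner]

lemma cinner_eqI: "(\<And>z. cinner x z = cinner y z) \<Longrightarrow> x = (y::'a::complex_inner)"
  by (metis cinner_diff_left cinner_self eq_iff_diff_eq_0 norm_eq_zero of_real_eq_0_iff
      power_eq_0_iff)

text \<open>Testing with \<open>y = x\<close> and cancelling one norm. Through this rule, bounds on
  scalar integrals of \<open>cinner (T t x) y\<close> become operator bounds.\<close>

lemma norm_leI_cinner:
  assumes "\<And>y. norm (cinner x y) \<le> C * norm y" "0 \<le> C"
  shows "norm (x::'a::complex_inner) \<le> C"
proof (cases "x = 0")
  case False
  then show ?thesis using assms(1)[of x] by (simp add: cinner_self power2_eq_square norm_mult)
qed (use assms in auto)

section \<open>Bessel's inequality for Fourier integrals\<close>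

text \<open>\<open>d - c\<close> is a whole number of periods of every frequency k \<delta>, so the
  antiderivative takes equal values at both ends.\<close>

lemma integral_exp_ii_period:
  fixes \<delta> :: real and c d :: real and k :: int
  assumes "c < d" "\<delta> * (d - c) = 2 * pi" "k \<noteq> 0"
  shows "integral {c..d} (\<lambda>\<xi>. exp (\<i> * of_real (\<xi> * (of_int k * \<delta>)))) = 0"
proof -
  define r where "r = of_int k * \<delta>"
  have r: "r \<noteq> 0" using assms by (auto simp: r_def)
  have "((\<lambda>\<xi>. exp (\<i> * of_real (\<xi> * r))) has_integral
      exp (\<i> * of_real (d * r)) / (\<i> * of_real r) - exp (\<i> * of_real (c * r)) / (\<i> * of_real r)) {c..d}"
  proof (rule fundamental_theorem_of_calculus)
    fix x assume "x \<in> {c..d}"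
    have "((\<lambda>z. exp (\<i> * (z * of_real r)) / (\<i> * of_real r)) has_field_derivative exp (\<i> * (of_real x * of_real r))) (at (of_real x))"
      using r by (auto intro!: derivative_eq_intros simp: field_simps)
    from has_vector_derivative_real_field[OF this]
    show "((\<lambda>\<xi>. exp (\<i> * of_real (\<xi> * r)) / (\<i> * of_real r)) has_vector_derivative exp (\<i> * of_real (x * r))) (at x within {c..d})"
      by simp
  qed (use assms in simp)
  moreover have "exp (\<i> * complex_of_real (d * r)) = exp (\<i> * of_real (c * r))"
  proof -
    have "\<i> * complex_of_real (d * r) = \<i> * of_real (c * r) + 2 * of_int k * of_real pi * \<i>"
    proof -
      have "d * r = c * r + 2 * of_int k * pi"
      proof -
        have "d * r - c * r = of_int k * (\<delta> * (d - c))" by (simp add: r_def algebra_simps)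
        then show ?thesis using assms(2) by simp
      qed
      then show ?thesis by (simp add: algebra_simps)
    qed
    then show ?thesis by (simp add: exp_add exp_integer_2pi mult_ac)
  qed
  ultimately show ?thesis by (simp add: r_def integral_unique)
qed

text \<open>On an interval of length 2 pi / \<delta> the exponentials with frequencies \<theta> + j
  \<delta> are orthogonal with squared norm \<open>d - c\<close>. Subtracting the projections one at
  a time leaves a residual whose nonnegative energy is the claim.\<close>

lemma bessel_finite:
  fixes p :: "real \<Rightarrow> 'h::chilbert_space"
  assumes cd: "c < d" and P: "\<delta> * (d - c) = 2 * pi" and p: "continuous_on {c..d} p"
  shows "(\<Sum>j<m. (norm (integral {c..d} (\<lambda>\<xi>. exp (\<i> * of_real (\<xi> * (\<theta> + real j * \<delta>))) *\<^sub>C p \<xi>)))\<^sup>2)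
     \<le> (d - c) * integral {c..d} (\<lambda>\<xi>. (norm (p \<xi>))\<^sup>2)"
proof -
  define e where "e j \<xi> = exp (\<i> * of_real (\<xi> * (\<theta> + real j * \<delta>)))" for j \<xi>
  define C where "C j = integral {c..d} (\<lambda>\<xi>. e j \<xi> *\<^sub>C p \<xi>)" for j
  \<comment> \<open>The coefficients are integrals against \<open>e j\<close>, so the projection is
    along the conjugate \<open>cnj (e j)\<close>, normalised by \<open>d - c\<close>.\<close>
  define r where "r m \<xi> = p \<xi> - (\<Sum>j<m. (cnj (e j \<xi>) / of_real (d - c)) *\<^sub>C C j)" for m \<xi>
  have ce: "continuous_on S (e j)" for S j
    unfolding e_def by (intro continuous_intros)
  have cr: "continuous_on {c..d} (r m)" for m
    unfolding r_def by (intro continuous_intros p ce) (use cd in auto)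
  have ee: "e j \<xi> * cnj (e l \<xi>) = exp (\<i> * of_real (\<xi> * (of_int (int j - int l) * \<delta>)))" for j l \<xi>
    unfolding e_def exp_cnj exp_add[symmetric] by (rule arg_cong[of _ _ exp]) (simp add: algebra_simps)
  \<comment> \<open>Orthogonality: removing earlier modes leaves all later coefficients untouched,
    which lets the induction peel off mode \<open>m\<close> from the residual.\<close>
  have coef: "integral {c..d} (\<lambda>\<xi>. e j \<xi> *\<^sub>C r m \<xi>) = C j" if "m \<le> j" for j m
  proof -
    have "((\<lambda>\<xi>. (e j \<xi> * (cnj (e l \<xi>) / of_real (d - c))) *\<^sub>C C l) has_integral 0) {c..d}" if "l < m" for l
    proof -
      have "(\<lambda>\<xi>. (e j \<xi> * (cnj (e l \<xi>)))) integrable_on {c..d}"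
        by (intro integrable_continuous_real continuous_intros ce)
      then have "((\<lambda>\<xi>. (e j \<xi> * (cnj (e l \<xi>)))) has_integral 0) {c..d}"
        using integral_exp_ii_period[OF cd P, of "int j - int l"] that \<open>m \<le> j\<close>
        by (simp add: has_integral_integral ee)
      from has_integral_mult_left[OF this, of "1 / of_real (d - c)"]
      have "((\<lambda>\<xi>. (e j \<xi> * (cnj (e l \<xi>) / of_real (d - c)))) has_integral 0) {c..d}"
        by simp
      from has_integral_linear[OF this bounded_linear_scaleC_left[of "C l"]]
      show ?thesis by (simp add: o_def)
    qed
    then have "((\<lambda>\<xi>. \<Sum>l<m. (e j \<xi> * (cnj (e l \<xi>) / of_real (d - c))) *\<^sub>C C l) has_integral (\<Sum>l<m. 0)) {c..d}"
      by (intro has_integral_sum) auto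
    moreover have "((\<lambda>\<xi>. e j \<xi> *\<^sub>C p \<xi>) has_integral C j) {c..d}"
      unfolding C_def by (intro integrable_integral integrable_continuous_real continuous_intros ce p)
    ultimately have "((\<lambda>\<xi>. e j \<xi> *\<^sub>C p \<xi> - (\<Sum>l<m. (e j \<xi> * (cnj (e l \<xi>) / of_real (d - c))) *\<^sub>C C l)) has_integral C j - (\<Sum>l<m. 0)) {c..d}"
      by (rule has_integral_diff[rotated])
    then show ?thesis
      by (simp add: r_def scaleC_diff_right bounded_linear.linear[OF bounded_linear_scaleC_right]
          linear_sum scaleC_scaleC integral_unique)
  qed
  have main: "integral {c..d} (\<lambda>\<xi>. (norm (r m \<xi>))\<^sup>2) = integral {c..d} (\<lambda>\<xi>. (norm (p \<xi>))\<^sup>2) - (\<Sum>j<m. (norm (C j))\<^sup>2) / (d - c)" for m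
  proof (induction m)
    case 0 then show ?case by (simp add: r_def)
  next
    case (Suc m)
    have 1: "r (Suc m) \<xi> = r m \<xi> - (cnj (e m \<xi>) / of_real (d - c)) *\<^sub>C C m" for \<xi>
      by (simp add: r_def)
    have ne: "norm (e m \<xi>) = 1" for \<xi> by (simp add: e_def)
    have 2: "(norm (r (Suc m) \<xi>))\<^sup>2 = (norm (r m \<xi>))\<^sup>2 - 2 / (d - c) * Re (cinner (e m \<xi> *\<^sub>C r m \<xi>) (C m))
        + (norm (C m))\<^sup>2 / (d - c)\<^sup>2" for \<xi>
    proof -
      have "Re (cinner (r m \<xi>) ((cnj (e m \<xi>) / of_real (d - c)) *\<^sub>C C m)) = Re (cinner (e m \<xi> *\<^sub>C r m \<xi>) (C m)) / (d - c)"
        by (simp add: cinner_scaleC_left cinner_scaleC_right del: of_real_diff)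
      moreover have "norm ((cnj (e m \<xi>) / of_real (d - c)) *\<^sub>C C m) = norm (C m) / (d - c)"
        using cd by (simp add: norm_scaleC ne norm_divide del: of_real_diff)
      ultimately show ?thesis by (simp only: 1 power2_norm_diff power_divide) simp
    qed
    have i1: "((\<lambda>\<xi>. (norm (r m \<xi>))\<^sup>2) has_integral integral {c..d} (\<lambda>\<xi>. (norm (p \<xi>))\<^sup>2) - (\<Sum>j<m. (norm (C j))\<^sup>2) / (d - c)) {c..d}"
      unfolding Suc[symmetric] by (intro integrable_integral integrable_continuous_real continuous_intros cr)
    have "((\<lambda>\<xi>. e m \<xi> *\<^sub>C r m \<xi>) has_integral C m) {c..d}"
      unfolding coef[OF order_refl, symmetric]
      by (intro integrable_integral integrable_continuous_real continuous_intros ce cr)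
    from has_integral_linear[OF this bounded_linear_compose[OF bounded_linear_Re bounded_linear_cinner_left[of "C m"]]]
    have "((\<lambda>\<xi>. Re (cinner (e m \<xi> *\<^sub>C r m \<xi>) (C m))) has_integral (norm (C m))\<^sup>2) {c..d}"
      by (simp add: o_def cinner_self)
    from has_integral_mult_right[OF this, of "2 / (d - c)"]
    have i2: "((\<lambda>\<xi>. 2 / (d - c) * Re (cinner (e m \<xi> *\<^sub>C r m \<xi>) (C m))) has_integral 2 / (d - c) * (norm (C m))\<^sup>2) {c..d}" .
    have i3: "((\<lambda>\<xi>. (norm (C m))\<^sup>2 / (d - c)\<^sup>2) has_integral (d - c) * ((norm (C m))\<^sup>2 / (d - c)\<^sup>2)) {c..d}"
      using has_integral_const_real[of "(norm (C m))\<^sup>2 / (d - c)\<^sup>2" c d] cd by simp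
    show ?case
      unfolding 2 using has_integral_add[OF has_integral_diff[OF i1 i2] i3, THEN integral_unique] cd
      by (simp add: power2_eq_square add_divide_distrib)
  qed
  have "0 \<le> integral {c..d} (\<lambda>\<xi>. (norm (r m \<xi>))\<^sup>2)"
    by (intro integral_nonneg integrable_continuous_real continuous_intros cr) auto
  then have "(\<Sum>j<m. (norm (C j))\<^sup>2) / (d - c) \<le> integral {c..d} (\<lambda>\<xi>. (norm (p \<xi>))\<^sup>2)"
    unfolding main by simp
  then show ?thesis using cd by (simp add: C_def e_def field_simps)
qed

lemma continuous_on_fourier:
  fixes p :: "real \<Rightarrow> 'h::chilbert_space"
  assumes p: "continuous_on {c..d} p"
  shows "continuous_on S (\<lambda>s. integral {c..d} (\<lambda>\<xi>. exp (\<i> * of_real (\<xi> * s)) *\<^sub>C p \<xi>))"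
proof -
  have "continuous_on (S \<times> cbox c d) (\<lambda>(s, \<xi>). exp (\<i> * of_real (\<xi> * s)) *\<^sub>C p \<xi>)"
    unfolding split_beta
    by (intro continuous_intros continuous_on_compose2[OF p]) auto
  from integral_continuous_on_param[OF this] show ?thesis by simp
qed

text \<open>An upper Plancherel bound. The s-axis is cut into cells of length \<delta> = 2 pi / (d -
  c) and the integral is folded into one cell: for each offset \<theta> the finite Bessel inequality
  bounds the sum over the cells by the same constant, and \<open>\<delta> * (d - c) = 2 * pi\<close>
  produces the factor.\<close>

lemma bessel_integral:
  fixes p :: "real \<Rightarrow> 'h::chilbert_space"
  assumes cd: "c < d" and p: "continuous_on {c..d} p"
  shows "integral {a..b} (\<lambda>s. (norm (integral {c..d} (\<lambda>\<xi>. exp (\<i> * of_real (\<xi> * s)) *\<^sub>C p \<xi>)))\<^sup>2)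
     \<le> 2 * pi * integral {c..d} (\<lambda>\<xi>. (norm (p \<xi>))\<^sup>2)"
proof -
  define \<delta> where "\<delta> = 2 * pi / (d - c)"
  have P: "\<delta> * (d - c) = 2 * pi" and \<delta>: "\<delta> > 0" using cd by (auto simp: \<delta>_def)
  define F where "F s = (norm (integral {c..d} (\<lambda>\<xi>. exp (\<i> * of_real (\<xi> * s)) *\<^sub>C p \<xi>)))\<^sup>2" for s
  have cF: "continuous_on S F" for S
    unfolding F_def by (intro continuous_intros continuous_on_fourier p)
  have iF: "F integrable_on {x..y}" for x y by (intro integrable_continuous_real cF)
  have F0: "F s \<ge> 0" for s by (simp add: F_def)
  obtain m :: nat where m: "b \<le> a + real m * \<delta>"
    using real_arch_simple[of "(b - a) / \<delta>"] \<delta> by (auto simp: field_simps)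
  have shift: "integral {a..a + real m * \<delta>} F = (\<Sum>j<m. integral {a..a+\<delta>} (\<lambda>\<theta>. F (\<theta> + real j * \<delta>)))" for m
  proof (induction m)
    case (Suc m)
    have "integral {a..a + real (Suc m) * \<delta>} F = integral {a..a + real m * \<delta>} F + integral {a + real m * \<delta>..a + real (Suc m) * \<delta>} F"
      by (rule Henstock_Kurzweil_Integration.integral_combine[symmetric]) (use \<delta> iF in \<open>auto simp: algebra_simps\<close>)
    also have "integral {a + real m * \<delta>..a + real (Suc m) * \<delta>} F = integral {a..a+\<delta>} (\<lambda>\<theta>. F (\<theta> + real m * \<delta>))"
      using integral_shift_Icc_real[of a "a + \<delta>" F "real m * \<delta>"]
      by (simp add: o_def algebra_simps)
    finally show ?case using Suc by simp
  qed simp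
  have "integral {a..b} F \<le> integral {a..a + real m * \<delta>} F"
    by (intro integral_subset_le iF) (use m F0 in auto)
  also have "\<dots> = integral {a..a+\<delta>} (\<lambda>\<theta>. \<Sum>j<m. F (\<theta> + real j * \<delta>))"
    unfolding shift
    by (intro integral_sum[symmetric] integrable_continuous_real continuous_intros continuous_on_compose2[OF cF]) auto
  also have "\<dots> \<le> integral {a..a+\<delta>} (\<lambda>\<theta>. (d - c) * integral {c..d} (\<lambda>\<xi>. (norm (p \<xi>))\<^sup>2))"
  proof (rule integral_le)
    show "(\<lambda>\<theta>. \<Sum>j<m. F (\<theta> + real j * \<delta>)) integrable_on {a..a + \<delta>}"
      by (intro integrable_continuous_real continuous_intros continuous_on_compose2[OF cF]) auto
    show "(\<Sum>j<m. F (\<theta> + real j * \<delta>)) \<le> (d - c) * integral {c..d} (\<lambda>\<xi>. (norm (p \<xi>))\<^sup>2)" for \<theta>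
      unfolding F_def by (rule bessel_finite[OF cd P p])
  qed (rule integrable_const_ivl)
  also have "\<dots> = (\<delta> * (d - c)) * integral {c..d} (\<lambda>\<xi>. (norm (p \<xi>))\<^sup>2)"
    using \<delta> by simp
  also have "\<dots> = 2 * pi * integral {c..d} (\<lambda>\<xi>. (norm (p \<xi>))\<^sup>2)"
    unfolding P ..
  finally show ?thesis unfolding F_def .
qed

section \<open>Bounded semigroups and the quadratic estimate\<close>

lemma integral_exp_le:
  assumes "(b::real) > 0" "0 \<le> L"
  shows "integral {0..L} (\<lambda>s. exp (- 2 * b * s)) \<le> 1 / (2 * b)"
proof -
  have "((\<lambda>s. exp (- 2 * b * s)) has_integral (- exp (- 2 * b * L) / (2 * b) - - exp (- 2 * b * 0) / (2 * b))) {0..L}"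
    by (rule fundamental_theorem_of_calculus)
      (use assms in \<open>auto intro!: derivative_eq_intros simp flip: has_real_derivative_iff_has_vector_derivative\<close>)
  then show ?thesis using assms by (simp add: integral_unique)
qed

text \<open>\<open>M\<close> may be any bound for the semigroup; the supremum enters when the locale
  is interpreted.\<close>

locale bdd_semigroup =
  fixes T :: "real \<Rightarrow> 'h::chilbert_space \<Rightarrow> 'h" and M :: real
  assumes C0: "C0_semigroup T"
    and norm_T: "\<And>t x. 0 \<le> t \<Longrightarrow> norm (T t x) \<le> M * norm x"
    and M_nonneg: "0 \<le> M"
begin

lemma bounded_clinear_T: "0 \<le> t \<Longrightarrow> bounded_clinear (T t)"
  using C0 by (auto simp: C0_semigroup_def)

lemma bounded_linear_T: "0 \<le> t \<Longrightarrow> bounded_linear (T t)"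
  using bounded_clinear_T by (auto simp: bounded_clinear_def)

lemma T_scaleC: "0 \<le> t \<Longrightarrow> T t (c *\<^sub>C x) = c *\<^sub>C T t x"
  using bounded_clinear_T by (auto simp: bounded_clinear_def)

lemma T_zero [simp]: "T 0 x = x"
  using C0 by (auto simp: C0_semigroup_def)

lemma T_add: "0 \<le> s \<Longrightarrow> 0 \<le> t \<Longrightarrow> T (s + t) x = T s (T t x)"
  using C0 by (auto simp: C0_semigroup_def)

lemma T_commute: "0 \<le> s \<Longrightarrow> 0 \<le> t \<Longrightarrow> T s (T t x) = T t (T s x)"
  by (metis T_add add.commute)

lemma T_diff: "0 \<le> t \<Longrightarrow> T t (x - y) = T t x - T t y"
  using bounded_linear_T[of t] by (simp add: bounded_linear.linear linear_diff)

text \<open>The operator at the smaller time factors out of the difference. This yields continuity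
  from the left, although the axioms only give a limit at 0 from the right.\<close>

lemma norm_T_diff_le:
  assumes "0 \<le> s" "0 \<le> t"
  shows "norm (T s x - T t x) \<le> M * norm (T \<bar>s - t\<bar> x - x)"
proof -
  have *: "norm (T b x - T a x) \<le> M * norm (T (b - a) x - x)" if "0 \<le> a" "a \<le> b" for a b
  proof -
    have "T b x - T a x = T a (T (b - a) x - x)"
      using that T_add[of a "b - a" x] by (simp add: T_diff)
    then show ?thesis using norm_T that by simp
  qed
  show ?thesis
    using *[of s t] *[of t s] assms by (cases "s \<le> t") (auto simp: norm_minus_commute abs_if)
qed

lemma T_tendsto_0: "((\<lambda>t. T t x) \<longlongrightarrow> x) (at_right 0)"
  using C0 by (auto simp: C0_semigroup_def)

text \<open>Joint strong continuity: the uniform bound \<open>M\<close> controls the variation of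
  the vector, \<open>norm_T_diff_le\<close> the variation of the time.\<close>

lemma continuous_on_T [continuous_intros]:
  assumes f: "continuous_on S f" and g: "continuous_on S g" and pos: "\<And>s. s \<in> S \<Longrightarrow> 0 \<le> f s"
  shows "continuous_on S (\<lambda>s. T (f s) (g s))"
  unfolding continuous_on_def
proof
  fix s assume s: "s \<in> S"
  have fs: "(f \<longlongrightarrow> f s) (at s within S)" and gs: "(g \<longlongrightarrow> g s) (at s within S)"
    using f g s by (auto simp: continuous_on_def)
  \<comment> \<open>The even extension in r makes the limit at 0 two-sided, so that
    \<open>f s' - f s\<close> can be inserted regardless of its sign.\<close>
  have 0: "((\<lambda>r. T \<bar>r\<bar> (g s) - g s) \<longlongrightarrow> 0) (at 0)"
  proof -
    have R: "((\<lambda>t. T \<bar>t\<bar> (g s) - g s) \<longlongrightarrow> 0) (at_right 0)"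
      using LIM_zero[OF T_tendsto_0[of "g s"]]
      by (rule Lim_transform_eventually) (auto simp: eventually_at_right_field intro!: exI[of _ 1])
    moreover have "((\<lambda>t. T \<bar>t\<bar> (g s) - g s) \<longlongrightarrow> 0) (at_left 0)"
      using R by (simp add: filterlim_at_left_to_right)
    ultimately show ?thesis by (simp add: filterlim_split_at)
  qed
  then have "isCont (\<lambda>r. T \<bar>r\<bar> (g s) - g s) 0" by (simp add: isCont_def)
  from isCont_tendsto_compose[OF this LIM_zero[OF fs]]
  have 1: "((\<lambda>s'. T \<bar>f s' - f s\<bar> (g s) - g s) \<longlongrightarrow> 0) (at s within S)" by simp
  have lim: "((\<lambda>s'. M * norm (g s' - g s) + M * norm (T \<bar>f s' - f s\<bar> (g s) - g s)) \<longlongrightarrow> 0) (at s within S)"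
    using tendsto_add[OF tendsto_mult_right_zero[OF tendsto_norm_zero[OF LIM_zero[OF gs]], of M]
        tendsto_mult_right_zero[OF tendsto_norm_zero[OF 1], of M]] by simp
  have "\<forall>\<^sub>F s' in at s within S. norm (T (f s') (g s') - T (f s) (g s))
        \<le> M * norm (g s' - g s) + M * norm (T \<bar>f s' - f s\<bar> (g s) - g s)"
    unfolding eventually_at_filter
  proof (intro always_eventually allI impI)
    fix s' assume "s' \<in> S"
    have "T (f s') (g s') - T (f s) (g s) = T (f s') (g s' - g s) + (T (f s') (g s) - T (f s) (g s))"
      using pos \<open>s' \<in> S\<close> by (simp add: T_diff)
    then show "norm (T (f s') (g s') - T (f s) (g s))
        \<le> M * norm (g s' - g s) + M * norm (T \<bar>f s' - f s\<bar> (g s) - g s)"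
      using norm_triangle_mono[OF norm_T norm_T_diff_le] pos[OF \<open>s' \<in> S\<close>] pos[OF s] by metis
  qed
  from Lim_null_comparison[OF this lim]
  have "((\<lambda>s'. T (f s') (g s') - T (f s) (g s)) \<longlongrightarrow> 0) (at s within S)" .
  then show "((\<lambda>s'. T (f s') (g s')) \<longlongrightarrow> T (f s) (g s)) (at s within S)"
    by (rule LIM_zero_cancel)
qed

text \<open>Both Hilbert space inequalities are instances of Bessel's inequality: once for the
  trajectory \<open>t \<mapsto> exp (- b t) T t x\<close>, and once for \<open>q\<close> times its Fourier transform. Applying it
  on the outer side instead of to the adjoint semigroup avoids the Riesz representation theorem.\<close>

lemma norm_square_integral_le:
  assumes q: "continuous_on {-N..N} q" and qK: "\<And>\<xi>. norm (q \<xi>) \<le> K" and K: "K > 0"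
    and b: "b > 0" and N: "N > 0" and L: "0 \<le> L"
  defines "\<kappa> \<equiv> \<lambda>t. of_real (exp (- b * t) / (2 * pi)) * integral {-N..N} (\<lambda>\<xi>. q \<xi> * exp (\<i> * of_real (\<xi> * t)))"
  shows "norm (integral {0..L} (\<lambda>s. integral {0..L} (\<lambda>t. \<kappa> (s + t) *\<^sub>C T (s + t) x))) \<le> M\<^sup>2 * K / (2 * b) * norm x"
    and "(\<lambda>s. integral {0..L} (\<lambda>t. \<kappa> (s + t) *\<^sub>C T (s + t) x)) integrable_on {0..L}"
    and "continuous_on UNIV \<kappa>"
proof -
  define u where "u t = of_real (exp (- b * t)) *\<^sub>C T t x" for t
  define uh where "uh \<xi> = integral {0..L} (\<lambda>t. exp (\<i> * of_real (t * \<xi>)) *\<^sub>C u t)" for \<xi>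
  \<comment> \<open>\<open>q\<close> acts as a Fourier multiplier: the damped orbit \<open>u\<close>
    is transformed, multiplied by \<open>q\<close> and transformed a second time.\<close>
  define p where "p \<xi> = q \<xi> *\<^sub>C uh \<xi>" for \<xi>
  define ph where "ph s = integral {-N..N} (\<lambda>\<xi>. exp (\<i> * of_real (\<xi> * s)) *\<^sub>C p \<xi>)" for s
  define J where "J s = integral {0..L} (\<lambda>t. \<kappa> (s + t) *\<^sub>C T (s + t) x)" for s
  have cu: "continuous_on {0..L} u"
    unfolding u_def by (intro continuous_intros) auto
  have cuh: "continuous_on S uh" for S
    unfolding uh_def by (rule continuous_on_fourier[OF cu])
  have cp: "continuous_on {-N..N} p"
    unfolding p_def by (intro continuous_intros q cuh)
  have cph: "continuous_on S ph" for S
    unfolding ph_def by (rule continuous_on_fourier[OF cp])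
  show c\<kappa>: "continuous_on UNIV \<kappa>"
  proof -
    have "continuous_on (UNIV \<times> cbox (-N) N) (\<lambda>(t, \<xi>). q \<xi> * exp (\<i> * of_real (\<xi> * t)))"
      unfolding split_beta by (intro continuous_intros continuous_on_compose2[OF q]) auto
    from integral_continuous_on_param[OF this] show ?thesis
      unfolding \<kappa>_def by (intro continuous_intros) auto
  qed
  \<comment> \<open>After the two integrals are swapped, T(s + t) = T(s) T(t) and the matching split
    of the exponentials pull everything that depends on s alone out of the t-integral.\<close>
  have J: "J s = of_real (exp (- b * s) / (2 * pi)) *\<^sub>C T s (ph s)" if s: "0 \<le> s" for s
  proof -
    define f where "f t \<xi> = (exp (\<i> * of_real (\<xi> * s)) * q \<xi>) *\<^sub>C (exp (\<i> * of_real (t * \<xi>)) *\<^sub>C u t)" for t \<xi>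
    have cf: "continuous_on (cbox (0, -N) (L, N)) (\<lambda>(t, \<xi>). f t \<xi>)"
      unfolding split_beta f_def
      by (intro continuous_intros continuous_on_compose2[OF q] continuous_on_compose2[OF cu]) auto
    have sw: "integral {0..L} (\<lambda>t. integral {-N..N} (f t)) = integral {-N..N} (\<lambda>\<xi>. integral {0..L} (\<lambda>t. f t \<xi>))"
      using integral_swap_continuous[OF cf] by simp
    have "integral {0..L} (\<lambda>t. f t \<xi>) = exp (\<i> * of_real (\<xi> * s)) *\<^sub>C p \<xi>" for \<xi>
    proof -
      have "(\<lambda>t. exp (\<i> * of_real (t * \<xi>)) *\<^sub>C u t) integrable_on {0..L}"
        by (intro integrable_continuous_real continuous_intros cu)
      from integral_linear[OF this bounded_linear_scaleC_right[of "exp (\<i> * of_real (\<xi> * s)) * q \<xi>"]]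
      show ?thesis by (simp add: f_def o_def p_def uh_def scaleC_scaleC)
    qed
    then have *: "integral {0..L} (\<lambda>t. integral {-N..N} (f t)) = ph s"
      unfolding sw ph_def by simp
    have "integral {-N..N} (f t) = (integral {-N..N} (\<lambda>\<xi>. q \<xi> * exp (\<i> * of_real (\<xi> * (s + t)))) * of_real (exp (- b * t))) *\<^sub>C T t x" for t
    proof -
      have "(\<lambda>\<xi>. q \<xi> * exp (\<i> * of_real (\<xi> * (s + t)))) integrable_on {-N..N}"
        by (intro integrable_continuous_real continuous_intros q)
      from integral_linear[OF this bounded_linear_scaleC_left[of "u t"]]
      show ?thesis
        by (simp add: o_def f_def[abs_def] u_def scaleC_scaleC exp_add algebra_simps)
    qed
    then have "\<kappa> (s + t) *\<^sub>C T (s + t) x = of_real (exp (- b * s) / (2 * pi)) *\<^sub>C T s (integral {-N..N} (f t))" if "0 \<le> t" for t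
      using s that by (simp add: T_add T_scaleC scaleC_scaleC \<kappa>_def exp_add[symmetric] algebra_simps exp_diff
          flip: of_real_mult) (simp add: exp_minus exp_add field_simps)
    then have "J s = integral {0..L} (\<lambda>t. of_real (exp (- b * s) / (2 * pi)) *\<^sub>C T s (integral {-N..N} (f t)))"
      unfolding J_def by (intro integral_cong) auto
    also have "\<dots> = of_real (exp (- b * s) / (2 * pi)) *\<^sub>C T s (integral {0..L} (\<lambda>t. integral {-N..N} (f t)))"
    proof -
      have "(\<lambda>t. integral {-N..N} (f t)) integrable_on {0..L}"
      proof (rule integrable_continuous_real)
        have "continuous_on ({0..L} \<times> cbox (-N) N) (\<lambda>(t, \<xi>). f t \<xi>)"
          using cf by (simp add: cbox_Pair_eq)
        from integral_continuous_on_param[OF this] show "continuous_on {0..L} (\<lambda>t. integral {-N..N} (f t))"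
          by simp
      qed
      from integral_linear[OF this bounded_linear_compose[OF bounded_linear_scaleC_right bounded_linear_T[OF s]]]
      show ?thesis by (simp add: o_def)
    qed
    finally show ?thesis unfolding * .
  qed
  have cJ: "continuous_on {0..L} J"
    by (subst continuous_on_cong[OF refl J]) (auto intro!: continuous_intros cph)
  then show "(\<lambda>s. integral {0..L} (\<lambda>t. \<kappa> (s + t) *\<^sub>C T (s + t) x)) integrable_on {0..L}"
    unfolding J_def by (rule integrable_continuous_real)
  have exb: "integral {0..L} (\<lambda>s. exp (- 2 * b * s)) \<le> 1 / (2 * b)"
    by (rule integral_exp_le[OF b L])
  have "integral {0..L} (\<lambda>s. (norm (u s))\<^sup>2) \<le> integral {0..L} (\<lambda>s. (M * norm x)\<^sup>2 * exp (- 2 * b * s))"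
  proof (rule integral_le)
    fix s assume "s \<in> {0..L}"
    then have "(norm (u s))\<^sup>2 \<le> (exp (- b * s) * (M * norm x))\<^sup>2"
      by (intro power_mono) (auto simp: u_def norm_scaleC norm_T)
    then show "(norm (u s))\<^sup>2 \<le> (M * norm x)\<^sup>2 * exp (- 2 * b * s)"
      by (simp add: power_mult_distrib exp_double[symmetric] mult_ac)
  qed (intro integrable_continuous_real continuous_intros cu)+
  also have "\<dots> \<le> (M * norm x)\<^sup>2 * (1 / (2 * b))"
    using mult_left_mono[OF exb, of "(M * norm x)\<^sup>2"] by simp
  finally have e1: "integral {0..L} (\<lambda>s. (norm (u s))\<^sup>2) \<le> (M * norm x)\<^sup>2 / (2 * b)" by simp
  \<comment> \<open>First Bessel inequality, for the orbit; the second, for \<open>ph\<close>, leads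
    to \<open>e4\<close>. Together they give (2 pi)^2, whose root cancels the 1 / (2 pi) in
    \<kappa>.\<close>
  have e2: "integral {-N..N} (\<lambda>s. (norm (uh s))\<^sup>2) \<le> 2 * pi * ((M * norm x)\<^sup>2 / (2 * b))"
  proof (cases "L = 0")
    case True
    then have "uh s = 0" for s by (simp add: uh_def)
    then show ?thesis using b by simp
  next
    case False
    then have "0 < L" using L by simp
    from bessel_integral[OF this cu, of "-N" N] e1 show ?thesis
      unfolding uh_def by (meson order_trans mult_left_mono pi_ge_zero zero_le_mult_iff zero_le_numeral)
  qed
  have "integral {-N..N} (\<lambda>s. (norm (p s))\<^sup>2) \<le> integral {-N..N} (\<lambda>s. K\<^sup>2 * (norm (uh s))\<^sup>2)"
  proof (rule integral_le)
    fix s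
    show "(norm (p s))\<^sup>2 \<le> K\<^sup>2 * (norm (uh s))\<^sup>2"
      unfolding p_def norm_scaleC power_mult_distrib
      by (intro mult_right_mono power_mono qK) auto
  qed (intro integrable_continuous_real continuous_intros cp cuh)+
  also have "\<dots> \<le> K\<^sup>2 * (2 * pi * ((M * norm x)\<^sup>2 / (2 * b)))"
    using mult_left_mono[OF e2, of "K\<^sup>2"] by simp
  finally have e3: "integral {-N..N} (\<lambda>s. (norm (p s))\<^sup>2) \<le> K\<^sup>2 * (2 * pi * ((M * norm x)\<^sup>2 / (2 * b)))" .
  have "integral {0..L} (\<lambda>s. (norm (ph s))\<^sup>2) \<le> 2 * pi * integral {-N..N} (\<lambda>s. (norm (p s))\<^sup>2)"
    unfolding ph_def by (rule bessel_integral) (use N cp in auto)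
  also have "\<dots> \<le> 2 * pi * (K\<^sup>2 * (2 * pi * ((M * norm x)\<^sup>2 / (2 * b))))"
    by (rule mult_left_mono[OF e3]) simp
  finally have e4: "integral {0..L} (\<lambda>s. (norm (ph s))\<^sup>2) \<le> (2 * pi * K * M * norm x)\<^sup>2 / (2 * b)"
    by (simp add: power2_eq_square mult_ac)
  show "norm (integral {0..L} (\<lambda>s. integral {0..L} (\<lambda>t. \<kappa> (s + t) *\<^sub>C T (s + t) x))) \<le> M\<^sup>2 * K / (2 * b) * norm x"
  proof (cases "M * norm x = 0")
    case True
    then have "T s x = 0" if "0 \<le> s" for s using norm_T[OF that, of x] unfolding True by simp
    then have "integral {0..L} (\<lambda>s. integral {0..L} (\<lambda>t. \<kappa> (s + t) *\<^sub>C T (s + t) x)) = integral {0..L} (\<lambda>s. integral {0..L} (\<lambda>t. 0))"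
      by (intro integral_cong) auto
    then show ?thesis using M_nonneg K b by simp
  next
    case False
    \<comment> \<open>The weight that balances 2 x y \<le> l x^2 + y^2 / l, used in place of the
      Cauchy-Schwarz inequality: with this \<open>l\<close> both terms integrate to at most l / (2
      b). It is a divisor, hence the separate case \<open>M * norm x = 0\<close>.\<close>
    define l where "l = 2 * pi * K * M * norm x"
    have l: "l > 0" using False K M_nonneg by (auto simp: l_def less_le)
    have "norm (integral {0..L} J) \<le> integral {0..L} (\<lambda>s. M / (4 * pi) * (l * exp (- 2 * b * s) + (norm (ph s))\<^sup>2 / l))"
    proof (rule integral_norm_bound_integral)
      fix s assume s: "s \<in> {0..L}"
      have "norm (J s) \<le> exp (- b * s) / (2 * pi) * (M * norm (ph s))"
      proof -
        have "norm (J s) = exp (- b * s) / (2 * pi) * norm (T s (ph s))"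
          using s by (simp add: J norm_scaleC norm_divide)
        then show ?thesis using s by (auto intro!: mult_left_mono divide_right_mono norm_T simp del: times_divide_eq_left)
      qed
      also have "exp (- b * s) * norm (ph s) \<le> (l * exp (- 2 * b * s) + (norm (ph s))\<^sup>2 / l) / 2"
      proof -
        have "0 \<le> (l * exp (- b * s) - norm (ph s))\<^sup>2" by simp
        then have "2 * l * (exp (- b * s) * norm (ph s)) \<le> l\<^sup>2 * (exp (- b * s))\<^sup>2 + (norm (ph s))\<^sup>2"
          by (simp add: power2_eq_square algebra_simps)
        also have "(exp (- b * s))\<^sup>2 = exp (- 2 * b * s)" by (simp add: exp_double[symmetric])
        finally show ?thesis using l by (simp add: field_simps power2_eq_square)
      qed
      from mult_left_mono[OF this, of "M / (2 * pi)"] M_nonneg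
      have "M / (2 * pi) * (exp (- b * s) * norm (ph s)) \<le> M / (2 * pi) * ((l * exp (- 2 * b * s) + (norm (ph s))\<^sup>2 / l) / 2)"
        by simp
      then have "exp (- b * s) / (2 * pi) * (M * norm (ph s)) \<le> M / (2 * pi) * ((l * exp (- 2 * b * s) + (norm (ph s))\<^sup>2 / l) / 2)"
        by (simp only: times_divide_eq_left times_divide_eq_right mult_ac)
      finally show "norm (J s) \<le> M / (4 * pi) * (l * exp (- 2 * b * s) + (norm (ph s))\<^sup>2 / l)"
        by simp
    next
      show "J integrable_on {0..L}" by (rule integrable_continuous_real[OF cJ])
      show "(\<lambda>s. M / (4 * pi) * (l * exp (- 2 * b * s) + (norm (ph s))\<^sup>2 / l)) integrable_on {0..L}"
        by (rule integrable_continuous_real, intro continuous_intros cph) (use l in auto)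
    qed
    also have "\<dots> = M / (4 * pi) * (l * integral {0..L} (\<lambda>s. exp (- 2 * b * s)) + integral {0..L} (\<lambda>s. (norm (ph s))\<^sup>2) / l)"
    proof -
      have "((\<lambda>s. M / (4 * pi) * (l * exp (- 2 * b * s) + (norm (ph s))\<^sup>2 / l)) has_integral
         M / (4 * pi) * (l * integral {0..L} (\<lambda>s. exp (- 2 * b * s)) + integral {0..L} (\<lambda>s. (norm (ph s))\<^sup>2) / l)) {0..L}"
        by (intro has_integral_mult_right has_integral_add has_integral_divide integrable_integral
            integrable_continuous_real continuous_intros cph)
      then show ?thesis by (rule integral_unique)
    qed
    also have "\<dots> \<le> M / (4 * pi) * (l * (1 / (2 * b)) + (l\<^sup>2 / (2 * b)) / l)"
      using exb e4 l M_nonneg by (intro mult_left_mono add_mono divide_right_mono) (auto simp: l_def)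
    also have "\<dots> = M\<^sup>2 * K / (2 * b) * norm x"
      using l b by (simp add: l_def field_simps power2_eq_square)
    finally show ?thesis unfolding J_def .
  qed
qed

end

section \<open>Absolutely convergent integrals on the half-line and the plane\<close>

lemma integrable_pair_mult:
  fixes f g :: "real \<Rightarrow> real"
  assumes [measurable]: "integrable lborel f" "integrable lborel g"
  shows "integrable (lborel \<Otimes>\<^sub>M lborel) (\<lambda>(s, t). f s * g t)"
proof (rule lborel_pair.Fubini_integrable)
  show "integrable lborel (\<lambda>x. \<integral>y. norm (case (x, y) of (s, t) \<Rightarrow> f s * g t) \<partial>lborel)"
    using assms by (simp add: abs_mult)
qed (use assms in auto)

text \<open>A nonnegative integrand makes the improper integral absolutely convergent, so a limit of
  the antiderivative gives integrability and value at once.\<close>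

lemma has_bochner_integral_FTC_atLeast:
  fixes f F :: "real \<Rightarrow> real"
  assumes [measurable]: "f \<in> borel_measurable borel"
    and F: "\<And>x. a \<le> x \<Longrightarrow> (F has_real_derivative f x) (at x)"
    and nonneg: "\<And>x. a \<le> x \<Longrightarrow> 0 \<le> f x" and lim: "(F \<longlongrightarrow> L) at_top"
  shows "has_bochner_integral lborel (\<lambda>x. indicator {a..} x * f x) (L - F a)"
proof (rule has_bochner_integral_nn_integral)
  have mono: "F a \<le> F x" if "a \<le> x" for x
    by (rule DERIV_nonneg_imp_nondecreasing[OF that]) (use F nonneg in blast)
  have "F a \<le> L"
    by (rule tendsto_lowerbound[OF lim]) (auto intro: mono eventually_mono[OF eventually_ge_at_top[of a]])
  then show "0 \<le> L - F a" by simp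
  have "(\<integral>\<^sup>+x. ennreal (indicator {a..} x * f x) \<partial>lborel) = (\<integral>\<^sup>+x. ennreal (f x) * indicator {a..} x \<partial>lborel)"
    by (intro nn_integral_cong) (auto simp: indicator_def)
  also have "\<dots> = ennreal (L - F a)"
    by (rule nn_integral_FTC_atLeast) (use F nonneg lim in auto)
  finally show "(\<integral>\<^sup>+x. ennreal (indicator {a..} x * f x) \<partial>lborel) = ennreal (L - F a)" .
qed (auto simp: indicator_def nonneg)

lemma has_bochner_integral_exp_atLeast:
  assumes "(c::real) > 0"
  shows "has_bochner_integral lborel (\<lambda>t. indicator {0..} t * exp (- c * t)) (1 / c)"
proof -
  have "((\<lambda>t. - exp (- c * t) / c) \<longlongrightarrow> - 0 / c) at_top"
    by (intro tendsto_intros filterlim_compose[OF exp_at_bot] filterlim_tendsto_neg_mult_at_bot[OF tendsto_const _ filterlim_ident])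
      (use assms in auto)
  then have "has_bochner_integral lborel (\<lambda>t. indicator {0..} t * exp (- c * t)) (- 0 / c - (- exp (- c * 0) / c))"
    by (intro has_bochner_integral_FTC_atLeast) (use assms in \<open>auto intro!: derivative_eq_intros\<close>)
  then show ?thesis by simp
qed

lemmas integrable_exp_atLeast = integrable.intros[OF has_bochner_integral_exp_atLeast]

section \<open>The weighted estimate on the whole half-line\<close>

context bdd_semigroup
begin

lemma norm_cinner_T: "0 \<le> t \<Longrightarrow> norm (cinner (T t x) y) \<le> M * norm x * norm y"
  by (rule order_trans[OF norm_cinner_le]) (auto intro!: mult_right_mono norm_T)

text \<open>The substitution u = s + t turns the quadrant into the wedge 0 \<le> s \<le> u, and
  integrating out s, on which the integrand no longer depends, produces the weight u. Over truncated
  squares the double integral is bounded by \<open>norm_square_integral_le\<close>; dominated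
  convergence removes the truncations of time and frequency together.\<close>

lemma norm_weighted_integral_le:
  assumes qc: "continuous_on UNIV q" and qi: "integrable lborel q" and qK: "\<And>\<xi>. norm (q \<xi>) \<le> K"
    and K: "K > 0" and b: "b > 0"
  defines "\<kappa> \<equiv> \<lambda>t. of_real (exp (- b * t) / (2 * pi)) * (LINT \<xi>|lborel. q \<xi> * exp (\<i> * of_real (\<xi> * t)))"
  shows "norm (LINT t:{0..}|lborel. of_real t * \<kappa> t * cinner (T t x) y) \<le> M\<^sup>2 * K / (2 * b) * (norm x * norm y)"
proof -
  \<comment> \<open>\<open>Suc\<close> keeps every truncation length positive, as the truncated
    estimate requires.\<close>
  define N where "N n = real (Suc n)" for n
  define \<kappa>n where "\<kappa>n n t = of_real (exp (- b * t) / (2 * pi)) * integral {-N n..N n} (\<lambda>\<xi>. q \<xi> * exp (\<i> * of_real (\<xi> * t)))" for n t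
  \<comment> \<open>Clipping the time at 0 makes \<phi> continuous, hence measurable, on the whole
    line.\<close>
  define \<phi> where "\<phi> u = cinner (T (max 0 u) x) y" for u
  define B where "B = M * norm x * norm y"
  define Q where "Q = (LINT \<xi>|lborel. norm (q \<xi>))"
  define C where "C = Q / (2 * pi) * B"
  have qc': "continuous_on S q" for S by (rule continuous_on_subset[OF qc]) simp
  have [measurable]: "q \<in> borel_measurable borel" by (rule borel_measurable_continuous_onI[OF qc])
  have c\<phi>: "continuous_on UNIV \<phi>" unfolding \<phi>_def by (intro continuous_intros) auto
  then have [measurable]: "\<phi> \<in> borel_measurable borel" by (rule borel_measurable_continuous_onI)
  have \<phi>B: "norm (\<phi> u) \<le> B" for u unfolding \<phi>_def B_def by (rule norm_cinner_T) simp
  have B: "0 \<le> B" using M_nonneg by (simp add: B_def)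
  have Q: "0 \<le> Q" by (simp add: Q_def)
  have [measurable]: "\<kappa> \<in> borel_measurable borel" unfolding \<kappa>_def by measurable
  have c\<kappa>n: "continuous_on UNIV (\<kappa>n n)" for n
    unfolding \<kappa>n_def using norm_square_integral_le(3)[OF qc' qK K b, of "N n" 0] by (simp add: N_def)
  then have [measurable]: "\<kappa>n n \<in> borel_measurable borel" for n by (rule borel_measurable_continuous_onI)
  have qexp: "integrable lborel (\<lambda>\<xi>. q \<xi> * exp (\<i> * of_real (\<xi> * t)))" for t
    by (rule Bochner_Integration.integrable_bound[OF qi]) (auto simp: norm_mult)
  have \<kappa>n_eq: "\<kappa>n n t = of_real (exp (- b * t) / (2 * pi)) * (LINT \<xi>|lborel. indicator {-N n..N n} \<xi> *\<^sub>R (q \<xi> * exp (\<i> * of_real (\<xi> * t))))" for n t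
    unfolding \<kappa>n_def
    by (subst set_borel_integral_eq_integral(2)[symmetric])
      (auto intro!: borel_integrable_atLeastAtMost' continuous_intros qc' simp: set_lebesgue_integral_def)
  have \<kappa>n_bound: "norm (\<kappa>n n t) \<le> exp (- b * t) / (2 * pi) * Q" for n t
  proof -
    have "norm (LINT \<xi>|lborel. indicator {-N n..N n} \<xi> *\<^sub>R (q \<xi> * exp (\<i> * of_real (\<xi> * t)))) \<le> Q"
      unfolding Q_def using qi
      by (intro order_trans[OF integral_norm_bound] integral_mono_AE integrable_norm
          Bochner_Integration.integrable_bound[OF qi])
        (auto simp: norm_mult indicator_def)
    then show ?thesis
      unfolding \<kappa>n_eq norm_mult by (intro mult_mono) (auto simp del: of_real_divide)
  qed
  have \<kappa>n_lim: "(\<lambda>n. \<kappa>n n t) \<longlonglongrightarrow> \<kappa> t" for t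
    unfolding \<kappa>n_eq \<kappa>_def
  proof (intro tendsto_intros integral_dominated_convergence[where w="\<lambda>\<xi>. norm (q \<xi>)"])
    show "AE \<xi> in lborel. (\<lambda>n. indicator {- N n..N n} \<xi> *\<^sub>R (q \<xi> * exp (\<i> * complex_of_real (\<xi> * t)))) \<longlonglongrightarrow> q \<xi> * exp (\<i> * complex_of_real (\<xi> * t))"
    proof (rule AE_I2)
      fix \<xi> :: real
      obtain m :: nat where m: "\<bar>\<xi>\<bar> \<le> real m" using real_arch_simple by blast
      have "\<forall>\<^sub>F n in sequentially. indicator {- N n..N n} \<xi> *\<^sub>R (q \<xi> * exp (\<i> * complex_of_real (\<xi> * t))) = q \<xi> * exp (\<i> * complex_of_real (\<xi> * t))"
        using eventually_ge_at_top[of m] by eventually_elim (use m in \<open>auto simp: N_def indicator_def\<close>)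
      then show "(\<lambda>n. indicator {- N n..N n} \<xi> *\<^sub>R (q \<xi> * exp (\<i> * complex_of_real (\<xi> * t)))) \<longlonglongrightarrow> q \<xi> * exp (\<i> * complex_of_real (\<xi> * t))"
        by (rule tendsto_eventually)
    qed
  qed (use qi in \<open>auto simp: norm_mult indicator_def\<close>)
  define h where "h n p = (indicator {0..N n} (fst p) * indicator {0..N n} (snd p - fst p)) *\<^sub>R (\<kappa>n n (snd p) * \<phi> (snd p))" for n p
  define hl where "hl p = (indicator {0..} (fst p) * indicator {0..} (snd p - fst p)) *\<^sub>R (\<kappa> (snd p) * \<phi> (snd p))" for p :: "real \<times> real"
  \<comment> \<open>On the wedge \<open>fst p \<le> snd p\<close>, so half of the decay in
    \<open>snd p\<close> can be traded for decay in \<open>fst p\<close>. The majorant is then a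
    product of two integrable functions.\<close>
  define w where "w p = (indicator {0..} (fst p) * exp (- (b/2) * fst p)) * (C * (indicator {0..} (snd p) * exp (- (b/2) * snd p)))" for p :: "real \<times> real"
  have wi: "integrable (lborel \<Otimes>\<^sub>M lborel) w"
  proof -
    have *: "integrable lborel (\<lambda>t. indicator {0..} t * exp (- (b/2) * t))"
      by (rule integrable_exp_atLeast) (use b in simp)
    from integrable_pair_mult[OF * integrable_mult_right[OF *, of C]] show ?thesis
      unfolding w_def[abs_def] case_prod_beta' .
  qed
  have hw: "norm (h n p) \<le> w p" for n p
  proof (cases "0 \<le> fst p \<and> fst p \<le> snd p")
    case True
    have "norm (h n p) \<le> norm (\<kappa>n n (snd p)) * norm (\<phi> (snd p))"
      by (simp add: h_def norm_mult indicator_def)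
    also have "\<dots> \<le> (exp (- b * snd p) / (2 * pi) * Q) * B"
      by (intro mult_mono \<kappa>n_bound \<phi>B) (auto simp: Q)
    also have "\<dots> = exp (- b * snd p) * C" by (simp add: C_def)
    also have "\<dots> \<le> (exp (- (b/2) * fst p) * exp (- (b/2) * snd p)) * C"
    proof (rule mult_right_mono)
      have "b * fst p \<le> b * snd p" using True b by (intro mult_left_mono) auto
      then show "exp (- b * snd p) \<le> exp (- (b/2) * fst p) * exp (- (b/2) * snd p)"
        by (simp flip: exp_add)
    qed (use Q B in \<open>simp add: C_def\<close>)
    also have "\<dots> = w p" using True by (simp add: w_def)
    finally show ?thesis .
  next
    case False
    then have "h n p = 0" by (auto simp: h_def indicator_def)
    then show ?thesis using Q B by (simp add: w_def C_def)
  qed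
  have [measurable]: "h n \<in> borel_measurable (lborel \<Otimes>\<^sub>M lborel)" for n
    unfolding h_def[abs_def] by measurable
  have [measurable]: "hl \<in> borel_measurable (lborel \<Otimes>\<^sub>M lborel)"
    unfolding hl_def[abs_def] by measurable
  have hlim: "(\<lambda>n. h n p) \<longlonglongrightarrow> hl p" for p
  proof -
    obtain m :: nat where m: "\<bar>fst p\<bar> + \<bar>snd p - fst p\<bar> \<le> real m" using real_arch_simple by blast
    have "\<forall>\<^sub>F n in sequentially. (indicator {0..} (fst p) * indicator {0..} (snd p - fst p)) *\<^sub>R (\<kappa>n n (snd p) * \<phi> (snd p)) = h n p"
      using eventually_ge_at_top[of m] by eventually_elim (use m in \<open>auto simp: N_def h_def indicator_def\<close>)
    moreover have "(\<lambda>n. (indicator {0..} (fst p) * indicator {0..} (snd p - fst p)) *\<^sub>R (\<kappa>n n (snd p) * \<phi> (snd p))) \<longlonglongrightarrow> hl p"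
      unfolding hl_def by (intro tendsto_intros \<kappa>n_lim)
    ultimately show ?thesis by (rule Lim_transform_eventually[rotated])
  qed
  have hi: "integrable (lborel \<Otimes>\<^sub>M lborel) (h n)" for n
    by (rule Bochner_Integration.integrable_bound[OF wi]) (auto intro!: AE_I2 order_trans[OF hw])
  have hli: "integrable (lborel \<Otimes>\<^sub>M lborel) hl" and
    lim: "(\<lambda>n. \<integral>p. h n p \<partial>(lborel \<Otimes>\<^sub>M lborel)) \<longlonglongrightarrow> (\<integral>p. hl p \<partial>(lborel \<Otimes>\<^sub>M lborel))"
    by (rule integrable_dominated_convergence[where w=w and s=h] integral_dominated_convergence[where w=w];
        auto intro!: wi AE_I2 hlim hw)+
  have hbound: "norm (\<integral>p. h n p \<partial>(lborel \<Otimes>\<^sub>M lborel)) \<le> M\<^sup>2 * K / (2 * b) * (norm x * norm y)" for n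
  proof -
    have Npos: "0 < N n" "0 \<le> N n" by (auto simp: N_def)
    define F where "F s = integral {0..N n} (\<lambda>t. \<kappa>n n (s + t) *\<^sub>C T (s + t) x)" for s
    have Fi: "F integrable_on {0..N n}" and Fn: "norm (integral {0..N n} F) \<le> M\<^sup>2 * K / (2 * b) * norm x"
      unfolding F_def[abs_def] \<kappa>n_def
      using norm_square_integral_le(1,2)[OF qc' qK K b Npos, of x] by auto
    have c\<kappa>n': "continuous_on S (\<kappa>n n)" for S by (rule continuous_on_subset[OF c\<kappa>n]) simp
    have c\<phi>': "continuous_on S \<phi>" for S by (rule continuous_on_subset[OF c\<phi>]) simp
    have inner: "(\<integral>u. h n (s, u) \<partial>lborel) = indicator {0..N n} s *\<^sub>R cinner (F s) y" for s
    proof (cases "s \<in> {0..N n}")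
      case True
      have "(\<integral>u. h n (s, u) \<partial>lborel) = (\<integral>t. h n (s, s + t) \<partial>lborel)"
        using lborel_integral_real_affine[of 1 "\<lambda>u. h n (s, u)" s] by simp
      also have "\<dots> = (LINT t:{0..N n}|lborel. \<kappa>n n (s + t) * \<phi> (s + t))"
        using True by (simp add: h_def set_lebesgue_integral_def)
      also have "\<dots> = integral {0..N n} (\<lambda>t. \<kappa>n n (s + t) * \<phi> (s + t))"
        by (intro set_borel_integral_eq_integral borel_integrable_atLeastAtMost' continuous_intros
            continuous_on_compose2[OF c\<kappa>n] continuous_on_compose2[OF c\<phi>]) auto
      also have "\<dots> = integral {0..N n} (\<lambda>t. cinner (\<kappa>n n (s + t) *\<^sub>C T (s + t) x) y)"
        using True by (intro integral_cong) (auto simp: \<phi>_def cinner_scaleC_left)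
      also have "\<dots> = cinner (F s) y"
      proof -
        have "(\<lambda>t. \<kappa>n n (s + t) *\<^sub>C T (s + t) x) integrable_on {0..N n}"
          using True by (intro integrable_continuous_real continuous_intros continuous_on_compose2[OF c\<kappa>n]) auto
        from integral_linear[OF this bounded_linear_cinner_left[of y]] show ?thesis
          by (simp add: o_def F_def)
      qed
      finally show ?thesis using True by simp
    qed (simp add: h_def)
    have "(\<integral>p. h n p \<partial>(lborel \<Otimes>\<^sub>M lborel)) = (\<integral>s. \<integral>u. h n (s, u) \<partial>lborel \<partial>lborel)"
      by (rule lborel_pair.integral_fst'[OF hi, symmetric])
    also have "\<dots> = (LINT s:{0..N n}|lborel. cinner (F s) y)"
      by (simp add: inner set_lebesgue_integral_def)
    also have "\<dots> = integral {0..N n} (\<lambda>s. cinner (F s) y)"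
    proof (rule set_borel_integral_eq_integral)
      show "set_integrable lborel {0..N n} (\<lambda>s. cinner (F s) y)"
        unfolding set_integrable_def inner[symmetric] by (rule lborel_pair.integrable_fst'[OF hi])
    qed
    also have "\<dots> = cinner (integral {0..N n} F) y"
      using integral_linear[OF Fi bounded_linear_cinner_left[of y]] by (simp add: o_def)
    also have "norm \<dots> \<le> norm (integral {0..N n} F) * norm y" by (rule norm_cinner_le)
    also have "\<dots> \<le> (M\<^sup>2 * K / (2 * b) * norm x) * norm y" by (intro mult_right_mono Fn) auto
    finally show ?thesis by (simp add: mult.assoc)
  qed
  \<comment> \<open>With s integrated first, the slice at u is {0..u}, and its length is the
    weight.\<close>
  have "(\<integral>p. hl p \<partial>(lborel \<Otimes>\<^sub>M lborel)) = (\<integral>u. \<integral>s. hl (s, u) \<partial>lborel \<partial>lborel)"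
    using lborel_pair.integral_snd[of "curry hl"] hli by (simp add: curry_def)
  also have "\<dots> = (\<integral>u. indicator {0..} u *\<^sub>R (of_real u * \<kappa> u * cinner (T u x) y) \<partial>lborel)"
  proof (intro Bochner_Integration.integral_cong refl)
    fix u :: real
    have "hl (s, u) = indicator {0..u} s *\<^sub>R (\<kappa> u * \<phi> u)" for s
      by (auto simp: hl_def indicator_def)
    then show "(\<integral>s. hl (s, u) \<partial>lborel) = indicator {0..} u *\<^sub>R (of_real u * \<kappa> u * cinner (T u x) y)"
      by (cases "0 \<le> u") (simp_all add: \<phi>_def scaleR_conv_of_real)
  qed
  finally have "(LINT t:{0..}|lborel. of_real t * \<kappa> t * cinner (T t x) y) = (\<integral>p. hl p \<partial>(lborel \<Otimes>\<^sub>M lborel))"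
    by (simp add: set_lebesgue_integral_def)
  then show ?thesis
    using tendsto_upperbound[OF tendsto_norm[OF lim], of "M\<^sup>2 * K / (2 * b) * (norm x * norm y)"] hbound by simp
qed

end

section \<open>Complex measures on the half-line as functionals\<close>

definition bcont :: "(real \<Rightarrow> complex) set" where
  "bcont = {g. continuous_on {0..} g \<and> bounded (g ` {0..})}"

text \<open>Complex measures on the half-line enter only through integration of functions in \<^term>\<open>bcont\<close>,
  of which nothing but linearity and bounded convergence is needed. Unlike measures, such functionals
  are closed under linear combinations and convolution by elementary arguments.\<close>

definition measure_functional :: "((real \<Rightarrow> complex) \<Rightarrow> complex) \<Rightarrow> bool" where
  "measure_functional L \<longleftrightarrow>
     (\<forall>g\<in>bcont. \<forall>h\<in>bcont. L (\<lambda>t. g t + h t) = L g + L h) \<and>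
     (\<forall>c. \<forall>g\<in>bcont. L (\<lambda>t. c * g t) = c * L g) \<and>
     (\<forall>G g B. (\<forall>n. G n \<in> bcont) \<longrightarrow> g \<in> bcont \<longrightarrow> (\<forall>n. \<forall>t\<ge>0. norm (G n t) \<le> B) \<longrightarrow>
        (\<forall>t\<ge>0. (\<lambda>n. G n t) \<longlonglongrightarrow> g t) \<longrightarrow> (\<lambda>n. L (G n)) \<longlonglongrightarrow> L g)"

lemma bcontI: "continuous_on {0..} g \<Longrightarrow> (\<And>t. 0 \<le> t \<Longrightarrow> norm (g t) \<le> B) \<Longrightarrow> g \<in> bcont"
  by (auto simp: bcont_def intro!: boundedI)

lemma bcont_continuous: "g \<in> bcont \<Longrightarrow> continuous_on {0..} g"
  by (auto simp: bcont_def)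

lemma bcont_bound:
  assumes "g \<in> bcont"
  obtains B where "0 < B" "\<And>t. 0 \<le> t \<Longrightarrow> norm (g t) \<le> B"
proof -
  from assms obtain B where "0 < B" "\<forall>x\<in>g ` {0..}. norm x \<le> B"
    by (auto simp: bcont_def bounded_pos)
  then show ?thesis using that by auto
qed

lemma bcont_add: "g \<in> bcont \<Longrightarrow> h \<in> bcont \<Longrightarrow> (\<lambda>t. g t + h t) \<in> bcont"
proof -
  assume g: "g \<in> bcont" and h: "h \<in> bcont"
  obtain B where "\<And>t. 0 \<le> t \<Longrightarrow> norm (g t) \<le> B" using bcont_bound[OF g] by blast
  moreover obtain C where "\<And>t. 0 \<le> t \<Longrightarrow> norm (h t) \<le> C" using bcont_bound[OF h] by blast
  ultimately show ?thesis
    by (intro bcontI[of _ "B + C"] continuous_on_add bcont_continuous[OF g] bcont_continuous[OF h] norm_triangle_mono)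
qed

lemma bcont_mult: "g \<in> bcont \<Longrightarrow> h \<in> bcont \<Longrightarrow> (\<lambda>t. g t * h t) \<in> bcont"
proof -
  assume g: "g \<in> bcont" and h: "h \<in> bcont"
  obtain B where "0 < B" "\<And>t. 0 \<le> t \<Longrightarrow> norm (g t) \<le> B" using bcont_bound[OF g] by blast
  moreover obtain C where "\<And>t. 0 \<le> t \<Longrightarrow> norm (h t) \<le> C" using bcont_bound[OF h] by blast
  ultimately show ?thesis
    by (intro bcontI[of _ "B * C"] continuous_on_mult bcont_continuous[OF g] bcont_continuous[OF h])
      (auto simp: norm_mult intro!: mult_mono)
qed

lemma bcont_const [simp]: "(\<lambda>t. c) \<in> bcont"
  by (rule bcontI[of _ "norm c"]) auto

lemma bcont_cmult: "g \<in> bcont \<Longrightarrow> (\<lambda>t. c * g t) \<in> bcont"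
  by (rule bcont_mult) auto

lemma bcont_exp: "0 \<le> Re z \<Longrightarrow> (\<lambda>t. exp (- z * of_real t)) \<in> bcont"
  by (rule bcontI[of _ 1]) (auto intro!: continuous_intros)

lemma bcont_shift: "g \<in> bcont \<Longrightarrow> 0 \<le> s \<Longrightarrow> (\<lambda>t. g (s + t)) \<in> bcont"
proof -
  assume g: "g \<in> bcont" and s: "0 \<le> s"
  obtain B where "\<And>t. 0 \<le> t \<Longrightarrow> norm (g t) \<le> B" using bcont_bound[OF g] by blast
  then show ?thesis using s
    by (intro bcontI[of _ B] continuous_on_compose2[OF bcont_continuous[OF g]] continuous_intros) auto
qed

lemma mf_add: "measure_functional L \<Longrightarrow> g \<in> bcont \<Longrightarrow> h \<in> bcont \<Longrightarrow> L (\<lambda>t. g t + h t) = L g + L h"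
  and mf_mult: "measure_functional L \<Longrightarrow> g \<in> bcont \<Longrightarrow> L (\<lambda>t. c * g t) = c * L g"
  by (auto simp: measure_functional_def)

lemma mf_lim:
  assumes "measure_functional L" "\<And>n. G n \<in> bcont" "g \<in> bcont" "\<And>n t. 0 \<le> t \<Longrightarrow> norm (G n t) \<le> B"
    "\<And>t. 0 \<le> t \<Longrightarrow> (\<lambda>n. G n t) \<longlonglongrightarrow> g t"
  shows "(\<lambda>n. L (G n)) \<longlonglongrightarrow> L g"
  using assms unfolding measure_functional_def by blast

text \<open>Functions in \<open>bcont\<close> are unrestricted at negative times. The constant
  sequence \<open>g\<close> converges to \<open>h\<close> on {0..}, and the convergence axiom then
  equates the two values.\<close>

lemma mf_cong:
  assumes L: "measure_functional L" and g: "g \<in> bcont" and h: "h \<in> bcont"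
    and eq: "\<And>t. 0 \<le> t \<Longrightarrow> g t = h t"
  shows "L g = L h"
proof -
  obtain B where "\<And>t. 0 \<le> t \<Longrightarrow> norm (g t) \<le> B" using bcont_bound[OF g] by blast
  then have "(\<lambda>n::nat. L g) \<longlonglongrightarrow> L h"
    by (intro mf_lim[OF L g h]) (auto simp: eq)
  then show ?thesis by (simp add: LIMSEQ_const_iff)
qed

lemma mf_zero: "measure_functional L \<Longrightarrow> L (\<lambda>t. 0) = 0"
  using mf_mult[of L "\<lambda>t. 0" 0] by simp

lemma mf_sum:
  assumes "measure_functional L" "finite I" "\<And>i. i \<in> I \<Longrightarrow> g i \<in> bcont"
  shows "L (\<lambda>t. \<Sum>i\<in>I. g i t) = (\<Sum>i\<in>I. L (g i)) \<and> (\<lambda>t. \<Sum>i\<in>I. g i t) \<in> bcont"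
  using assms(2,3)
  by (induction I) (auto simp: mf_zero assms(1) mf_add[OF assms(1)] bcont_add)

text \<open>Boundedness is hidden in the convergence axiom: if it failed, suitably scaled
  counterexamples would tend to 0 uniformly on {0..} while their values stayed at least 1 in
  modulus.\<close>

lemma mf_bounded:
  assumes L: "measure_functional L"
  shows "\<exists>C\<ge>0. \<forall>g\<in>bcont. \<forall>B. (\<forall>t\<ge>0. norm (g t) \<le> B) \<longrightarrow> norm (L g) \<le> C * B"
proof (rule ccontr)
  assume "\<not> ?thesis"
  then have "\<exists>g B. g \<in> bcont \<and> (\<forall>t\<ge>0. norm (g t) \<le> B) \<and> \<not> norm (L g) \<le> real (Suc n) * B" for n
    by (meson of_nat_0_le_iff)
  then obtain g B where g: "\<And>n. g n \<in> bcont" and gB: "\<And>n t. 0 \<le> t \<Longrightarrow> norm (g n t) \<le> B n"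
    and Lg: "\<And>n. norm (L (g n)) > real (Suc n) * B n"
    by (metis not_le)
  have B: "B n > 0" for n
  proof (rule ccontr)
    assume "\<not> B n > 0"
    then have "g n t = 0" if "0 \<le> t" for t using gB[OF that, of n] by (smt (verit) norm_le_zero_iff)
    then have "L (g n) = 0" using mf_cong[OF L g[of n], of "\<lambda>t. 0"] mf_zero[OF L] by simp
    moreover have "B n \<ge> 0" using gB[of 0 n] by (smt (verit) norm_ge_zero)
    ultimately show False using Lg[of n] by (simp add: mult_less_0_iff)
  qed
  define G where "G n t = (1 / of_real (real (Suc n) * B n)) * g n t" for n t
  have GB: "norm (G n t) \<le> inverse (real (Suc n))" if "0 \<le> t" for n t
    using gB[OF that, of n] B[of n]
    by (simp add: G_def norm_mult norm_divide divide_simps del: of_nat_Suc)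
  have "(\<lambda>n. L (G n)) \<longlonglongrightarrow> L (\<lambda>t. 0)"
  proof (rule mf_lim[OF L])
    show "G n \<in> bcont" for n unfolding G_def[abs_def] by (rule bcont_cmult[OF g])
    show "norm (G n t) \<le> 1" if "0 \<le> t" for n t
      using GB[OF that, of n] by (rule order_trans) (simp add: divide_simps)
    show "(\<lambda>n. G n t) \<longlonglongrightarrow> 0" if "0 \<le> t" for t
      by (rule Lim_null_comparison[OF _ LIMSEQ_inverse_real_of_nat])
        (rule always_eventually, rule allI, rule GB[OF that])
  qed simp
  then have "(\<lambda>n. norm (L (G n))) \<longlonglongrightarrow> 0" by (simp add: mf_zero[OF L] tendsto_norm_zero)
  moreover have "1 \<le> norm (L (G n))" for n
    using Lg[of n] B[of n] unfolding G_def[abs_def] mf_mult[OF L g]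
    by (simp add: norm_mult norm_divide divide_simps del: of_nat_Suc)
  ultimately show False using LIMSEQ_le_const[of _ 0 1] by fastforce
qed

lemma mf_comb:
  assumes "measure_functional L" "measure_functional L'"
  shows "measure_functional (\<lambda>g. a * L g + b * L' g)"
  unfolding measure_functional_def
proof (intro conjI ballI allI impI)
  fix G g and B :: real
  assume "\<forall>n. G n \<in> bcont" "g \<in> bcont" "\<forall>n. \<forall>t\<ge>0. norm (G n t) \<le> B" "\<forall>t\<ge>0. (\<lambda>n. G n t) \<longlonglongrightarrow> g t"
  then show "(\<lambda>n. a * L (G n) + b * L' (G n)) \<longlonglongrightarrow> a * L g + b * L' g"
    by (intro tendsto_intros mf_lim[OF assms(1), where B=B] mf_lim[OF assms(2), where B=B]) auto
qed (auto simp: mf_add[OF assms(1)] mf_add[OF assms(2)] mf_mult[OF assms(1)] mf_mult[OF assms(2)] algebra_simps)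

lemma mf_eval: "0 \<le> \<tau> \<Longrightarrow> measure_functional (\<lambda>g. g \<tau>)"
  by (auto simp: measure_functional_def)

text \<open>Makes the inner evaluation of a convolution admissible for the outer functional;
  continuity in s is the convergence axiom along sequences of shifts.\<close>

lemma mf_shift_bcont:
  assumes L: "measure_functional L" and g: "g \<in> bcont"
  shows "(\<lambda>s. L (\<lambda>t. g (s + t))) \<in> bcont"
proof -
  obtain B where B: "\<And>t. 0 \<le> t \<Longrightarrow> norm (g t) \<le> B" using bcont_bound[OF g] by blast
  obtain C where C: "\<And>g B. g\<in>bcont \<Longrightarrow> (\<forall>t\<ge>0. norm (g t) \<le> B) \<Longrightarrow> norm (L g) \<le> C * B"
    using mf_bounded[OF L] by blast
  show ?thesis
  proof (rule bcontI[of _ "C * B"])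
    show "norm (L (\<lambda>t. g (s + t))) \<le> C * B" if "0 \<le> s" for s
      using that by (intro C bcont_shift g) (auto intro: B)
    show "continuous_on {0..} (\<lambda>s. L (\<lambda>t. g (s + t)))"
      unfolding continuous_on_sequentially
    proof (intro allI ballI impI)
      fix x :: "nat \<Rightarrow> real" and a :: real
      assume "a \<in> {0..}" and x: "(\<forall>n. x n \<in> {0..}) \<and> x \<longlonglongrightarrow> a"
      then have "(\<lambda>n. L (\<lambda>t. g (x n + t))) \<longlonglongrightarrow> L (\<lambda>t. g (a + t))"
      proof (intro mf_lim[OF L, where B=B] bcont_shift g)
        fix t :: real assume t: "0 \<le> t"
        show "(\<lambda>n. g (x n + t)) \<longlonglongrightarrow> g (a + t)"
          using x \<open>a \<in> _\<close> t
          by (intro continuous_on_tendsto_compose[OF bcont_continuous[OF g]] tendsto_intros) auto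
      qed (auto intro: B)
      then show "((\<lambda>s. L (\<lambda>t. g (s + t))) \<circ> x) \<longlonglongrightarrow> L (\<lambda>t. g (a + t))" by (simp add: o_def)
    qed
  qed
qed

text \<open>The convolution of two measures as an iterated evaluation. \<open>mf_bounded\<close> for
  the inner functional supplies the uniform bound under which the outer limit is taken.\<close>

lemma mf_convolution:
  assumes L: "measure_functional L" and L': "measure_functional L'"
  shows "measure_functional (\<lambda>g. L (\<lambda>s. L' (\<lambda>t. g (s + t))))"
  unfolding measure_functional_def
proof (intro conjI ballI allI impI)
  fix g h assume g: "g \<in> bcont" and h: "h \<in> bcont"
  have "L (\<lambda>s. L' (\<lambda>t. g (s + t) + h (s + t))) = L (\<lambda>s. L' (\<lambda>t. g (s + t)) + L' (\<lambda>t. h (s + t)))"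
    by (rule mf_cong[OF L mf_shift_bcont[OF L' bcont_add[OF g h]]])
      (auto intro!: mf_shift_bcont[OF L'] bcont_add g h mf_add[OF L'] bcont_shift)
  also have "\<dots> = L (\<lambda>s. L' (\<lambda>t. g (s + t))) + L (\<lambda>s. L' (\<lambda>t. h (s + t)))"
    by (intro mf_add[OF L] mf_shift_bcont[OF L'] g h)
  finally show "L (\<lambda>s. L' (\<lambda>t. g (s + t) + h (s + t))) = L (\<lambda>s. L' (\<lambda>t. g (s + t))) + L (\<lambda>s. L' (\<lambda>t. h (s + t)))" .
next
  fix c g assume g: "g \<in> bcont"
  have "L (\<lambda>s. L' (\<lambda>t. c * g (s + t))) = L (\<lambda>s. c * L' (\<lambda>t. g (s + t)))"
    by (rule mf_cong[OF L mf_shift_bcont[OF L' bcont_cmult[OF g]]])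
      (auto intro!: mf_shift_bcont[OF L'] bcont_cmult g mf_mult[OF L'] bcont_shift)
  also have "\<dots> = c * L (\<lambda>s. L' (\<lambda>t. g (s + t)))"
    by (intro mf_mult[OF L] mf_shift_bcont[OF L'] g)
  finally show "L (\<lambda>s. L' (\<lambda>t. c * g (s + t))) = c * L (\<lambda>s. L' (\<lambda>t. g (s + t)))" .
next
  fix G g and B :: real
  assume G: "\<forall>n. G n \<in> bcont" and g: "g \<in> bcont" and GB: "\<forall>n. \<forall>t\<ge>0. norm (G n t) \<le> B"
    and lim: "\<forall>t\<ge>0. (\<lambda>n. G n t) \<longlonglongrightarrow> g t"
  obtain C where C: "\<And>g B. g\<in>bcont \<Longrightarrow> (\<forall>t\<ge>0. norm (g t) \<le> B) \<Longrightarrow> norm (L' g) \<le> C * B"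
    using mf_bounded[OF L'] by blast
  show "(\<lambda>n. L (\<lambda>s. L' (\<lambda>t. G n (s + t)))) \<longlonglongrightarrow> L (\<lambda>s. L' (\<lambda>t. g (s + t)))"
  proof (rule mf_lim[OF L, where B="C * B"])
    show "(\<lambda>s. L' (\<lambda>t. G n (s + t))) \<in> bcont" for n using mf_shift_bcont[OF L'] G by blast
    show "(\<lambda>s. L' (\<lambda>t. g (s + t))) \<in> bcont" by (rule mf_shift_bcont[OF L' g])
    show "norm (L' (\<lambda>t. G n (s + t))) \<le> C * B" if "0 \<le> s" for n s
      using that GB G by (intro C bcont_shift) auto
    show "(\<lambda>n. L' (\<lambda>t. G n (s + t))) \<longlonglongrightarrow> L' (\<lambda>t. g (s + t))" if "0 \<le> s" for s
      using that GB G g lim by (intro mf_lim[OF L', where B=B] bcont_shift) auto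
  qed
qed

lemma mf_integral:
  assumes sets: "sets m = sets (restrict_space borel {0..})" and k: "integrable m k"
  shows "measure_functional (\<lambda>g. \<integral>t. k t * g t \<partial>m)"
    and "g \<in> bcont \<Longrightarrow> integrable m (\<lambda>t. k t * g t)"
    and "g \<in> bcont \<Longrightarrow> g \<in> borel_measurable m"
proof -
  have sp: "space m = {0..}" using sets_eq_imp_space_eq[OF sets] by (simp add: space_restrict_space)
  show meas: "g \<in> borel_measurable m" if "g \<in> bcont" for g
    using borel_measurable_continuous_on_restrict[OF bcont_continuous[OF that]]
    by (subst measurable_cong_sets[OF sets refl])
  have [measurable]: "k \<in> borel_measurable m" using k by simp
  show int: "integrable m (\<lambda>t. k t * g t)" if g: "g \<in> bcont" for g
  proof -
    obtain B where B: "0 < B" "\<And>t. 0 \<le> t \<Longrightarrow> norm (g t) \<le> B" using bcont_bound[OF g] by blast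
    note [measurable] = meas[OF g]
    have "integrable m (\<lambda>t. of_real B * k t)" using k by simp
    then show ?thesis
      by (rule Bochner_Integration.integrable_bound)
        (use \<open>0 < B\<close> in \<open>auto simp: norm_mult sp mult.commute[of B] intro!: AE_I2 mult_left_mono B\<close>)
  qed
  show "measure_functional (\<lambda>g. \<integral>t. k t * g t \<partial>m)"
    unfolding measure_functional_def
  proof (intro conjI ballI allI impI)
    fix g h assume "g \<in> bcont" "h \<in> bcont"
    then show "(\<integral>t. k t * (g t + h t) \<partial>m) = (\<integral>t. k t * g t \<partial>m) + (\<integral>t. k t * h t \<partial>m)"
      by (simp add: distrib_left int)
  next
    fix c g assume "g \<in> bcont"
    then show "(\<integral>t. k t * (c * g t) \<partial>m) = c * (\<integral>t. k t * g t \<partial>m)"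
      by (simp add: mult.left_commute[of _ c])
  next
    fix G g and B :: real
    assume G: "\<forall>n. G n \<in> bcont" and g: "g \<in> bcont" and GB: "\<forall>n. \<forall>t\<ge>0. norm (G n t) \<le> B"
      and lim: "\<forall>t\<ge>0. (\<lambda>n. G n t) \<longlonglongrightarrow> g t"
    have [measurable]: "G n \<in> borel_measurable m" for n using G meas by blast
    note [measurable] = meas[OF g]
    show "(\<lambda>n. \<integral>t. k t * G n t \<partial>m) \<longlonglongrightarrow> (\<integral>t. k t * g t \<partial>m)"
    proof (rule integral_dominated_convergence[where w="\<lambda>t. norm (k t) * B"])
      show "AE x in m. (\<lambda>i. k x * G i x) \<longlonglongrightarrow> k x * g x"
        using lim by (intro AE_I2 tendsto_intros) (auto simp: sp)
      show "AE x in m. norm (k x * G i x) \<le> norm (k x) * B" for i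
        using GB by (intro AE_I2) (auto simp: sp norm_mult intro!: mult_left_mono)
    qed (use k in auto)
  qed
qed

text \<open>With x = exp (- t) the hypothesis says that all monomials x^n with n >= 1 are
  annihilated. The Bernstein polynomials of a function vanishing at 0 contain only such monomials,
  and they converge uniformly.\<close>

lemma mf_unique_aux:
  assumes L: "measure_functional L" and exp0: "\<And>n::nat. 1 \<le> n \<Longrightarrow> L (\<lambda>t. exp (- of_nat n * of_real t)) = 0"
    and h: "continuous_on {0..1} h" and h0: "h 0 = 0"
  shows "L (\<lambda>t. h (exp (- t))) = 0"
proof -
  have bx: "(\<lambda>t. of_real (exp (- t) ^ k * (1 - exp (- t)) ^ m)) \<in> bcont" for k m
    by (rule bcontI[of _ 1]) (auto intro!: continuous_intros mult_le_one power_le_one simp: norm_mult norm_power simp del: of_real_mult of_real_power)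
  \<comment> \<open>Induction on \<open>m\<close> by x^k (1 - x)^(m + 1) = x^k (1 - x)^m - x^(k + 1)
    (1 - x)^m, for all \<open>k\<close> at once.\<close>
  have P: "L (\<lambda>t. of_real (exp (- t) ^ k * (1 - exp (- t)) ^ m)) = 0" if "1 \<le> k" for k m
    using that
  proof (induction m arbitrary: k)
    case 0
    have "(\<lambda>t. complex_of_real (exp (- t) ^ k * (1 - exp (- t)) ^ 0)) = (\<lambda>t. exp (- of_nat k * of_real t))"
      by (simp add: fun_eq_iff exp_of_nat_mult[symmetric] flip: exp_of_real)
    then show ?case using exp0[OF 0] by simp
  next
    case (Suc m)
    have "L (\<lambda>t. of_real (exp (- t) ^ k * (1 - exp (- t)) ^ m) + (-1) * of_real (exp (- t) ^ Suc k * (1 - exp (- t)) ^ m)) = 0"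
      by (subst mf_add[OF L bx bcont_cmult[OF bx]], subst mf_mult[OF L bx])
        (use Suc.IH[of k] Suc.IH[of "Suc k"] Suc.prems in simp)
    moreover have "of_real (exp (- t) ^ k * (1 - exp (- t)) ^ m) + (-1) * of_real (exp (- t) ^ Suc k * (1 - exp (- t)) ^ m)
        = complex_of_real (exp (- t) ^ k * (1 - exp (- t)) ^ Suc m)" for t
      by (simp add: algebra_simps)
    ultimately show ?case by simp
  qed
  define Bn where "Bn n x = (\<Sum>k\<le>n. h (real k / real n) * of_real (Bernstein n k x))" for n x
  have bb: "(\<lambda>t. of_real (Bernstein n k (exp (- t)))) \<in> bcont" for n k
    using bcont_cmult[OF bx[of k "n - k"], of "of_nat (n choose k)"] by (simp add: Bernstein_def mult.assoc)
  have Bn0: "L (\<lambda>t. Bn n (exp (- t))) = 0" and Bnb: "(\<lambda>t. Bn n (exp (- t))) \<in> bcont" for n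
  proof -
    have s: "L (\<lambda>t. \<Sum>k\<le>n. h (real k / real n) * of_real (Bernstein n k (exp (- t)))) = (\<Sum>k\<le>n. L (\<lambda>t. h (real k / real n) * of_real (Bernstein n k (exp (- t)))))
      \<and> (\<lambda>t. \<Sum>k\<le>n. h (real k / real n) * of_real (Bernstein n k (exp (- t)))) \<in> bcont"
      by (rule mf_sum[OF L]) (auto intro: bcont_cmult bb)
    have "L (\<lambda>t. h (real k / real n) * of_real (Bernstein n k (exp (- t)))) = 0" for k
    \<comment> \<open>The term with k = 0 is the only one with a constant monomial; its coefficient
      is \<open>h 0 = 0\<close>.\<close>
    proof (cases "k = 0")
      case False
      have "L (\<lambda>t. of_real (Bernstein n k (exp (- t)))) = 0"
        using mf_mult[OF L bx[of k "n - k"], of "of_nat (n choose k)"] P[of k "n - k"] False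
        by (simp add: Bernstein_def mult.assoc)
      then show ?thesis using mf_mult[OF L bb] by simp
    qed (simp add: h0 mf_zero[OF L])
    with s show "L (\<lambda>t. Bn n (exp (- t))) = 0" "(\<lambda>t. Bn n (exp (- t))) \<in> bcont" by (auto simp: Bn_def)
  qed
  have hb: "(\<lambda>t. h (exp (- t))) \<in> bcont"
  proof -
    obtain B where "\<forall>x\<in>h ` {0..1}. norm x \<le> B"
      using compact_imp_bounded[OF compact_continuous_image[OF h compact_Icc]] by (auto simp: bounded_iff)
    then show ?thesis
      by (intro bcontI[of _ B] continuous_on_compose2[OF h] continuous_intros) auto
  qed
  \<comment> \<open>Real and imaginary parts are approximated separately, whence the factor
    2.\<close>
  have conv: "\<exists>N. \<forall>n x. N \<le> n \<and> x \<in> {0..1} \<longrightarrow> norm (h x - Bn n x) < 2 * e" if "e > 0" for e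
  proof -
    have "continuous_on {0..1} (\<lambda>x. Re (h x))" "continuous_on {0..1} (\<lambda>x. Im (h x))"
      by (intro continuous_intros h)+
    note B = Bernstein_Weierstrass[OF this(1) that] Bernstein_Weierstrass[OF this(2) that]
    obtain N1 where N1: "\<And>n x. N1 \<le> n \<Longrightarrow> x \<in> {0..1} \<Longrightarrow> \<bar>Re (h x) - (\<Sum>k\<le>n. Re (h (real k / real n)) * Bernstein n k x)\<bar> < e"
      using B(1) by blast
    obtain N2 where N2: "\<And>n x. N2 \<le> n \<Longrightarrow> x \<in> {0..1} \<Longrightarrow> \<bar>Im (h x) - (\<Sum>k\<le>n. Im (h (real k / real n)) * Bernstein n k x)\<bar> < e"
      using B(2) by blast
    have "norm (h x - Bn n x) < 2 * e" if "max N1 N2 \<le> n" "x \<in> {0..1}" for n x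
      using N1[of n x] N2[of n x] that cmod_le[of "h x - Bn n x"]
      by (simp add: Bn_def Re_sum Im_sum)
    then show ?thesis by blast
  qed
  obtain C where C: "C \<ge> 0" "\<And>g B. g\<in>bcont \<Longrightarrow> (\<forall>t\<ge>0. norm (g t) \<le> B) \<Longrightarrow> norm (L g) \<le> C * B"
    using mf_bounded[OF L] by blast
  have le: "norm (L (\<lambda>t. h (exp (- t)))) \<le> C * (2 * e)" if e: "e > 0" for e
  proof -
    obtain N where N: "\<And>x. x \<in> {0..1} \<Longrightarrow> norm (h x - Bn N x) < 2 * e" using conv[OF e] by blast
    have "L (\<lambda>t. h (exp (- t)) + (-1) * Bn N (exp (- t))) = L (\<lambda>t. h (exp (- t)))"
      by (subst mf_add[OF L hb bcont_cmult[OF Bnb]], subst mf_mult[OF L Bnb]) (simp add: Bn0)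
    moreover have "norm (L (\<lambda>t. h (exp (- t)) + (-1) * Bn N (exp (- t)))) \<le> C * (2 * e)"
      by (intro C bcont_add hb bcont_cmult Bnb) (use N in \<open>auto intro: less_imp_le\<close>)
    ultimately show ?thesis by simp
  qed
  have "norm (L (\<lambda>t. h (exp (- t)))) \<le> e" if "e > 0" for e
  proof -
    have "norm (L (\<lambda>t. h (exp (- t)))) \<le> C * (2 * (e / (2 * (C + 1))))"
      by (rule le) (use that C in auto)
    also have "\<dots> \<le> e" using that C by (simp add: field_simps)
    finally show ?thesis .
  qed
  then show ?thesis by (metis dense_ge norm_le_zero_iff)
qed

text \<open>A function in \<open>bcont\<close> may have no limit at infinity and then is no
  continuous function of exp (- t) on [0, 1]. The cutoff min 1 (j exp (- t)) repairs this for each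
  \<open>j\<close> and tends to 1 boundedly, so the convergence axiom removes it.\<close>

lemma mf_unique:
  assumes L: "measure_functional L" and exp0: "\<And>n::nat. 1 \<le> n \<Longrightarrow> L (\<lambda>t. exp (- of_nat n * of_real t)) = 0"
    and g: "g \<in> bcont"
  shows "L g = 0"
proof -
  obtain B where B: "0 < B" "\<And>t. 0 \<le> t \<Longrightarrow> norm (g t) \<le> B" using bcont_bound[OF g] by blast
  define h where "h j x = (if x = 0 then 0 else of_real (min 1 (real j * x)) * g (- ln x))" for j :: nat and x :: real
  have hB: "norm (h j x) \<le> B * (real j * x)" if "0 \<le> x" "x \<le> 1" for j x
  proof (cases "x = 0")
    case False
    then have "norm (h j x) \<le> (real j * x) * B"
      using that unfolding h_def by (auto simp: norm_mult simp del: of_real_mult intro!: mult_mono B)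
    then show ?thesis by (simp add: mult_ac)
  qed (simp add: h_def)
  have ch: "continuous_on {0..1} (h j)" for j
    unfolding continuous_on_def
  proof
    fix x :: real assume x: "x \<in> {0..1}"
    show "(h j \<longlongrightarrow> h j x) (at x within {0..1})"
    proof (cases "x = 0")
      case True
      have "((\<lambda>x. B * (real j * x)) \<longlongrightarrow> B * (real j * 0)) (at 0 within {0..1})"
        by (intro tendsto_intros)
      then have "(h j \<longlongrightarrow> 0) (at 0 within {0..1})"
        by (intro Lim_null_comparison[of "h j" "\<lambda>x. B * (real j * x)"])
          (auto simp: eventually_at_filter hB intro!: always_eventually)
      then show ?thesis by (simp add: True h_def)
    next
      case False
      have "continuous_on {0<..1} (\<lambda>x. of_real (min 1 (real j * x)) * g (- ln x))"
        by (intro continuous_intros continuous_on_compose2[OF bcont_continuous[OF g]]) auto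
      then have "((\<lambda>x. of_real (min 1 (real j * x)) * g (- ln x)) \<longlongrightarrow> h j x) (at x within {0<..1})"
        using x False by (auto simp: continuous_on_def h_def)
      moreover have "at x within {0..1} = at x within {0<..1}"
        using x False by (intro at_within_nhd[of x "{0<..}"]) auto
      ultimately show ?thesis
        by (auto simp: h_def eventually_at_filter intro!: always_eventually elim!: Lim_transform_eventually)
    qed
  qed
  have hexp: "h j (exp (- t)) = of_real (min 1 (real j * exp (- t))) * g t" for j t
    by (simp add: h_def)
  have hb: "(\<lambda>t. h j (exp (- t))) \<in> bcont" for j
    unfolding hexp by (intro bcont_mult g bcontI[of _ 1]) (auto intro!: continuous_intros)
  have "(\<lambda>j. L (\<lambda>t. h j (exp (- t)))) \<longlonglongrightarrow> L g"
  proof (rule mf_lim[OF L hb g, where B=B])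
    fix t :: real assume t: "0 \<le> t"
    show "norm (h n (exp (- t))) \<le> B" for n
    proof -
      have "norm (h n (exp (- t))) \<le> 1 * B"
        unfolding hexp norm_mult by (intro mult_mono B t) auto
      then show ?thesis by simp
    qed
    obtain m :: nat where m: "exp t \<le> real m" using real_arch_simple by blast
    have "1 \<le> real j * exp (- t)" if "m \<le> j" for j
    proof -
      have "exp t \<le> real j" using m that by linarith
      from mult_right_mono[OF this, of "exp (- t)"] show ?thesis by (simp flip: exp_add)
    qed
    then have "\<forall>\<^sub>F j in sequentially. h j (exp (- t)) = g t"
      unfolding hexp by (intro eventually_sequentiallyI[of m]) (simp add: min_absorb1)
    then show "(\<lambda>j. h j (exp (- t))) \<longlonglongrightarrow> g t" by (rule tendsto_eventually)
  qed
  moreover have "L (\<lambda>t. h j (exp (- t))) = 0" for j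
    by (rule mf_unique_aux[OF L exp0 ch]) (auto simp: h_def)
  ultimately show ?thesis by (simp add: LIMSEQ_const_iff)
qed

section \<open>Vector-valued integrals\<close>

lemma has_vec_integral_cong:
  assumes "\<And>t. t \<in> space m \<Longrightarrow> g t = h t"
  shows "has_vec_integral m g y \<longleftrightarrow> has_vec_integral m h y"
proof -
  have "(\<integral>\<^sup>+t. ennreal (norm (g t - s t)) \<partial>m) = (\<integral>\<^sup>+t. ennreal (norm (h t - s t)) \<partial>m)" for s
    by (intro nn_integral_cong) (simp add: assms)
  moreover have "g \<in> borel_measurable m \<longleftrightarrow> h \<in> borel_measurable m"
    by (rule measurable_cong) (rule assms)
  ultimately show ?thesis by (simp add: has_vec_integral_def)
qed

lemma has_vec_integralI:
  assumes "g \<in> borel_measurable m" "\<And>i. Bochner_Integration.simple_bochner_integrable m (s i)"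
    "(\<lambda>i. \<integral>\<^sup>+t. ennreal (norm (g t - s i t)) \<partial>m) \<longlonglongrightarrow> 0"
    "(\<lambda>i::nat. Bochner_Integration.simple_bochner_integral m (s i)) \<longlonglongrightarrow> y"
  shows "has_vec_integral m g y"
  unfolding has_vec_integral_def using assms by blast

lemma simple_bochner_integrable_linear:
  assumes "linear B" "Bochner_Integration.simple_bochner_integrable m s"
  shows "Bochner_Integration.simple_bochner_integrable m (\<lambda>t. B (s t))"
  using simple_bochner_integrable_compose2[of "\<lambda>a b. B a" m s s] assms by (simp add: linear_0)

lemma has_vec_integral_bounded_linear:
  assumes B: "bounded_linear B" and g: "has_vec_integral m g y"
  shows "has_vec_integral m (\<lambda>t. B (g t)) (B y)"
proof -
  interpret B: bounded_linear B by fact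
  obtain K where K: "K > 0" "\<And>x. norm (B x) \<le> norm x * K" using B.pos_bounded by blast
  from g obtain s where s: "\<And>i. Bochner_Integration.simple_bochner_integrable m (s i)"
    "(\<lambda>i. \<integral>\<^sup>+t. ennreal (norm (g t - s i t)) \<partial>m) \<longlonglongrightarrow> 0"
    "(\<lambda>i::nat. Bochner_Integration.simple_bochner_integral m (s i)) \<longlonglongrightarrow> y"
    and gm: "g \<in> borel_measurable m"
    by (auto simp: has_vec_integral_def)
  have B_meas: "B \<in> borel_measurable borel"
    by (rule borel_measurable_continuous_onI) (rule linear_continuous_on[OF B])
  have "(\<lambda>i. \<integral>\<^sup>+t. ennreal (norm (B (g t) - B (s i t))) \<partial>m) \<longlonglongrightarrow> 0"
  proof (rule tendsto_sandwich[OF always_eventually always_eventually tendsto_const])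
    show "\<forall>i. (\<integral>\<^sup>+t. ennreal (norm (B (g t) - B (s i t))) \<partial>m) \<le> K * (\<integral>\<^sup>+t. ennreal (norm (g t - s i t)) \<partial>m)"
    proof
      fix i
      \<comment> \<open>In a non-separable space the difference of two measurable functions may fail
        to be measurable. Here \<open>s i\<close> takes finitely many values, so the norm is a
        finite sum over the level sets of \<open>s i\<close>.\<close>
      have [measurable]: "(\<lambda>t. norm (g t - s i t)) \<in> borel_measurable m"
      proof -
        have sf: "simple_function m (s i)" using s(1)[of i] by (rule simple_bochner_integrable.cases)
        define X where "X = s i ` space m"
        have "finite X" using sf by (simp add: X_def simple_function_def)
        have "(\<lambda>t. norm (g t - s i t)) \<in> borel_measurable m \<longleftrightarrow> (\<lambda>t. \<Sum>c\<in>X. norm (g t - c) * indicator (s i -` {c} \<inter> space m) t) \<in> borel_measurable m"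
        proof (rule measurable_cong)
          fix t assume t: "t \<in> space m"
          have "(\<Sum>c\<in>X. norm (g t - c) * indicator (s i -` {c} \<inter> space m) t) = (\<Sum>c\<in>X. if c = s i t then norm (g t - c) else 0)"
            using t by (intro sum.cong) (auto simp: indicator_def)
          also have "\<dots> = norm (g t - s i t)" using \<open>finite X\<close> t by (simp add: X_def)
          finally show "norm (g t - s i t) = (\<Sum>c\<in>X. norm (g t - c) * indicator (s i -` {c} \<inter> space m) t)" by simp
        qed
        moreover have "(\<lambda>t. norm (g t - c)) \<in> borel_measurable m" for c
          by (rule measurable_compose[OF gm]) (auto intro!: borel_measurable_continuous_onI continuous_intros)
        moreover have "s i -` {c} \<inter> space m \<in> sets m" for c
          using sf by (cases "c \<in> X") (auto simp: simple_function_def X_def vimage_def intro: back_subst[of "\<lambda>S. S \<in> sets m"])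
        ultimately show ?thesis by (auto intro!: borel_measurable_sum borel_measurable_times)
      qed
      have "(\<integral>\<^sup>+t. ennreal (norm (B (g t) - B (s i t))) \<partial>m) \<le> (\<integral>\<^sup>+t. ennreal K * ennreal (norm (g t - s i t)) \<partial>m)"
        using K by (intro nn_integral_mono) (auto simp flip: B.diff ennreal_mult' simp: mult.commute)
      then show "(\<integral>\<^sup>+t. ennreal (norm (B (g t) - B (s i t))) \<partial>m) \<le> K * (\<integral>\<^sup>+t. ennreal (norm (g t - s i t)) \<partial>m)"
        by (simp add: nn_integral_cmult)
    qed
    show "(\<lambda>i. K * (\<integral>\<^sup>+t. ennreal (norm (g t - s i t)) \<partial>m)) \<longlonglongrightarrow> 0"
      using ennreal_tendsto_cmult[OF _ s(2), of K] by simp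
  qed simp
  moreover have "(\<lambda>i. Bochner_Integration.simple_bochner_integral m (\<lambda>t. B (s i t))) \<longlonglongrightarrow> B y"
    unfolding simple_bochner_integral_linear[OF B.linear s(1)] by (rule B.tendsto[OF s(3)])
  moreover have "Bochner_Integration.simple_bochner_integrable m (\<lambda>t. B (s i t))" for i
    by (rule simple_bochner_integrable_linear[OF B.linear s(1)])
  ultimately show ?thesis
    using measurable_compose[OF gm B_meas] by (intro has_vec_integralI[where s="\<lambda>i t. B (s i t)"])
qed

text \<open>In the separable codomain \<open>complex\<close> this integral is the usual Bochner
  integral; pairing with \<open>z\<close> is the way back to scalar integration.\<close>

lemma has_vec_integral_cinner:
  assumes "has_vec_integral m g y"
  shows "has_bochner_integral m (\<lambda>t. cinner (g t) z) (cinner y z)"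
proof -
  have "has_vec_integral m (\<lambda>t. cinner (g t) z) (cinner y z)"
    by (rule has_vec_integral_bounded_linear[OF bounded_linear_cinner_left assms])
  then show ?thesis
    unfolding has_vec_integral_def by (auto intro: has_bochner_integral.intros)
qed

lemma has_vec_integral_unique:
  "has_vec_integral m g y \<Longrightarrow> has_vec_integral m g y' \<Longrightarrow> y = (y' :: 'a::complex_inner)"
  by (rule cinner_eqI) (metis has_bochner_integral_eq has_vec_integral_cinner)

lemma vec_integral_eqI: "has_vec_integral m g y \<Longrightarrow> vec_integral m g = (y :: 'a::complex_inner)"
  unfolding vec_integral_def by (rule the_equality) (auto intro: has_vec_integral_unique)

lemma half_line_measure_space: "half_line_measure m \<Longrightarrow> space m = {0..}"
  using sets_eq_imp_space_eq[of m "restrict_space borel {0..}"]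
  by (simp add: half_line_measure_def space_restrict_space)

text \<open>Continuity replaces separability: sampling \<open>g\<close> on a grid of mesh 1 / N, cut
  off at time N, gives simple functions that converge pointwise and boundedly, hence in mean since
  the measure is finite. Their integrals are then Cauchy.\<close>

lemma has_vec_integral_bcont:
  fixes g :: "real \<Rightarrow> 'a::{complex_inner,banach}"
  assumes m: "half_line_measure m" and g: "continuous_on {0..} g" and B: "\<And>t. 0 \<le> t \<Longrightarrow> norm (g t) \<le> B"
  shows "\<exists>y. has_vec_integral m g y"
proof -
  interpret finite_measure m using m by (simp add: half_line_measure_def)
  have sets: "sets m = sets (restrict_space borel {0..})" using m by (simp add: half_line_measure_def)
  note sp = half_line_measure_space[OF m]
  have B0: "0 \<le> B" using B[of 0] norm_ge_zero[of "g 0"] by linarith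
  have meas: "f \<in> borel_measurable m" if "continuous_on {0..} f" for f :: "real \<Rightarrow> 'z::topological_space"
    using borel_measurable_continuous_on_restrict[OF that] by (subst measurable_cong_sets[OF sets refl])
  define N where "N i = Suc i" for i
  define c where "c i k = (if k < N i * N i then g (real k / real (N i)) else 0)" for i k
  define ix where "ix i t = nat \<lfloor>real (N i) * t\<rfloor>" for i t
  define s where "s i t = c i (ix i t)" for i t
  have ix_meas [measurable]: "ix i \<in> measurable m (count_space UNIV)" for i
  proof -
    have "ix i \<in> measurable borel (count_space UNIV)" unfolding ix_def[abs_def] by measurable
    then show ?thesis by (subst measurable_cong_sets[OF sets refl]) (rule measurable_restrict_space1)
  qed
  have s_simple: "Bochner_Integration.simple_bochner_integrable m (s i)" for i
  proof (rule simple_bochner_integrable.intros)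
    have "s i ` space m \<subseteq> c i ` {..N i * N i}"
    proof
      fix y assume "y \<in> s i ` space m"
      then obtain t where "y = c i (ix i t)" by (auto simp: s_def)
      \<comment> \<open>All indices from \<open>N i * N i\<close> on carry the value 0, so they can
        be merged into that single index.\<close>
      then have "y = c i (min (ix i t) (N i * N i))" by (simp add: c_def min_def)
      then show "y \<in> c i ` {..N i * N i}" by auto
    qed
    then have "finite (s i ` space m)" by (rule finite_subset) simp
    moreover have "s i -` {y} \<inter> space m \<in> sets m" for y
    proof -
      have "s i \<in> measurable m (count_space UNIV)"
        unfolding s_def[abs_def] by (rule measurable_compose[OF ix_meas]) simp
      then show ?thesis by (rule measurable_sets) simp
    qed
    ultimately show "simple_function m (s i)" by (simp add: simple_function_def)
  qed simp
  have sB: "norm (s i t) \<le> B" for i t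
    using B0 by (auto simp: s_def c_def intro!: B)
  \<comment> \<open>The approximant depends on t through a natural number only, so measurability can
    be checked for each fixed grid index.\<close>
  have nm [measurable]: "(\<lambda>t. norm (g t - s i t)) \<in> borel_measurable m" for i
    unfolding s_def
    by (rule measurable_compose_countable[OF _ ix_meas]) (auto intro!: meas continuous_intros g)
  have s_lim: "(\<lambda>i. s i t) \<longlonglongrightarrow> g t" if t: "0 \<le> t" for t
  proof -
    have ev: "\<forall>\<^sub>F i in sequentially. s i t = g (real (ix i t) / real (N i))"
    proof -
      obtain k :: nat where k: "t < real k" using reals_Archimedean2 by blast
      have "ix i t < N i * N i" if "k \<le> i" for i
      proof -
        have "real (N i) * t < real (N i) * real (N i)" using k that t by (intro mult_strict_left_mono) (auto simp: N_def)
        moreover have "real (ix i t) \<le> real (N i) * t" using t by (simp add: ix_def)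
        ultimately show ?thesis by (metis of_nat_less_iff of_nat_mult order_le_less_trans)
      qed
      then show ?thesis by (intro eventually_sequentiallyI[of k]) (simp add: s_def c_def)
    qed
    have "(\<lambda>i. real (ix i t) / real (N i)) \<longlonglongrightarrow> t"
    proof (rule LIM_zero_cancel, rule Lim_null_comparison[OF _ LIMSEQ_inverse_real_of_nat], rule always_eventually, rule allI)
      fix i
      have "real (ix i t) \<le> real (N i) * t" "real (N i) * t < real (ix i t) + 1"
        using t by (auto simp: ix_def)
      then have "\<bar>real (ix i t) - real (N i) * t\<bar> \<le> 1" by linarith
      moreover have "real (ix i t) / real (N i) - t = (real (ix i t) - real (N i) * t) / real (N i)"
        by (simp add: N_def field_simps)
      ultimately show "norm (real (ix i t) / real (N i) - t) \<le> inverse (real (Suc i))"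
        by (simp add: N_def divide_simps mult.commute del: of_nat_Suc)
    qed
    then have "(\<lambda>i. g (real (ix i t) / real (N i))) \<longlonglongrightarrow> g t"
      using t by (intro continuous_on_tendsto_compose[OF g]) auto
    then show ?thesis by (rule Lim_transform_eventually) (use ev in \<open>auto elim: eventually_mono\<close>)
  qed
  have lim0: "(\<lambda>i. \<integral>t. norm (g t - s i t) \<partial>m) \<longlonglongrightarrow> (\<integral>t. 0 \<partial>m)"
    and int: "integrable m (\<lambda>t. norm (g t - s i t))" for i
  proof -
    have bd: "norm (g t - s i t) \<le> 2 * B" if "0 \<le> t" for i t
      using norm_triangle_ineq4[of "g t" "s i t"] B[OF that] sB[of i t] by simp
    show "integrable m (\<lambda>t. norm (g t - s i t))"
      by (rule integrable_const_bound[of _ "2 * B"]) (auto simp: sp intro!: AE_I2 bd)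
    show "(\<lambda>i. \<integral>t. norm (g t - s i t) \<partial>m) \<longlonglongrightarrow> (\<integral>t. 0 \<partial>m)"
    proof (rule integral_dominated_convergence[where w="\<lambda>_. 2 * B"])
      show "AE t in m. (\<lambda>i. norm (g t - s i t)) \<longlonglongrightarrow> 0"
        by (intro AE_I2 tendsto_norm_zero) (use s_lim sp in \<open>auto intro!: tendsto_eq_intros\<close>)
      show "AE t in m. norm (norm (g t - s i t)) \<le> 2 * B" for i
        by (intro AE_I2) (simp add: sp bd)
    qed auto
  qed
  have e_eq: "(\<integral>\<^sup>+t. ennreal (norm (g t - s i t)) \<partial>m) = ennreal (\<integral>t. norm (g t - s i t) \<partial>m)" for i
    by (rule nn_integral_eq_integral[OF int]) simp
  have diff: "norm (Bochner_Integration.simple_bochner_integral m (s i) - Bochner_Integration.simple_bochner_integral m (s j))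
     \<le> (\<integral>t. norm (g t - s i t) \<partial>m) + (\<integral>t. norm (g t - s j t) \<partial>m)" for i j
  proof -
    have ij: "Bochner_Integration.simple_bochner_integrable m (\<lambda>t. s i t - s j t)"
      by (rule simple_bochner_integrable_compose2[of "(-)"]) (auto intro: s_simple)
    have nij: "Bochner_Integration.simple_bochner_integrable m (\<lambda>t. norm (s i t - s j t))"
      using simple_bochner_integrable_compose2[of "\<lambda>a b. norm (a - b)", OF _ s_simple[of i] s_simple[of j]] by simp
    have "norm (Bochner_Integration.simple_bochner_integral m (s i) - Bochner_Integration.simple_bochner_integral m (s j))
       = norm (Bochner_Integration.simple_bochner_integral m (\<lambda>t. s i t - s j t))"
      by (simp add: simple_bochner_integral_diff s_simple)
    also have "\<dots> \<le> Bochner_Integration.simple_bochner_integral m (\<lambda>t. norm (s i t - s j t))"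
      by (rule simple_bochner_integral_norm_bound[OF ij])
    also have "\<dots> = (\<integral>t. norm (s i t - s j t) \<partial>m)"
      using has_bochner_integral_simple_bochner_integrable[OF nij] by (simp add: has_bochner_integral_integral_eq)
    also have "\<dots> \<le> (\<integral>t. norm (g t - s i t) + norm (g t - s j t) \<partial>m)"
    proof (intro integral_mono Bochner_Integration.integrable_add int)
      show "integrable m (\<lambda>t. norm (s i t - s j t))"
        using has_bochner_integral_simple_bochner_integrable[OF nij] by (rule integrable.intros)
      show "norm (s i t - s j t) \<le> norm (g t - s i t) + norm (g t - s j t)" for t
        using norm_triangle_ineq4[of "g t - s j t" "g t - s i t"] by simp
    qed
    also have "\<dots> = (\<integral>t. norm (g t - s i t) \<partial>m) + (\<integral>t. norm (g t - s j t) \<partial>m)"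
      by (simp add: int)
    finally show ?thesis .
  qed
  have "Cauchy (\<lambda>i. Bochner_Integration.simple_bochner_integral m (s i))"
  proof (rule metric_CauchyI)
    fix e :: real assume e: "0 < e"
    have "\<forall>\<^sub>F i in sequentially. (\<integral>t. norm (g t - s i t) \<partial>m) < e / 2"
      by (rule order_tendstoD(2)[OF lim0]) (use e in simp)
    then obtain n where n: "\<And>i. n \<le> i \<Longrightarrow> (\<integral>t. norm (g t - s i t) \<partial>m) < e / 2"
      by (auto simp: eventually_sequentially)
    show "\<exists>n. \<forall>i\<ge>n. \<forall>j\<ge>n. dist (Bochner_Integration.simple_bochner_integral m (s i)) (Bochner_Integration.simple_bochner_integral m (s j)) < e"
    proof (intro exI allI impI)
      fix i j assume "n \<le> i" "n \<le> j"
      then show "dist (Bochner_Integration.simple_bochner_integral m (s i)) (Bochner_Integration.simple_bochner_integral m (s j)) < e"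
        using diff[of i j] n[of i] n[of j] by (simp add: dist_norm)
    qed
  qed
  then obtain y where y: "(\<lambda>i. Bochner_Integration.simple_bochner_integral m (s i)) \<longlonglongrightarrow> y"
    using convergent_eq_Cauchy convergent_def by blast
  have "(\<lambda>i. \<integral>\<^sup>+t. ennreal (norm (g t - s i t)) \<partial>m) \<longlonglongrightarrow> 0"
    unfolding e_eq using tendsto_ennrealI[OF lim0] by simp
  then show ?thesis
    using has_vec_integralI[OF meas[OF g] s_simple _ y] by blast
qed

section \<open>Symbols of operators\<close>

context bdd_semigroup
begin

text \<open>The weak form of \<open>S = \<integral> T(t) d\<mu>(t)\<close>, with \<open>\<phi>\<close> the Laplace transform of \<open>\<mu>\<close>. Commutation with
  the semigroup is required separately, since it cannot be read off the weak form without adjoints.\<close>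

definition has_symbol :: "('h \<Rightarrow> 'h) \<Rightarrow> (complex \<Rightarrow> complex) \<Rightarrow> bool" where
  "has_symbol S \<phi> \<longleftrightarrow> (\<forall>t\<ge>0. \<forall>x. S (T t x) = T t (S x)) \<and>
     (\<exists>L. measure_functional L \<and> (\<forall>x y. cinner (S x) y = L (\<lambda>t. cinner (T t x) y)) \<and>
       (\<forall>z. 0 < Re z \<longrightarrow> L (\<lambda>t. exp (- z * of_real t)) = \<phi> z))"

lemma orbit_bcont: "(\<lambda>t. cinner (T t x) y) \<in> bcont"
  by (rule bcontI[of _ "M * norm x * norm y"]) (auto intro!: continuous_intros norm_cinner_T)

lemma orbit_add: "0 \<le> t \<Longrightarrow> T t (x + y) = T t x + T t y"
  using bounded_linear_T[of t] by (simp add: bounded_linear.linear linear_add)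

lemma has_symbolE:
  assumes "has_symbol S \<phi>"
  obtains L where "measure_functional L" "\<And>x y. cinner (S x) y = L (\<lambda>t. cinner (T t x) y)"
    "\<And>z. 0 < Re z \<Longrightarrow> L (\<lambda>t. exp (- z * of_real t)) = \<phi> z" "\<And>t x. 0 \<le> t \<Longrightarrow> S (T t x) = T t (S x)"
  using assms unfolding has_symbol_def by blast

lemma has_symbolI:
  assumes "measure_functional L" "\<And>x y. cinner (S x) y = L (\<lambda>t. cinner (T t x) y)"
    "\<And>z. 0 < Re z \<Longrightarrow> L (\<lambda>t. exp (- z * of_real t)) = \<phi> z" "\<And>t x. 0 \<le> t \<Longrightarrow> S (T t x) = T t (S x)"
  shows "has_symbol S \<phi>"
  using assms unfolding has_symbol_def by blast

lemma has_symbol_cong: "has_symbol S \<phi> \<Longrightarrow> (\<And>z. 0 < Re z \<Longrightarrow> \<phi> z = \<psi> z) \<Longrightarrow> has_symbol S \<psi>"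
  unfolding has_symbol_def by metis

lemma has_symbol_bounded_clinear:
  assumes "has_symbol S \<phi>"
  shows "bounded_clinear S"
proof -
  from assms obtain L where L: "measure_functional L" and S: "\<And>x y. cinner (S x) y = L (\<lambda>t. cinner (T t x) y)"
    by (elim has_symbolE) blast
  obtain C where C: "C \<ge> 0" "\<And>g B. g\<in>bcont \<Longrightarrow> (\<forall>t\<ge>0. norm (g t) \<le> B) \<Longrightarrow> norm (L g) \<le> C * B"
    using mf_bounded[OF L] by blast
  have add: "S (x + y) = S x + S y" for x y
  proof (rule cinner_eqI)
    fix z
    have "L (\<lambda>t. cinner (T t (x + y)) z) = L (\<lambda>t. cinner (T t x) z + cinner (T t y) z)"
      by (rule mf_cong[OF L]) (auto intro!: orbit_bcont bcont_add simp: orbit_add cinner_add_left)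
    then show "cinner (S (x + y)) z = cinner (S x + S y) z"
      by (simp add: S cinner_add_left mf_add[OF L orbit_bcont orbit_bcont])
  qed
  have scale: "S (c *\<^sub>C x) = c *\<^sub>C S x" for c x
  proof (rule cinner_eqI)
    fix z
    have "L (\<lambda>t. cinner (T t (c *\<^sub>C x)) z) = L (\<lambda>t. c * cinner (T t x) z)"
      by (rule mf_cong[OF L]) (auto intro!: orbit_bcont bcont_cmult simp: T_scaleC cinner_scaleC_left)
    then show "cinner (S (c *\<^sub>C x)) z = cinner (c *\<^sub>C S x) z"
      by (simp add: S cinner_scaleC_left mf_mult[OF L orbit_bcont])
  qed
  have "norm (S x) \<le> norm x * (C * M)" for x
  proof (rule norm_leI_cinner)
    show "norm (cinner (S x) y) \<le> norm x * (C * M) * norm y" for y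
    proof -
      have "norm (cinner (S x) y) \<le> C * (M * norm x * norm y)"
        unfolding S by (intro C orbit_bcont) (auto intro: norm_cinner_T)
      then show ?thesis by (simp add: mult_ac)
    qed
  qed (use C M_nonneg in simp)
  then have "bounded_linear S"
    using add scale[of "of_real _"] by (intro bounded_linear_intro[of S "C * M"]) (auto simp: scaleC_of_real)
  then show ?thesis using scale by (simp add: bounded_clinear_def)
qed

text \<open>The difference of the representing functionals kills exp (- n t) for every n >= 1, hence
  all of \<open>bcont\<close>, in particular the orbits. By this rule operator identities reduce to
  identities between symbols.\<close>

lemma has_symbol_unique:
  assumes "has_symbol S \<phi>" "has_symbol S' \<psi>" "\<And>z. 0 < Re z \<Longrightarrow> \<phi> z = \<psi> z"
  shows "S = S'"
proof
  fix x
  from assms obtain L where L: "measure_functional L" "\<And>x y. cinner (S x) y = L (\<lambda>t. cinner (T t x) y)"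
    "\<And>z. 0 < Re z \<Longrightarrow> L (\<lambda>t. exp (- z * of_real t)) = \<phi> z"
    by (elim has_symbolE) blast
  from assms obtain L' where L': "measure_functional L'" "\<And>x y. cinner (S' x) y = L' (\<lambda>t. cinner (T t x) y)"
    "\<And>z. 0 < Re z \<Longrightarrow> L' (\<lambda>t. exp (- z * of_real t)) = \<psi> z"
    by (elim has_symbolE) blast
  have D: "measure_functional (\<lambda>g. 1 * L g + (- 1) * L' g)"
    by (rule mf_comb[OF L(1) L'(1)])
  have "1 * L g + (- 1) * L' g = 0" if "g \<in> bcont" for g
    by (rule mf_unique[OF D _ that]) (use L(3)[of "of_nat _"] L'(3)[of "of_nat _"] assms(3) in auto)
  then have "L g = L' g" if "g \<in> bcont" for g using that by fastforce
  then show "S x = S' x"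
    by (intro cinner_eqI) (simp add: L(2) L'(2) orbit_bcont)
qed

text \<open>Convolution of the functionals. Moving \<open>S'\<close> past \<open>T s\<close> turns
  \<open>cinner (T s (S' x)) y\<close> into an evaluation of \<open>L'\<close> along the orbit of
  \<open>T s x\<close>; this is the purpose of the commutation clause.\<close>

lemma has_symbol_comp:
  assumes "has_symbol S \<phi>" "has_symbol S' \<psi>"
  shows "has_symbol (\<lambda>x. S (S' x)) (\<lambda>z. \<phi> z * \<psi> z)"
proof -
  from assms(1) obtain L where L: "measure_functional L" "\<And>x y. cinner (S x) y = L (\<lambda>t. cinner (T t x) y)"
    "\<And>z. 0 < Re z \<Longrightarrow> L (\<lambda>t. exp (- z * of_real t)) = \<phi> z" "\<And>t x. 0 \<le> t \<Longrightarrow> S (T t x) = T t (S x)"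
    by (elim has_symbolE) blast
  from assms(2) obtain L' where L': "measure_functional L'" "\<And>x y. cinner (S' x) y = L' (\<lambda>t. cinner (T t x) y)"
    "\<And>z. 0 < Re z \<Longrightarrow> L' (\<lambda>t. exp (- z * of_real t)) = \<psi> z" "\<And>t x. 0 \<le> t \<Longrightarrow> S' (T t x) = T t (S' x)"
    by (elim has_symbolE) blast
  show ?thesis
  proof (rule has_symbolI[OF mf_convolution[OF L(1) L'(1)]])
    fix x y
    have "L (\<lambda>s. cinner (T s (S' x)) y) = L (\<lambda>s. L' (\<lambda>t. cinner (T (s + t) x) y))"
    proof (rule mf_cong[OF L(1) orbit_bcont mf_shift_bcont[OF L'(1) orbit_bcont]])
      fix s :: real assume s: "0 \<le> s"
      have "cinner (T s (S' x)) y = L' (\<lambda>t. cinner (T t (T s x)) y)"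
        using s by (simp add: L'(2,4)[symmetric])
      also have "\<dots> = L' (\<lambda>t. cinner (T (s + t) x) y)"
        by (rule mf_cong[OF L'(1) orbit_bcont bcont_shift[OF orbit_bcont s]])
          (use s in \<open>simp add: T_add T_commute[of s]\<close>)
      finally show "cinner (T s (S' x)) y = L' (\<lambda>t. cinner (T (s + t) x) y)" .
    qed
    then show "cinner (S (S' x)) y = L (\<lambda>s. L' (\<lambda>t. cinner (T (s + t) x) y))" by (simp add: L(2))
  next
    fix z :: complex assume z: "0 < Re z"
    have "(\<lambda>s. L' (\<lambda>t. exp (- z * of_real (s + t)))) = (\<lambda>s. \<psi> z * exp (- z * of_real s))"
    proof
      fix s
      have "L' (\<lambda>t. exp (- z * of_real s) * exp (- z * of_real t)) = \<psi> z * exp (- z * of_real s)"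
        using L'(3)[OF z] z by (subst mf_mult[OF L'(1) bcont_exp]) auto
      then show "L' (\<lambda>t. exp (- z * of_real (s + t))) = \<psi> z * exp (- z * of_real s)"
        by (simp add: distrib_left exp_add[symmetric])
    qed
    then show "L (\<lambda>s. L' (\<lambda>t. exp (- z * of_real (s + t)))) = \<phi> z * \<psi> z"
      using z L(3)[OF z] by (simp only:) (subst mf_mult[OF L(1) bcont_exp]; simp)
  qed (simp add: L(4) L'(4))
qed

lemma has_symbol_commute:
  assumes "has_symbol S \<phi>" "has_symbol S' \<psi>"
  shows "S (S' x) = S' (S x)"
  using has_symbol_unique[OF has_symbol_comp[OF assms] has_symbol_comp[OF assms(2,1)]]
  by (metis mult.commute)

lemma has_symbol_add:
  assumes "has_symbol S \<phi>" "has_symbol S' \<psi>"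
  shows "has_symbol (\<lambda>x. a *\<^sub>C S x + b *\<^sub>C S' x) (\<lambda>z. a * \<phi> z + b * \<psi> z)"
proof -
  from assms(1) obtain L where L: "measure_functional L" "\<And>x y. cinner (S x) y = L (\<lambda>t. cinner (T t x) y)"
    "\<And>z. 0 < Re z \<Longrightarrow> L (\<lambda>t. exp (- z * of_real t)) = \<phi> z" "\<And>t x. 0 \<le> t \<Longrightarrow> S (T t x) = T t (S x)"
    by (elim has_symbolE) blast
  from assms(2) obtain L' where L': "measure_functional L'" "\<And>x y. cinner (S' x) y = L' (\<lambda>t. cinner (T t x) y)"
    "\<And>z. 0 < Re z \<Longrightarrow> L' (\<lambda>t. exp (- z * of_real t)) = \<psi> z" "\<And>t x. 0 \<le> t \<Longrightarrow> S' (T t x) = T t (S' x)"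
    by (elim has_symbolE) blast
  show ?thesis
  proof (rule has_symbolI[OF mf_comb[OF L(1) L'(1)]])
    show "a * L (\<lambda>t. exp (- z * of_real t)) + b * L' (\<lambda>t. exp (- z * of_real t)) = a * \<phi> z + b * \<psi> z" if "0 < Re z" for z
      by (simp only: L(3)[OF that] L'(3)[OF that])
  qed (auto simp: cinner_add_left cinner_scaleC_left L(2,4) L'(2,4) orbit_add T_scaleC)
qed

lemma has_symbol_T: "0 \<le> \<tau> \<Longrightarrow> has_symbol (T \<tau>) (\<lambda>z. exp (- z * of_real \<tau>))"
  by (rule has_symbolI[OF mf_eval]) (auto simp: T_commute)

lemma has_symbol_id: "has_symbol (\<lambda>x. x) (\<lambda>z. 1)"
proof -
  have "T 0 = (\<lambda>x. x)" by (simp add: fun_eq_iff)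
  then show ?thesis using has_symbol_T[of 0] by simp
qed

end

section \<open>Complex measures, densities and their operators\<close>

fun integral_cmeasure :: "cmeasure \<Rightarrow> (real \<Rightarrow> complex) \<Rightarrow> complex" where
  "integral_cmeasure (m1, m2, m3, m4) g =
     (\<integral>t. g t \<partial>m1) - (\<integral>t. g t \<partial>m2) + \<i> * ((\<integral>t. g t \<partial>m3) - (\<integral>t. g t \<partial>m4))"

lemma mf_half_line_measure: "half_line_measure m \<Longrightarrow> measure_functional (\<lambda>g. \<integral>t. g t \<partial>m)"
  using mf_integral(1)[of m "\<lambda>_. 1"] by (simp add: half_line_measure_def finite_measure.integrable_const)

lemma mf_cmeasure:
  assumes "complex_borel_measure \<mu>"
  shows "measure_functional (integral_cmeasure \<mu>)"
proof -
  obtain m1 m2 m3 m4 where \<mu>: "\<mu> = (m1, m2, m3, m4)" by (cases \<mu>)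
  then have m: "half_line_measure m1" "half_line_measure m2" "half_line_measure m3" "half_line_measure m4"
    using assms by auto
  have "measure_functional (\<lambda>g. 1 * (1 * (\<integral>t. g t \<partial>m1) + (-1) * (\<integral>t. g t \<partial>m2)) + \<i> * (1 * (\<integral>t. g t \<partial>m3) + (-1) * (\<integral>t. g t \<partial>m4)))"
    by (intro mf_comb mf_half_line_measure m)
  moreover have "integral_cmeasure \<mu> = (\<lambda>g. 1 * (1 * (\<integral>t. g t \<partial>m1) + (-1) * (\<integral>t. g t \<partial>m2)) + \<i> * (1 * (\<integral>t. g t \<partial>m3) + (-1) * (\<integral>t. g t \<partial>m4)))"
    by (simp add: \<mu> fun_eq_iff)
  ultimately show ?thesis by simp
qed

lemma laplace_eq: "laplace \<mu> z = integral_cmeasure \<mu> (\<lambda>t. exp (- z * of_real t))"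
  by (cases \<mu>) (simp add: Let_def)

text \<open>The clipping of negative reals by \<^const>\<open>ennreal\<close> turns the four densities into the positive
  and negative parts of \<open>Re k\<close> and \<open>Im k\<close>.\<close>

definition kernel_cmeasure :: "(real \<Rightarrow> complex) \<Rightarrow> cmeasure" where
  "kernel_cmeasure k = (let m = (\<lambda>f. density (restrict_space lborel {0..}) (\<lambda>t. ennreal (f (k t))))
     in (m Re, m (\<lambda>z. - Re z), m Im, m (\<lambda>z. - Im z)))"

lemma sets_half_line: "sets (restrict_space lborel {0..}) = sets (restrict_space borel {0::real..})"
  by (simp add: sets_restrict_space)

lemma integrable_half_line:
  "integrable (restrict_space lborel {0..}) f \<longleftrightarrow> set_integrable lborel {0..} (f :: real \<Rightarrow> 'a::{banach, second_countable_topology})"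
  by (simp add: integrable_restrict_space set_integrable_def)

lemma integral_half_line:
  "integral\<^sup>L (restrict_space lborel {0::real..}) f = (LINT t:{0..}|lborel. (f t :: 'a::{banach, second_countable_topology}))"
  unfolding set_lebesgue_integral_def by (rule integral_restrict_space) simp

lemma half_line_measure_density:
  assumes "integrable (restrict_space lborel {0..}) (f :: real \<Rightarrow> real)"
  shows "half_line_measure (density (restrict_space lborel {0..}) (\<lambda>t. ennreal (f t)))"
proof -
  let ?H = "restrict_space lborel {0..} :: real measure"
  have [measurable]: "f \<in> borel_measurable ?H" using assms by simp
  have "(\<integral>\<^sup>+t. ennreal (f t) \<partial>?H) \<le> (\<integral>\<^sup>+t. ennreal (norm (f t)) \<partial>?H)"
    by (intro nn_integral_mono ennreal_leI) auto
  also have "\<dots> < \<infinity>" using assms by (simp add: integrable_iff_bounded)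
  finally have fin: "(\<integral>\<^sup>+t. ennreal (f t) \<partial>?H) < \<infinity>" .
  have "emeasure (density ?H (\<lambda>t. ennreal (f t))) (space ?H) = (\<integral>\<^sup>+t. ennreal (f t) \<partial>?H)"
  proof -
    have "(\<lambda>t. ennreal (f t)) \<in> borel_measurable ?H" by measurable
    from emeasure_density[OF this sets.top] show ?thesis
      by (simp cong: nn_integral_cong_simp)
  qed
  with fin have "finite_measure (density ?H (\<lambda>t. ennreal (f t)))"
    by (intro finite_measureI) auto
  then show ?thesis by (simp add: half_line_measure_def sets_half_line)
qed

lemma integral_density_clipped:
  assumes f: "integrable (restrict_space lborel {0..}) (f :: real \<Rightarrow> real)" and g: "g \<in> bcont"
  shows "(\<integral>t. g t \<partial>density (restrict_space lborel {0..}) (\<lambda>t. ennreal (f t))) =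
      (\<integral>t. of_real (max 0 (f t)) * g t \<partial>restrict_space lborel {0..})"
    and "integrable (restrict_space lborel {0..}) (\<lambda>t. of_real (max 0 (f t)) * g t)"
proof -
  have [measurable]: "f \<in> borel_measurable (restrict_space lborel {0..})" using f by simp
  have "integrable (restrict_space lborel {0..}) (\<lambda>t. complex_of_real (max 0 (f t)))"
    using f by (intro integrable_of_real integrable_max) auto
  note k = mf_integral[OF sets_half_line this]
  note [measurable] = k(3)[OF g]
  have "density (restrict_space lborel {0..}) (\<lambda>t. ennreal (f t)) = density (restrict_space lborel {0..}) (\<lambda>t. ennreal (max 0 (f t)))"
    by (intro arg_cong[where f="density _"]) (auto simp: fun_eq_iff max_def ennreal_neg)
  then show "(\<integral>t. g t \<partial>density (restrict_space lborel {0..}) (\<lambda>t. ennreal (f t))) =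
      (\<integral>t. of_real (max 0 (f t)) * g t \<partial>restrict_space lborel {0..})"
    by (simp add: integral_density scaleR_conv_of_real)
  show "integrable (restrict_space lborel {0..}) (\<lambda>t. of_real (max 0 (f t)) * g t)"
    by (rule k(2)[OF g])
qed

lemma
  assumes k: "set_integrable lborel {0..} k"
  shows complex_borel_measure_kernel: "complex_borel_measure (kernel_cmeasure k)"
    and integral_kernel_cmeasure: "g \<in> bcont \<Longrightarrow> integral_cmeasure (kernel_cmeasure k) g = (LINT t:{0..}|lborel. k t * g t)"
    and laplace_kernel: "0 < Re z \<Longrightarrow> laplace (kernel_cmeasure k) z = (LINT t:{0..}|lborel. k t * exp (- z * of_real t))"
proof -
  let ?H = "restrict_space lborel {0..} :: real measure"
  have k': "integrable ?H k" using k by (simp add: integrable_half_line)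
  then have i: "integrable ?H (\<lambda>t. Re (k t))" "integrable ?H (\<lambda>t. - Re (k t))"
    "integrable ?H (\<lambda>t. Im (k t))" "integrable ?H (\<lambda>t. - Im (k t))" by auto
  then show "complex_borel_measure (kernel_cmeasure k)"
    by (simp add: kernel_cmeasure_def half_line_measure_density)
  show *: "integral_cmeasure (kernel_cmeasure k) g = (LINT t:{0..}|lborel. k t * g t)" if g: "g \<in> bcont" for g
  proof -
    note d = integral_density_clipped[OF i(1) g] integral_density_clipped[OF i(2) g]
      integral_density_clipped[OF i(3) g] integral_density_clipped[OF i(4) g]
    have "integral_cmeasure (kernel_cmeasure k) g = (\<integral>t. of_real (max 0 (Re (k t))) * g t - of_real (max 0 (- Re (k t))) * g t
       + \<i> * (of_real (max 0 (Im (k t))) * g t - of_real (max 0 (- Im (k t))) * g t) \<partial>?H)"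
      using d by (simp add: kernel_cmeasure_def)
    also have "\<dots> = (\<integral>t. k t * g t \<partial>?H)"
    proof (rule Bochner_Integration.integral_cong[OF refl])
      fix t
      have "of_real (max 0 (Re (k t))) * g t - of_real (max 0 (- Re (k t))) * g t
         + \<i> * (of_real (max 0 (Im (k t))) * g t - of_real (max 0 (- Im (k t))) * g t)
        = (of_real (max 0 (Re (k t)) - max 0 (- Re (k t))) + \<i> * of_real (max 0 (Im (k t)) - max 0 (- Im (k t)))) * g t"
        by (simp add: algebra_simps)
      also have "max 0 (Re (k t)) - max 0 (- Re (k t)) = Re (k t)" by simp
      also have "max 0 (Im (k t)) - max 0 (- Im (k t)) = Im (k t)" by simp
      finally show "of_real (max 0 (Re (k t))) * g t - of_real (max 0 (- Re (k t))) * g t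
         + \<i> * (of_real (max 0 (Im (k t))) * g t - of_real (max 0 (- Im (k t))) * g t) = k t * g t"
        by (simp flip: complex_eq)
    qed
    finally show ?thesis by (simp add: integral_half_line)
  qed
  show "laplace (kernel_cmeasure k) z = (LINT t:{0..}|lborel. k t * exp (- z * of_real t))" if "0 < Re z" for z
    unfolding laplace_eq using that by (intro * bcont_exp) simp
qed

text \<open>The calculus refers to the semigroup chosen in \<open>semigroup_of A\<close>, the
  estimates to a given \<open>T\<close>. Uniqueness of the generated semigroup discharges the
  assumption that links them.\<close>

locale hp_semigroup = bdd_semigroup T M for T :: "real \<Rightarrow> 'h::chilbert_space \<Rightarrow> 'h" and M +
  fixes A :: "('h \<times> 'h) set"
  assumes semigroup_of_eq: "\<And>t. 0 \<le> t \<Longrightarrow> semigroup_of A t = T t"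
begin

lemma has_vec_integral_orbit:
  assumes m: "half_line_measure m"
  shows "has_vec_integral m (\<lambda>t. T t x) (vec_integral m (\<lambda>t. semigroup_of A t x))"
proof -
  have "continuous_on {0..} (\<lambda>t. T t x)" by (intro continuous_intros) auto
  with has_vec_integral_bcont[OF m this norm_T] obtain y where y: "has_vec_integral m (\<lambda>t. T t x) y" by auto
  then have "has_vec_integral m (\<lambda>t. semigroup_of A t x) y"
    using semigroup_of_eq half_line_measure_space[OF m]
    by (subst has_vec_integral_cong[where h="\<lambda>t. T t x"]) auto
  with y show ?thesis by (simp add: vec_integral_eqI)
qed

lemma cinner_vec_integral:
  "half_line_measure m \<Longrightarrow> cinner (vec_integral m (\<lambda>t. semigroup_of A t x)) y = (\<integral>t. cinner (T t x) y \<partial>m)"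
  using has_vec_integral_cinner[OF has_vec_integral_orbit] by (metis has_bochner_integral_integral_eq)

lemma vec_integral_T:
  assumes m: "half_line_measure m" and t: "0 \<le> \<tau>"
  shows "vec_integral m (\<lambda>t. semigroup_of A t (T \<tau> x)) = T \<tau> (vec_integral m (\<lambda>t. semigroup_of A t x))"
proof (rule has_vec_integral_unique[OF has_vec_integral_orbit[OF m]])
  have "has_vec_integral m (\<lambda>t. T \<tau> (T t x)) (T \<tau> (vec_integral m (\<lambda>t. semigroup_of A t x)))"
    by (rule has_vec_integral_bounded_linear[OF bounded_linear_T[OF t] has_vec_integral_orbit[OF m]])
  then show "has_vec_integral m (\<lambda>t. T t (T \<tau> x)) (T \<tau> (vec_integral m (\<lambda>t. semigroup_of A t x)))"
    using t half_line_measure_space[OF m]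
    by (subst has_vec_integral_cong[where h="\<lambda>t. T \<tau> (T t x)"]) (auto intro: T_commute)
qed

lemma cinner_hp_measure:
  assumes "complex_borel_measure \<mu>"
  shows "cinner (hp_measure A \<mu> x) y = integral_cmeasure \<mu> (\<lambda>t. cinner (T t x) y)"
  using assms
  by (cases \<mu>) (simp add: Let_def cinner_vec_integral cinner_add_left cinner_diff_left cinner_scaleC_left)

lemma has_symbol_hp_measure:
  assumes \<mu>: "complex_borel_measure \<mu>"
  shows "has_symbol (hp_measure A \<mu>) (laplace \<mu>)"
proof (rule has_symbolI[OF mf_cmeasure[OF \<mu>]])
  show "hp_measure A \<mu> (T t x) = T t (hp_measure A \<mu> x)" if "0 \<le> t" for t x
    using \<mu> that
    by (cases \<mu>) (simp add: Let_def vec_integral_T T_diff T_scaleC orbit_add)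
qed (simp_all only: cinner_hp_measure[OF \<mu>] laplace_eq)

definition kernel_op :: "(real \<Rightarrow> complex) \<Rightarrow> 'h \<Rightarrow> 'h" where
  "kernel_op k = hp_measure A (kernel_cmeasure k)"

lemma
  assumes k: "set_integrable lborel {0..} k"
  shows cinner_kernel_op: "cinner (kernel_op k x) y = (LINT t:{0..}|lborel. k t * cinner (T t x) y)"
    and has_symbol_kernel_op: "has_symbol (kernel_op k) (\<lambda>z. LINT t:{0..}|lborel. k t * exp (- z * of_real t))"
proof -
  show "cinner (kernel_op k x) y = (LINT t:{0..}|lborel. k t * cinner (T t x) y)"
    unfolding kernel_op_def
    by (simp add: cinner_hp_measure[OF complex_borel_measure_kernel[OF k]] integral_kernel_cmeasure[OF k orbit_bcont])
  show "has_symbol (kernel_op k) (\<lambda>z. LINT t:{0..}|lborel. k t * exp (- z * of_real t))"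
    unfolding kernel_op_def
    by (rule has_symbol_cong[OF has_symbol_hp_measure[OF complex_borel_measure_kernel[OF k]] laplace_kernel[OF k]])
qed

end

section \<open>Uniqueness of the generated semigroup\<close>

lemma bdd_semigroup_SUP:
  assumes "bounded_C0_semigroup (T :: real \<Rightarrow> 'h::chilbert_space \<Rightarrow> 'h)"
  shows "bdd_semigroup T (SUP t\<in>{0..}. onorm (T t))"
proof
  show C0: "C0_semigroup T" using assms by (simp add: bounded_C0_semigroup_def)
  have bl: "bounded_linear (T t)" if "0 \<le> t" for t
    using C0 that by (auto simp: C0_semigroup_def bounded_clinear_def)
  have bdd: "bdd_above ((\<lambda>t. onorm (T t)) ` {0..})"
    using assms by (intro bounded_imp_bdd_above) (simp add: bounded_C0_semigroup_def)
  have le: "onorm (T t) \<le> (SUP t\<in>{0..}. onorm (T t))" if "0 \<le> t" for t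
    by (rule cSUP_upper[OF _ bdd]) (use that in simp)
  show "norm (T t x) \<le> (SUP t\<in>{0..}. onorm (T t)) * norm x" if "0 \<le> t" for t x
    by (rule order_trans[OF onorm[OF bl[OF that]] mult_right_mono[OF le[OF that]]]) simp
  show "0 \<le> (SUP t\<in>{0..}. onorm (T t))"
    using onorm_pos_le[OF bl[of 0]] le[of 0] by simp
qed

lemma set_integrable_exp_bcont:
  assumes g: "g \<in> bcont" and c: "0 < Re c"
  shows "set_integrable lborel {0..} (\<lambda>t. exp (- c * of_real t) * g t)"
proof -
  have "set_integrable lborel {0..} (\<lambda>t. exp (- c * of_real t))"
    unfolding set_integrable_def
  proof (rule Bochner_Integration.integrable_bound[OF integrable_exp_atLeast[OF c]])
    show "AE t in lborel. norm (indicat_real {0..} t *\<^sub>R exp (- c * complex_of_real t)) \<le> norm (indicat_real {0..} t * exp (- Re c * t))"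
      by (auto simp: indicator_def)
  qed simp
  from mf_integral(2)[OF sets_half_line this[folded integrable_half_line] g] show ?thesis
    unfolding integrable_half_line .
qed

text \<open>For fixed x and y the difference g of the two scalar orbits has Laplace transform 0 on a
  half-plane. The measure exp (- c t) g(t) dt then annihilates all exponentials, hence the conjugate
  of g; so the integral of exp (- c t) |g|^2 vanishes, and continuity forces g = 0.\<close>

lemma generated_semigroup_unique:
  fixes T T' :: "real \<Rightarrow> 'h::chilbert_space \<Rightarrow> 'h"
  assumes T: "bounded_C0_semigroup T" "neg_generates A T"
    and T': "bounded_C0_semigroup T'" "neg_generates A T'" and t0: "0 \<le> t0"
  shows "T t0 = T' t0"
proof -
  define M where "M = (SUP t\<in>{0..}. onorm (T t))"
  define M' where "M' = (SUP t\<in>{0..}. onorm (T' t))"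
  interpret S: bdd_semigroup T M unfolding M_def by (rule bdd_semigroup_SUP[OF T(1)])
  interpret S': bdd_semigroup T' M' unfolding M'_def by (rule bdd_semigroup_SUP[OF T'(1)])
  from T(2) obtain w where w: "\<And>\<mu> x. Re \<mu> > w \<Longrightarrow> (\<lambda>t. exp (- \<mu> * of_real t) *\<^sub>C T t x) integrable_on {0..}"
    "\<And>\<mu>. Re \<mu> > w \<Longrightarrow> {(\<mu> *\<^sub>C x + y, x) | x y. (x, y) \<in> A} = graph (\<lambda>x. integral {0..} (\<lambda>t. exp (- \<mu> * of_real t) *\<^sub>C T t x))"
    unfolding neg_generates_def by blast
  from T'(2) obtain w' where w': "\<And>\<mu> x. Re \<mu> > w' \<Longrightarrow> (\<lambda>t. exp (- \<mu> * of_real t) *\<^sub>C T' t x) integrable_on {0..}"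
    "\<And>\<mu>. Re \<mu> > w' \<Longrightarrow> {(\<mu> *\<^sub>C x + y, x) | x y. (x, y) \<in> A} = graph (\<lambda>x. integral {0..} (\<lambda>t. exp (- \<mu> * of_real t) *\<^sub>C T' t x))"
    unfolding neg_generates_def by blast
  \<comment> \<open>Beyond both abscissae and positive, so that \<open>c + n\<close> is admissible
    for every natural n and exp (- c t) is integrable.\<close>
  define c where "c = max 0 (max w w') + 1"
  have c: "0 < c" "w < c" "w' < c" by (auto simp: c_def)
  show ?thesis
  proof (rule ext, rule cinner_eqI)
    fix x y
    define g where "g t = cinner (T t x - T' t x) y" for t
    have g: "g \<in> bcont"
      using bcont_add[OF S.orbit_bcont bcont_cmult[OF S'.orbit_bcont], of x y "-1" x y]
      by (simp add: g_def[abs_def] cinner_diff_left)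
    have lap: "(LINT t:{0..}|lborel. exp (- \<mu> * of_real t) * g t) = 0" if "Re \<mu> \<ge> c" for \<mu>
    proof -
      have \<mu>: "Re \<mu> > w" "Re \<mu> > w'" "Re \<mu> > 0" using that c by auto
      have "integral {0..} (\<lambda>t. exp (- \<mu> * of_real t) *\<^sub>C T t x) = integral {0..} (\<lambda>t. exp (- \<mu> * of_real t) *\<^sub>C T' t x)"
        using w(2)[OF \<mu>(1)] w'(2)[OF \<mu>(2)] by (auto simp: graph_def fun_eq_iff)
      then have "integral {0..} (\<lambda>t. exp (- \<mu> * of_real t) *\<^sub>C T t x - exp (- \<mu> * of_real t) *\<^sub>C T' t x) = 0"
        by (subst Henstock_Kurzweil_Integration.integral_diff[OF w(1)[OF \<mu>(1)] w'(1)[OF \<mu>(2)]]) simp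
      moreover have "(\<lambda>t. exp (- \<mu> * of_real t) *\<^sub>C T t x - exp (- \<mu> * of_real t) *\<^sub>C T' t x) integrable_on {0..}"
        by (rule integrable_diff[OF w(1)[OF \<mu>(1)] w'(1)[OF \<mu>(2)]])
      ultimately have "integral {0..} (\<lambda>t. cinner (exp (- \<mu> * of_real t) *\<^sub>C T t x - exp (- \<mu> * of_real t) *\<^sub>C T' t x) y) = 0"
        using integral_linear[OF _ bounded_linear_cinner_left[of y]] by (fastforce simp: o_def)
      then have "integral {0..} (\<lambda>t. exp (- \<mu> * of_real t) * g t) = 0"
        by (simp add: g_def cinner_scaleC_left scaleC_diff_right[symmetric])
      then show ?thesis
        by (subst set_borel_integral_eq_integral(2)[OF set_integrable_exp_bcont[OF g \<mu>(3)]])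
    qed
    define k where "k t = exp (- of_real c * of_real t) * g t" for t
    have k: "set_integrable lborel {0..} k"
      unfolding k_def using c by (intro set_integrable_exp_bcont[OF g]) simp
    note L = mf_integral[OF sets_half_line k[folded integrable_half_line]]
    have cg: "(\<lambda>t. cnj (g t)) \<in> bcont"
      using bcont_bound[OF g] by (metis bcontI bcont_continuous complex_mod_cnj continuous_on_cnj g)
    have "(\<integral>t. k t * cnj (g t) \<partial>restrict_space lborel {0..}) = 0"
    proof (rule mf_unique[OF L(1) _ cg])
      fix n :: nat assume "1 \<le> n"
      have "(\<lambda>t. k t * exp (- of_nat n * of_real t)) = (\<lambda>t. exp (- (of_real c + of_nat n) * of_real t) * g t)"
        by (simp add: k_def fun_eq_iff distrib_right exp_add mult_ac exp_diff exp_minus field_simps)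
      then show "(\<integral>t. k t * exp (- of_nat n * of_real t) \<partial>restrict_space lborel {0..}) = 0"
        using lap[of "of_real c + of_nat n"] by (simp add: integral_half_line)
    qed
    moreover have kg: "k t * cnj (g t) = of_real (exp (- c * t) * (norm (g t))\<^sup>2)" for t
      by (simp add: k_def mult.assoc complex_norm_square[symmetric] exp_of_real[symmetric])
    ultimately have zero: "(LINT t:{0..}|lborel. exp (- c * t) * (norm (g t))\<^sup>2) = 0"
      and int: "set_integrable lborel {0..} (\<lambda>t. exp (- c * t) * (norm (g t))\<^sup>2)"
      using L(2)[OF cg] unfolding kg integrable_half_line[symmetric] integral_half_line[symmetric]
      by (simp_all only: integral_complex_of_real of_real_eq_0_iff complex_of_real_integrable_eq)
    have cont: "continuous_on {0..} (\<lambda>t. exp (- c * t) * (norm (g t))\<^sup>2)"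
      by (intro continuous_intros bcont_continuous[OF g])
    define f where "f t = exp (- c * t) * (norm (g t))\<^sup>2" for t
    have f0: "f t \<ge> 0" for t by (simp add: f_def)
    have fi: "f integrable_on {0..}" "integral {0..} f = 0"
      using set_borel_integral_eq_integral[OF int] zero by (simp_all add: f_def[abs_def])
    \<comment> \<open>The right end \<open>t0 + 1\<close> keeps the interval nondegenerate when
      \<open>t0 = 0\<close>.\<close>
    have fi': "f integrable_on {0..t0+1}"
      by (rule integrable_continuous_real) (use cont in \<open>auto simp: f_def[abs_def] intro: continuous_on_subset\<close>)
    have "integral {0..t0+1} f \<le> integral {0..} f"
      by (intro integral_subset_le fi fi') (auto simp: f0)
    moreover have "0 \<le> integral {0..t0+1} f" by (intro integral_nonneg fi' f0)
    ultimately have "(f has_integral 0) (cbox 0 (t0 + 1))"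
      using fi' fi(2) by (simp add: has_integral_iff)
    then have "f t0 = 0"
      by (rule has_integral_0_cbox_imp_0[rotated 2])
        (use t0 cont f0 in \<open>auto simp: f_def[abs_def] intro: continuous_on_subset\<close>)
    then have "g t0 = 0" by (simp add: f_def)
    then show "cinner (T t0 x) y = cinner (T' t0 x) y" by (simp add: g_def cinner_diff_left)
  qed
qed

lemma hp_semigroup_SUP:
  assumes "bounded_C0_semigroup (T :: real \<Rightarrow> 'h::chilbert_space \<Rightarrow> 'h)" "neg_generates A T"
  shows "hp_semigroup T (SUP t\<in>{0..}. onorm (T t)) A"
proof -
  interpret bdd_semigroup T "SUP t\<in>{0..}. onorm (T t)" by (rule bdd_semigroup_SUP) fact
  have "bounded_C0_semigroup (semigroup_of A) \<and> neg_generates A (semigroup_of A)"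
    unfolding semigroup_of_def by (rule someI[of _ T]) (use assms in simp)
  then show ?thesis
    by unfold_locales (auto intro: generated_semigroup_unique assms)
qed

section \<open>Inverse Laplace transforms\<close>

lemma integrable_1_div_plus_square: "integrable lborel (\<lambda>x::real. 1 / (1 + x\<^sup>2))"
proof -
  have "has_bochner_integral lborel (\<lambda>x. indicator {0..} x * (1 / (1 + x\<^sup>2))) (pi / 2 - arctan 0)"
    by (rule has_bochner_integral_FTC_atLeast[OF _ _ _ tendsto_arctan_at_top])
      (auto intro!: derivative_eq_intros simp: inverse_eq_divide)
  then have 1: "integrable lborel (\<lambda>x::real. indicator {0..} x * (1 / (1 + x\<^sup>2)))" by (rule integrable.intros)
  from lborel_integrable_real_affine[OF this, of "-1" 0]
  have 2: "integrable lborel (\<lambda>x::real. indicator {0..} (- x) * (1 / (1 + x\<^sup>2)))" by simp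
  show ?thesis
    by (rule Bochner_Integration.integrable_bound[OF Bochner_Integration.integrable_add[OF 1 2]])
      (auto simp: indicator_def)
qed

text \<open>Common limit for Cauchy's theorem (\<open>J = 0\<close>) and Cauchy's formula (a pole at
  \<open>z\<close>). On rectangles of half-height N \<ge> h the vertical sides converge to the line
  integrals by domination and the horizontal ones are O(1 / N^2). The factor - i comes from du = i
  d\<xi> on vertical lines.\<close>

lemma rectangle_limit:
  fixes Q :: "complex \<Rightarrow> complex"
  assumes x: "x1 < x2" and cont: "continuous_on {u. x1 \<le> Re u \<and> Re u \<le> x2 \<and> u \<noteq> z} Q"
    and z: "x1 < Re z" "Re z < x2" "\<bar>Im z\<bar> < h"
    and bound: "\<And>u. x1 \<le> Re u \<Longrightarrow> Re u \<le> x2 \<Longrightarrow> Re u = x1 \<or> Re u = x2 \<or> h \<le> \<bar>Im u\<bar> \<Longrightarrow> norm (Q u) \<le> D / (1 + (Im u)\<^sup>2)"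
    and rect: "\<And>N. h \<le> N \<Longrightarrow> (Q has_contour_integral J) (rectpath (Complex x1 (-N)) (Complex x2 N))"
  shows "(LINT \<xi>|lborel. Q (Complex x2 \<xi>)) - (LINT \<xi>|lborel. Q (Complex x1 \<xi>)) = - \<i> * J"
proof -
  define N where "N n = h + real n" for n
  have N: "0 < N n" "h \<le> N n" for n using z by (auto simp: N_def)
  have D: "0 \<le> D" using norm_ge_zero[THEN order_trans, OF bound[of "Complex x1 0"]] x by simp
  have cl: "continuous_on UNIV (\<lambda>\<xi>. Q (Complex x \<xi>))" if "x = x1 \<or> x = x2" for x
    using that \<open>x1 < x2\<close> z unfolding Complex_eq
    by (intro continuous_on_compose2[OF cont] continuous_intros) auto
  have bl: "norm (Q (Complex x \<xi>)) \<le> D / (1 + \<xi>\<^sup>2)" if "x = x1 \<or> x = x2" for x \<xi>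
    using bound[of "Complex x \<xi>"] that \<open>x1 < x2\<close> by auto
  have lim: "(\<lambda>n. integral {-N n..N n} (\<lambda>\<xi>. Q (Complex x \<xi>))) \<longlonglongrightarrow> (LINT \<xi>|lborel. Q (Complex x \<xi>))"
    if xx: "x = x1 \<or> x = x2" for x
  proof -
    have [measurable]: "(\<lambda>\<xi>. Q (Complex x \<xi>)) \<in> borel_measurable borel"
      by (rule borel_measurable_continuous_onI[OF cl[OF xx]])
    have eq: "integral {-N n..N n} (\<lambda>\<xi>. Q (Complex x \<xi>)) = (LINT \<xi>|lborel. indicator {-N n..N n} \<xi> *\<^sub>R Q (Complex x \<xi>))" for n
      using set_borel_integral_eq_integral(2)[OF borel_integrable_atLeastAtMost'[OF continuous_on_subset[OF cl[OF xx]]], of "-N n" "N n"]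
      by (simp add: set_lebesgue_integral_def)
    show ?thesis unfolding eq
    proof (rule integral_dominated_convergence[where w="\<lambda>\<xi>. D * (1 / (1 + \<xi>\<^sup>2))"])
      show "integrable lborel (\<lambda>\<xi>. D * (1 / (1 + \<xi>\<^sup>2)))"
        by (rule integrable_mult_right[OF integrable_1_div_plus_square])
      show "AE \<xi> in lborel. norm (indicator {-N n..N n} \<xi> *\<^sub>R Q (Complex x \<xi>)) \<le> D * (1 / (1 + \<xi>\<^sup>2))" for n
        using bl[OF xx] D by (auto simp: indicator_def)
      show "AE \<xi> in lborel. (\<lambda>n. indicator {-N n..N n} \<xi> *\<^sub>R Q (Complex x \<xi>)) \<longlonglongrightarrow> Q (Complex x \<xi>)"
      proof (rule AE_I2)
        fix \<xi> :: real
        obtain m :: nat where m: "\<bar>\<xi>\<bar> \<le> real m" using real_arch_simple by blast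
        have "\<forall>\<^sub>F n in sequentially. indicator {-N n..N n} \<xi> *\<^sub>R Q (Complex x \<xi>) = Q (Complex x \<xi>)"
          using z m by (intro eventually_sequentiallyI[of m]) (auto simp: N_def indicator_def)
        then show "(\<lambda>n. indicator {-N n..N n} \<xi> *\<^sub>R Q (Complex x \<xi>)) \<longlonglongrightarrow> Q (Complex x \<xi>)"
          by (rule tendsto_eventually)
      qed
    qed auto
  qed
  have diff: "norm (\<i> * (integral {-N n..N n} (\<lambda>\<xi>. Q (Complex x2 \<xi>)) - integral {-N n..N n} (\<lambda>\<xi>. Q (Complex x1 \<xi>))) - J)
      \<le> 2 * (D * (x2 - x1)) / (1 + (N n)\<^sup>2)" for n
  proof -
    define a1 a2 a3 a4 where a: "a1 = Complex x1 (- N n)" "a2 = Complex x2 (- N n)" "a3 = Complex x2 (N n)" "a4 = Complex x1 (N n)"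
    have seg_h: "Im u = t \<and> x1 \<le> Re u \<and> Re u \<le> x2" if "u \<in> closed_segment (Complex x1 t) (Complex x2 t)" for u t
    proof -
      from that obtain s where s: "0 \<le> s" "s \<le> 1" "u = (1 - s) *\<^sub>R Complex x1 t + s *\<^sub>R Complex x2 t"
        by (auto simp: closed_segment_def)
      have "Re u = x1 + s * (x2 - x1)" by (simp add: s algebra_simps)
      moreover have "s * (x2 - x1) \<le> 1 * (x2 - x1)" using s x by (intro mult_right_mono) auto
      moreover have "0 \<le> s * (x2 - x1)" using s x by simp
      ultimately show ?thesis by (simp add: s algebra_simps)
    qed
    have seg_v: "Re u = x" if "u \<in> closed_segment (Complex x s) (Complex x t)" for u s t x
    proof -
      from that obtain r where "u = (1 - r) *\<^sub>R Complex x s + r *\<^sub>R Complex x t"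
        by (auto simp: closed_segment_def)
      then have "Re u = (1 - r) * x + r * x" by simp
      then show ?thesis by (simp add: algebra_simps)
    qed
    have ch: "continuous_on (closed_segment (Complex x1 t) (Complex x2 t)) Q" if "\<bar>t\<bar> = N n" for t
      by (rule continuous_on_subset[OF cont]) (use seg_h that z N(2)[of n] in fastforce)
    have cv: "continuous_on (closed_segment (Complex x s) (Complex x t)) Q" if "x = x1 \<or> x = x2" for s t x
      by (rule continuous_on_subset[OF cont]) (use seg_v that z x in fastforce)
    have i: "Q contour_integrable_on linepath a1 a2" "Q contour_integrable_on linepath a2 a3"
      "Q contour_integrable_on linepath a3 a4" "Q contour_integrable_on linepath a4 a1"
      unfolding a using N(1)[of n] ch[of "- N n"] ch[of "N n"] cv
      by (auto intro!: contour_integrable_continuous_linepath simp: closed_segment_commute[of "Complex x2 (N n)"])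
    have "contour_integral (rectpath a1 a3) Q = J"
      using rect[OF N(2)] unfolding a by (rule contour_integral_unique)
    then have J: "J = contour_integral (linepath a1 a2) Q + contour_integral (linepath a2 a3) Q
        + contour_integral (linepath a3 a4) Q + contour_integral (linepath a4 a1) Q"
      using i by (simp add: rectpath_def Let_def a[symmetric] contour_integrable_joinI) (simp add: a add.assoc)
    have vert: "contour_integral (linepath (Complex x (- N n)) (Complex x (N n))) Q = \<i> * integral {-N n..N n} (\<lambda>\<xi>. Q (Complex x \<xi>))"
      if xx: "x = x1 \<or> x = x2" for x
    proof (rule contour_integral_unique)
      have "((\<lambda>\<xi>. Q (Complex x \<xi>)) has_integral integral {-N n..N n} (\<lambda>\<xi>. Q (Complex x \<xi>))) {-N n..N n}"
        by (intro integrable_integral integrable_continuous_real continuous_on_subset[OF cl[OF xx]]) auto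
      then show "(Q has_contour_integral \<i> * integral {-N n..N n} (\<lambda>\<xi>. Q (Complex x \<xi>))) (linepath (Complex x (- N n)) (Complex x (N n)))"
        by (subst has_contour_integral_linepath_same_Re_iff[of _ x _ "-N n" "N n"]) (use N(1)[of n] in auto)
    qed
    have hor: "norm (contour_integral (linepath (Complex x1 t) (Complex x2 t)) Q) \<le> D / (1 + (N n)\<^sup>2) * (x2 - x1)" if t: "\<bar>t\<bar> = N n" for t
    proof -
      have "t\<^sup>2 = (N n)\<^sup>2" using t by (metis power2_abs)
      have "norm (contour_integral (linepath (Complex x1 t) (Complex x2 t)) Q) \<le> D / (1 + (N n)\<^sup>2) * norm (Complex x2 t - Complex x1 t)"
      proof (rule contour_integral_bound_linepath)
        show "Q contour_integrable_on linepath (Complex x1 t) (Complex x2 t)"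
          by (rule contour_integrable_continuous_linepath[OF ch[OF t]])
        show "0 \<le> D / (1 + (N n)\<^sup>2)" using D by simp
        fix u assume "u \<in> closed_segment (Complex x1 t) (Complex x2 t)"
        from seg_h[OF this] show "norm (Q u) \<le> D / (1 + (N n)\<^sup>2)"
          using bound[of u] t N(2)[of n] \<open>t\<^sup>2 = (N n)\<^sup>2\<close> by auto
      qed
      also have "norm (Complex x2 t - Complex x1 t) = x2 - x1" using x by (simp add: cmod_def)
      finally show ?thesis .
    qed
    have "\<i> * (integral {-N n..N n} (\<lambda>\<xi>. Q (Complex x2 \<xi>)) - integral {-N n..N n} (\<lambda>\<xi>. Q (Complex x1 \<xi>))) - J
        = contour_integral (linepath a4 a3) Q - contour_integral (linepath a1 a2) Q"
      using J vert[of x1] vert[of x2] contour_integral_reverse_linepath[of a3 a4 Q] contour_integral_reverse_linepath[of a4 a1 Q]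
        ch[of "N n"] cv[of x1] N(1)[of n]
      by (simp add: a closed_segment_commute[of "Complex x2 (N n)"] algebra_simps)
    also have "norm \<dots> \<le> D / (1 + (N n)\<^sup>2) * (x2 - x1) + D / (1 + (N n)\<^sup>2) * (x2 - x1)"
      unfolding a by (intro order_trans[OF norm_triangle_ineq4] add_mono hor) (use N(1)[of n] in auto)
    finally show ?thesis by simp
  qed
  have "(\<lambda>n. 2 * (D * (x2 - x1)) / (1 + (N n)\<^sup>2)) \<longlonglongrightarrow> 0"
    unfolding N_def by real_asymp
  from Lim_null_comparison[OF always_eventually[OF allI[OF diff]] this]
  have "(\<lambda>n. \<i> * (integral {-N n..N n} (\<lambda>\<xi>. Q (Complex x2 \<xi>)) - integral {-N n..N n} (\<lambda>\<xi>. Q (Complex x1 \<xi>))) - J) \<longlonglongrightarrow> 0" .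
  moreover have "(\<lambda>n. \<i> * (integral {-N n..N n} (\<lambda>\<xi>. Q (Complex x2 \<xi>)) - integral {-N n..N n} (\<lambda>\<xi>. Q (Complex x1 \<xi>))) - J)
     \<longlonglongrightarrow> \<i> * ((LINT \<xi>|lborel. Q (Complex x2 \<xi>)) - (LINT \<xi>|lborel. Q (Complex x1 \<xi>))) - J"
    by (intro tendsto_intros lim) auto
  ultimately have "\<i> * ((LINT \<xi>|lborel. Q (Complex x2 \<xi>)) - (LINT \<xi>|lborel. Q (Complex x1 \<xi>))) - J = 0"
    by (rule LIMSEQ_unique[symmetric])
  then have "J = \<i> * ((LINT \<xi>|lborel. Q (Complex x2 \<xi>)) - (LINT \<xi>|lborel. Q (Complex x1 \<xi>)))" by simp
  then show ?thesis by (simp add: mult.assoc[symmetric])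
qed

section \<open>Moving vertical lines, and Cauchy's formula for a strip\<close>

lemma convex_right_half_plane: "convex (right_half_plane w)" and open_right_half_plane: "open (right_half_plane w)"
  unfolding right_half_plane_def by (auto simp: convex_halfspace_Re_gt open_halfspace_Re_gt)

lemma path_image_rectpath_right_half_plane:
  assumes "w < x1" "x1 < x2" "0 < N"
  shows "path_image (rectpath (Complex x1 (-N)) (Complex x2 N)) \<subseteq> right_half_plane w"
  using path_image_rectpath_subset_cbox[of "Complex x1 (-N)" "Complex x2 N"] assms
  by (fastforce simp: right_half_plane_def in_cbox_complex_iff)

lemma line_integral_shift:
  fixes Q :: "complex \<Rightarrow> complex"
  assumes Q: "Q holomorphic_on right_half_plane w" and x: "w < x1" "x1 \<le> x2"
    and bound: "\<And>u. x1 \<le> Re u \<Longrightarrow> Re u \<le> x2 \<Longrightarrow> norm (Q u) \<le> D / (1 + (Im u)\<^sup>2)"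
  shows "(LINT \<xi>|lborel. Q (Complex x2 \<xi>)) = (LINT \<xi>|lborel. Q (Complex x1 \<xi>))"
proof (cases "x1 = x2")
  case False
  \<comment> \<open>Since \<open>Q\<close> is holomorphic throughout, the excluded point may lie
    anywhere between the two lines; the midpoint is taken.\<close>
  define z where "z = Complex ((x1 + x2) / 2) 0"
  have "(LINT \<xi>|lborel. Q (Complex x2 \<xi>)) - (LINT \<xi>|lborel. Q (Complex x1 \<xi>)) = - \<i> * 0"
  proof (rule rectangle_limit[where z=z and h=1])
    show "continuous_on {u. x1 \<le> Re u \<and> Re u \<le> x2 \<and> u \<noteq> z} Q"
      by (rule continuous_on_subset[OF holomorphic_on_imp_continuous_on[OF Q]]) (use x in \<open>auto simp: right_half_plane_def\<close>)
    show "(Q has_contour_integral 0) (rectpath (Complex x1 (-N)) (Complex x2 N))" if "1 \<le> N" for N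
      by (rule Cauchy_theorem_convex_simple[OF Q convex_right_half_plane _ path_image_rectpath_right_half_plane])
        (use x False that in auto)
  qed (use x False bound in \<open>auto simp: z_def\<close>)
  then show ?thesis by simp
qed simp

lemma line_integral_Cauchy:
  fixes G :: "complex \<Rightarrow> complex"
  assumes G: "G holomorphic_on right_half_plane w" and x: "w < x1" "x1 < Re z" "Re z < x2"
    and bound: "\<And>u. x1 \<le> Re u \<Longrightarrow> norm (G u) \<le> C / (1 + (Im u)\<^sup>2)"
  shows "(LINT \<xi>|lborel. G (Complex x2 \<xi>) / (Complex x2 \<xi> - z)) - (LINT \<xi>|lborel. G (Complex x1 \<xi>) / (Complex x1 \<xi> - z)) = 2 * pi * G z"
proof -
  \<comment> \<open>A lower bound for the distance from \<open>z\<close> to the two lines and to the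
    points with |Im u| \<ge> |Im z| + 1; the latter account for the entry 1.\<close>
  define \<delta> where "\<delta> = min 1 (min (Re z - x1) (x2 - Re z))"
  have \<delta>: "0 < \<delta>" using x by (auto simp: \<delta>_def)
  have z: "z \<in> right_half_plane w" using x by (simp add: right_half_plane_def)
  have "(LINT \<xi>|lborel. G (Complex x2 \<xi>) / (Complex x2 \<xi> - z)) - (LINT \<xi>|lborel. G (Complex x1 \<xi>) / (Complex x1 \<xi> - z)) = - \<i> * (2 * pi * \<i> * 1 * G z)"
  proof (rule rectangle_limit[where z=z and h="\<bar>Im z\<bar> + 1" and D="C / \<delta>"])
    show "continuous_on {u. x1 \<le> Re u \<and> Re u \<le> x2 \<and> u \<noteq> z} (\<lambda>u. G u / (u - z))"
      by (intro continuous_intros continuous_on_subset[OF holomorphic_on_imp_continuous_on[OF G]])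
        (use x in \<open>auto simp: right_half_plane_def\<close>)
    fix N assume N: "\<bar>Im z\<bar> + 1 \<le> N"
    have box: "z \<in> box (Complex x1 (-N)) (Complex x2 N)" using x N by (auto simp: in_box_complex_iff)
    have pi: "path_image (rectpath (Complex x1 (-N)) (Complex x2 N)) \<subseteq> right_half_plane w - {z}"
    proof -
      have "z \<notin> path_image (rectpath (Complex x1 (-N)) (Complex x2 N))"
        using path_image_rectpath_cbox_minus_box[of "Complex x1 (-N)" "Complex x2 N"] box x N by auto
      moreover have "path_image (rectpath (Complex x1 (-N)) (Complex x2 N)) \<subseteq> right_half_plane w"
        by (rule path_image_rectpath_right_half_plane) (use x N in auto)
      ultimately show ?thesis by blast
    qed
    have "((\<lambda>u. G u / (u - z)) has_contour_integral 2 * pi * \<i> * winding_number (rectpath (Complex x1 (-N)) (Complex x2 N)) z * G z) (rectpath (Complex x1 (-N)) (Complex x2 N))"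
      by (rule Cauchy_integral_formula_convex_simple[OF convex_right_half_plane[of w] G _ _ pi])
        (use z open_right_half_plane in \<open>auto simp: interior_open\<close>)
    then show "((\<lambda>u. G u / (u - z)) has_contour_integral 2 * pi * \<i> * 1 * G z) (rectpath (Complex x1 (-N)) (Complex x2 N))"
      by (simp add: winding_number_rectpath[OF box])
  next
    fix u assume u: "x1 \<le> Re u" "Re u \<le> x2" "Re u = x1 \<or> Re u = x2 \<or> \<bar>Im z\<bar> + 1 \<le> \<bar>Im u\<bar>"
    have "\<delta> \<le> norm (u - z)"
      using abs_Re_le_cmod[of "u - z"] abs_Im_le_cmod[of "u - z"] u(3) by (auto simp: \<delta>_def)
    then have "norm (G u / (u - z)) \<le> (C / (1 + (Im u)\<^sup>2)) / \<delta>"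
      unfolding norm_divide using bound[OF u(1)] \<delta> order_trans[OF norm_ge_zero bound[OF u(1)]]
      by (intro frac_le)
    then show "norm (G u / (u - z)) \<le> C / \<delta> / (1 + (Im u)\<^sup>2)" by (simp add: mult.commute)
  qed (use x in auto)
  then show ?thesis by simp
qed

lemma LINT_exp_atLeast:
  assumes s: "0 < Re s"
  shows "(LINT t:{0..}|lborel. exp (- s * of_real t)) = 1 / s"
    and "set_integrable lborel {0..} (\<lambda>t. exp (- s * of_real t))"
proof -
  show i: "set_integrable lborel {0..} (\<lambda>t. exp (- s * of_real t))"
    using set_integrable_exp_bcont[OF bcont_const[of 1] s] by simp
  have s0: "s \<noteq> 0" using s by auto
  have "((\<lambda>y. \<integral>t. indicator {..y} t *\<^sub>R (indicator {0..} t *\<^sub>R exp (- s * of_real t)) \<partial>lborel) \<longlongrightarrow> (LINT t:{0..}|lborel. exp (- s * of_real t))) at_top"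
    unfolding set_lebesgue_integral_def by (rule tendsto_integral_at_top) (use i in \<open>auto simp: set_integrable_def\<close>)
  moreover have "\<forall>\<^sub>F y in at_top. (\<integral>t. indicator {..y} t *\<^sub>R (indicator {0..} t *\<^sub>R exp (- s * of_real t)) \<partial>lborel) = 1 / s - exp (- s * of_real y) / s"
    using eventually_ge_at_top[of 0]
  proof eventually_elim
    fix y :: real assume y: "0 \<le> y"
    have "(\<integral>t. indicator {..y} t *\<^sub>R (indicator {0..} t *\<^sub>R exp (- s * of_real t)) \<partial>lborel) = (\<integral>t. indicator {0..y} t *\<^sub>R exp (- s * of_real t) \<partial>lborel)"
      by (intro Bochner_Integration.integral_cong) (auto simp: indicator_def)
    also have "\<dots> = (- exp (- s * of_real y) / s) - (- exp (- s * of_real 0) / s)"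
    proof (rule integral_FTC_atLeastAtMost[OF y])
      fix x
      have "((\<lambda>z. - exp (- s * z) / s) has_field_derivative exp (- s * of_real x)) (at (of_real x))"
        using s0 by (auto intro!: derivative_eq_intros)
      from has_vector_derivative_real_field[OF this]
      show "((\<lambda>t. - exp (- s * of_real t) / s) has_vector_derivative exp (- s * of_real x)) (at x within {0..y})" .
    qed (intro continuous_intros)
    finally show "(\<integral>t. indicator {..y} t *\<^sub>R (indicator {0..} t *\<^sub>R exp (- s * of_real t)) \<partial>lborel) = 1 / s - exp (- s * of_real y) / s"
      by simp
  qed
  ultimately have "((\<lambda>y. 1 / s - exp (- s * of_real y) / s) \<longlongrightarrow> (LINT t:{0..}|lborel. exp (- s * of_real t))) at_top"
    by (rule Lim_transform_eventually)
  moreover have "((\<lambda>y. 1 / s - exp (- s * of_real y) / s) \<longlongrightarrow> 1 / s - 0 / s) at_top"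
  proof (intro tendsto_intros s0)
    have "((\<lambda>y. exp (- Re s * y)) \<longlongrightarrow> 0) at_top"
      using s by real_asymp
    then show "((\<lambda>y. exp (- s * complex_of_real y)) \<longlongrightarrow> 0) at_top"
      by (rule tendsto_norm_zero_cancel[OF tendsto_cong[THEN iffD1, rotated]]) auto
  qed
  ultimately show "(LINT t:{0..}|lborel. exp (- s * of_real t)) = 1 / s"
    using tendsto_unique[OF trivial_limit_at_top_linorder] by fastforce
qed

text \<open>The Bromwich integral on the line Re z = - a. For a > 0 this line lies to the left of
  the imaginary axis, which gives the kernel its decay exp (- a t).\<close>

definition inverse_laplace :: "(complex \<Rightarrow> complex) \<Rightarrow> real \<Rightarrow> real \<Rightarrow> complex" where
  "inverse_laplace G a t = (LINT \<xi>|lborel. G (Complex (-a) \<xi>) * exp (Complex (-a) \<xi> * of_real t)) / (2 * pi)"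

text \<open>By Fubini the Laplace transform of \<open>k\<close> at z is, up to a factor, a Cauchy
  integral over Re u = - a. Cauchy's formula for a strip contains in addition a line at distance r
  to the right of z, whose contribution is O(1 / r) and disappears as r tends to infinity.\<close>

lemma inverse_laplace:
  fixes G :: "complex \<Rightarrow> complex"
  assumes G: "G holomorphic_on right_half_plane w" and a: "w < - a"
    and bound: "\<And>u. - a \<le> Re u \<Longrightarrow> norm (G u) \<le> C / (1 + (Im u)\<^sup>2)"
  defines "k \<equiv> inverse_laplace G a"
  shows inverse_laplace_line: "\<And>x t. - a \<le> x \<Longrightarrow> 0 \<le> t \<Longrightarrow> k t = (LINT \<xi>|lborel. G (Complex x \<xi>) * exp (Complex x \<xi> * of_real t)) / (2 * pi)"
    and inverse_laplace_bound: "\<And>t. norm (k t) \<le> exp (- a * t) * ((LINT \<xi>|lborel. C / (1 + \<xi>\<^sup>2)) / (2 * pi))"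
    and inverse_laplace_measurable: "k \<in> borel_measurable borel"
    and laplace_inverse_laplace: "\<And>z. - a < Re z \<Longrightarrow> (LINT t:{0..}|lborel. k t * exp (- z * of_real t)) = G z"
proof -
  have k: "k = (\<lambda>t. (LINT \<xi>|lborel. G (Complex (-a) \<xi>) * exp (Complex (-a) \<xi> * of_real t)) / (2 * pi))"
    by (simp add: k_def inverse_laplace_def fun_eq_iff)
  have C: "0 \<le> C" using order_trans[OF norm_ge_zero bound[of "of_real (-a)"]] by simp
  show "k t = (LINT \<xi>|lborel. G (Complex x \<xi>) * exp (Complex x \<xi> * of_real t)) / (2 * pi)" if "- a \<le> x" "0 \<le> t" for x t
  proof -
    have "(LINT \<xi>|lborel. G (Complex x \<xi>) * exp (Complex x \<xi> * of_real t)) = (LINT \<xi>|lborel. G (Complex (-a) \<xi>) * exp (Complex (-a) \<xi> * of_real t))"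
    proof (rule line_integral_shift[where Q="\<lambda>u. G u * exp (u * of_real t)" and D="C * exp (x * t)"])
      fix u assume u: "- a \<le> Re u" "Re u \<le> x"
      then have "norm (G u * exp (u * of_real t)) \<le> C / (1 + (Im u)\<^sup>2) * exp (x * t)"
        unfolding norm_mult using that by (intro mult_mono bound) (auto simp: mult_right_mono C)
      then show "norm (G u * exp (u * of_real t)) \<le> C * exp (x * t) / (1 + (Im u)\<^sup>2)" by simp
    qed (use a that in \<open>auto intro!: holomorphic_intros G\<close>)
    then show ?thesis by (simp add: k)
  qed
  have cG: "continuous_on UNIV (\<lambda>\<xi>. G (Complex (-a) \<xi>))"
    unfolding Complex_eq
    by (intro continuous_on_compose2[OF holomorphic_on_imp_continuous_on[OF G]] continuous_intros)
      (use a in \<open>auto simp: right_half_plane_def\<close>)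
  then have [measurable]: "(\<lambda>\<xi>. G (Complex (-a) \<xi>)) \<in> borel_measurable borel" by (rule borel_measurable_continuous_onI)
  have [measurable]: "(\<lambda>\<xi>. Complex (-a) \<xi>) \<in> borel_measurable borel"
    unfolding Complex_eq by measurable
  show k_meas [measurable]: "k \<in> borel_measurable borel" unfolding k by measurable
  have int1: "integrable lborel (\<lambda>\<xi>::real. C / (1 + \<xi>\<^sup>2))"
    using integrable_mult_right[OF integrable_1_div_plus_square, of C] by simp
  have nb: "norm (G (Complex (-a) \<xi>)) \<le> C / (1 + \<xi>\<^sup>2)" for \<xi> using bound[of "Complex (-a) \<xi>"] by simp
  show kb: "norm (k t) \<le> exp (- a * t) * ((LINT \<xi>|lborel. C / (1 + \<xi>\<^sup>2)) / (2 * pi))" for t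
  proof -
    have "norm (LINT \<xi>|lborel. G (Complex (-a) \<xi>) * exp (Complex (-a) \<xi> * of_real t)) \<le> (LINT \<xi>|lborel. exp (- a * t) * (C / (1 + \<xi>\<^sup>2)))"
    proof (rule Bochner_Integration.integral_norm_bound_integral)
      show "norm (G (Complex (-a) \<xi>) * exp (Complex (-a) \<xi> * of_real t)) \<le> exp (- a * t) * (C / (1 + \<xi>\<^sup>2))" for \<xi>
        using mult_right_mono[OF nb[of \<xi>], of "exp (- a * t)"] by (simp add: norm_mult mult.commute)
      show "integrable lborel (\<lambda>\<xi>. G (Complex (-a) \<xi>) * exp (Complex (-a) \<xi> * of_real t))"
        by (rule Bochner_Integration.integrable_bound[OF integrable_mult_right[OF int1, of "exp (- a * t)"]])
          (use mult_right_mono[OF nb, of "exp (- a * t)"] C in \<open>auto simp: norm_mult mult.commute\<close>)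
    qed (rule integrable_mult_right[OF int1])
    also have "\<dots> = exp (- a * t) * (LINT \<xi>|lborel. C / (1 + \<xi>\<^sup>2))"
      by (rule integral_mult_right_zero)
    finally show ?thesis by (simp add: k norm_divide divide_right_mono)
  qed
  show "(LINT t:{0..}|lborel. k t * exp (- z * of_real t)) = G z" if z: "- a < Re z" for z
  proof -
    define f where "f t \<xi> = indicator {0..} t *\<^sub>R (G (Complex (-a) \<xi>) * exp (- (z - Complex (-a) \<xi>) * of_real t))" for t \<xi>
    have "0 < Re z + a" using z by simp
    note p = integrable_pair_mult[OF integrable_exp_atLeast[OF this] int1]
    have [measurable]: "case_prod f \<in> borel_measurable (lborel \<Otimes>\<^sub>M lborel)"
      unfolding f_def[abs_def] by measurable
    have "integrable (lborel \<Otimes>\<^sub>M lborel) (case_prod f)"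
    proof (rule Bochner_Integration.integrable_bound[OF p])
      show "AE p in lborel \<Otimes>\<^sub>M lborel. norm (case_prod f p) \<le> norm (case p of (t, \<xi>) \<Rightarrow> indicator {0..} t * exp (- (Re z + a) * t) * (C / (1 + \<xi>\<^sup>2)))"
      proof (rule AE_I2)
        fix p :: "real \<times> real"
        obtain t \<xi> where p: "p = (t, \<xi>)" by (cases p)
        have "norm (f t \<xi>) = indicator {0..} t * (norm (G (Complex (-a) \<xi>)) * exp (- (Re z + a) * t))"
          by (simp add: f_def norm_mult)
        also have "\<dots> \<le> indicator {0..} t * (C / (1 + \<xi>\<^sup>2) * exp (- (Re z + a) * t))"
          by (intro mult_left_mono mult_right_mono nb) auto
        finally show "norm (case_prod f p) \<le> norm (case p of (t, \<xi>) \<Rightarrow> indicator {0..} t * exp (- (Re z + a) * t) * (C / (1 + \<xi>\<^sup>2)))"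
          using C by (simp add: p abs_mult mult_ac)
      qed
    qed measurable
    from lborel_pair.Fubini_integral[OF this]
    have F: "(\<integral>\<xi>. \<integral>t. f t \<xi> \<partial>lborel \<partial>lborel) = (\<integral>t. \<integral>\<xi>. f t \<xi> \<partial>lborel \<partial>lborel)" .
    have f1: "(\<integral>\<xi>. f t \<xi> \<partial>lborel) = (2 * pi) * (indicator {0..} t *\<^sub>R (k t * exp (- z * of_real t)))" for t
    proof -
      have "f t \<xi> = (indicator {0..} t *\<^sub>R exp (- z * of_real t)) * (G (Complex (-a) \<xi>) * exp (Complex (-a) \<xi> * of_real t))" for \<xi>
        by (simp add: f_def exp_diff left_diff_distrib exp_minus field_simps indicator_def)
      then show ?thesis by (simp add: k)
    qed
    have f2: "(\<integral>t. f t \<xi> \<partial>lborel) = - (G (Complex (-a) \<xi>) / (Complex (-a) \<xi> - z))" for \<xi>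
    proof -
      have "(\<integral>t. f t \<xi> \<partial>lborel) = (\<integral>t. G (Complex (-a) \<xi>) * (indicator {0..} t *\<^sub>R exp (- (z - Complex (-a) \<xi>) * of_real t)) \<partial>lborel)"
        by (simp add: f_def)
      also have "\<dots> = G (Complex (-a) \<xi>) * (LINT t:{0..}|lborel. exp (- (z - Complex (-a) \<xi>) * of_real t))"
        unfolding set_lebesgue_integral_def by (rule integral_mult_right_zero)
      also have "\<dots> = G (Complex (-a) \<xi>) * (1 / (z - Complex (-a) \<xi>))"
        by (subst LINT_exp_atLeast(1)) (use z in auto)
      also have "\<dots> = - (G (Complex (-a) \<xi>) / (Complex (-a) \<xi> - z))"
        by (metis minus_diff_eq minus_divide_right mult.right_neutral times_divide_eq_right)
      finally show ?thesis .
    qed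
    define I where "I = (\<integral>\<xi>. G (Complex (-a) \<xi>) / (Complex (-a) \<xi> - z) \<partial>lborel)"
    have "(2 * pi) * (LINT t:{0..}|lborel. k t * exp (- z * of_real t)) = - I"
    proof -
      have "(2 * pi) * (LINT t:{0..}|lborel. k t * exp (- z * of_real t)) = (\<integral>t. \<integral>\<xi>. f t \<xi> \<partial>lborel \<partial>lborel)"
        unfolding f1 set_lebesgue_integral_def by (rule integral_mult_right_zero[symmetric])
      also have "\<dots> = - I" unfolding F[symmetric] f2 by (simp add: I_def)
      finally show ?thesis .
    qed
    moreover have "- I = 2 * pi * G z"
    proof -
      define J where "J = (LINT \<xi>|lborel. C / (1 + \<xi>\<^sup>2))"
      have le: "norm (I + 2 * pi * G z) \<le> J / r" if r: "0 < r" for r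
      proof -
        define x where "x = Re z + r"
        have "(LINT \<xi>|lborel. G (Complex x \<xi>) / (Complex x \<xi> - z)) = I + 2 * pi * G z"
          using line_integral_Cauchy[OF G a z, of x C] bound r by (simp add: x_def I_def algebra_simps)
        moreover have "norm (LINT \<xi>|lborel. G (Complex x \<xi>) / (Complex x \<xi> - z)) \<le> (LINT \<xi>|lborel. C / (1 + \<xi>\<^sup>2) / r)"
        proof (rule Bochner_Integration.integral_norm_bound_integral)
          have nx: "norm (G (Complex x \<xi>) / (Complex x \<xi> - z)) \<le> C / (1 + \<xi>\<^sup>2) / r" for \<xi>
          proof -
            have "r \<le> norm (Complex x \<xi> - z)"
              using abs_Re_le_cmod[of "Complex x \<xi> - z"] by (simp add: x_def)
            then show ?thesis
              unfolding norm_divide using bound[of "Complex x \<xi>"] r z C by (intro frac_le) (auto simp: x_def)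
          qed
          then show "norm (G (Complex x \<xi>) / (Complex x \<xi> - z)) \<le> C / (1 + \<xi>\<^sup>2) / r" for \<xi> .
          have "continuous_on UNIV (\<lambda>\<xi>. G (Complex x \<xi>) / (Complex x \<xi> - z))"
            unfolding Complex_eq
            by (intro continuous_on_compose2[OF holomorphic_on_imp_continuous_on[OF G]] continuous_intros)
              (use a z r in \<open>auto simp: right_half_plane_def x_def complex_eq_iff\<close>)
          then show "integrable lborel (\<lambda>\<xi>. G (Complex x \<xi>) / (Complex x \<xi> - z))"
            by (intro Bochner_Integration.integrable_bound[OF integrable_divide_zero[OF int1, of r]]
                AE_I2 order_trans[OF nx]) (use C r in \<open>auto intro: borel_measurable_continuous_onI\<close>)
        qed (rule integrable_divide_zero[OF int1])
        moreover have "(LINT \<xi>|lborel. C / (1 + \<xi>\<^sup>2) / r) = J / r"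
          unfolding J_def by (rule integral_divide_zero)
        ultimately show ?thesis by simp
      qed
      have "((\<lambda>r. J / r) \<longlongrightarrow> 0) at_top" by real_asymp
      then have "norm (I + 2 * pi * G z) \<le> 0"
      proof (rule tendsto_lowerbound)
        show "\<forall>\<^sub>F r in at_top. norm (I + 2 * pi * G z) \<le> J / r"
          using eventually_gt_at_top[of 0] by eventually_elim (rule le)
      qed simp
      then have "I + 2 * pi * G z = 0" by simp
      then show ?thesis by (metis add_eq_0_iff2 minus_minus add_eq_0_iff)
    qed
    ultimately show ?thesis by simp
  qed
qed

section \<open>Gamma integrals with a complex rate\<close>

lemma has_bochner_integral_powr_exp:
  assumes "0 < \<alpha>" "0 < (c::real)"
  shows "has_bochner_integral lborel (\<lambda>t. indicator {0..} t * (t powr (\<alpha> - 1) * exp (- c * t))) (Gamma \<alpha> * c powr (- \<alpha>))"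
proof -
  let ?f = "\<lambda>t::real. indicator {0..} t * t powr (\<alpha> - 1) / exp t"
  have "has_bochner_integral lborel ?f (Gamma \<alpha>)"
    by (rule has_bochner_integral_nn_integral)
      (use assms in \<open>auto simp: Gamma_conv_nn_integral_real Gamma_real_nonneg\<close>)
  then have "has_bochner_integral lborel (\<lambda>t. ?f (0 + c * t)) (Gamma \<alpha> /\<^sub>R \<bar>c\<bar>)"
    using assms by (subst lborel_has_bochner_integral_real_affine_iff[symmetric]) auto
  then have "has_bochner_integral lborel (\<lambda>t. c powr (1 - \<alpha>) * ?f (c * t)) (c powr (1 - \<alpha>) * (Gamma \<alpha> /\<^sub>R \<bar>c\<bar>))"
    by (intro has_bochner_integral_mult_right) simp
  moreover have "c powr (1 - \<alpha>) * ?f (c * t) = indicator {0..} t * (t powr (\<alpha> - 1) * exp (- c * t))" for t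
    using assms by (auto simp: indicator_def powr_mult exp_minus field_simps powr_add[symmetric] zero_le_mult_iff simp flip: powr_add)
  moreover have "c powr (1 - \<alpha>) * (Gamma \<alpha> /\<^sub>R \<bar>c\<bar>) = Gamma \<alpha> * c powr (- \<alpha>)"
    using assms by (simp add: powr_diff powr_minus field_simps)
  ultimately show ?thesis by (simp only:)
qed

lemma set_integrable_powr_exp:
  assumes "0 < \<alpha>" "0 < Re s"
  shows "set_integrable lborel {0..} (\<lambda>t. of_real (t powr (\<alpha> - 1)) * exp (- s * of_real t))"
  unfolding set_integrable_def
  by (rule Bochner_Integration.integrable_bound[OF integrable.intros[OF has_bochner_integral_powr_exp[OF assms]]])
    (auto simp: norm_mult indicator_def)

text \<open>For real \<open>s\<close> this is the Gamma integral. A complex \<open>s\<close> lies in the disc around some large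
  \<open>c > 0\<close> that touches \<open>0\<close>, where both sides are given by the binomial series in \<open>s / c - 1\<close>.\<close>

lemma LINT_powr_exp:
  assumes \<alpha>: "0 < \<alpha>" and s: "0 < Re s"
  shows "(LINT t:{0..}|lborel. of_real (t powr (\<alpha> - 1)) * exp (- s * of_real t)) = of_real (Gamma \<alpha>) * s powr (- of_real \<alpha>)"
proof -
  \<comment> \<open>This choice gives |s - c|^2 = c^2 - |s|^2 < c^2, so that |s / c - 1| <
    1.\<close>
  define c where "c = (norm s)\<^sup>2 / Re s"
  define \<eta> where "\<eta> = s - of_real c"
  have s0: "s \<noteq> 0" using s by auto
  have c: "0 < c" using s s0 by (simp add: c_def)
  have "(norm \<eta>)\<^sup>2 = (norm s)\<^sup>2 - 2 * c * Re s + c\<^sup>2"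
    unfolding \<eta>_def cmod_power2 by (simp add: power2_eq_square algebra_simps)
  also have "\<dots> < c\<^sup>2" using s s0 by (simp add: c_def)
  finally have \<eta>c: "norm \<eta> < c" using c by (metis less_eq_real_def power2_less_imp_less)
  define f where "f k t = (indicator {0..} t * (t powr (\<alpha> + real k - 1) * exp (- c * t))) *\<^sub>R ((- \<eta>) ^ k / fact k)" for k t
  have G: "Gamma (\<alpha> + real k) = Gamma \<alpha> * pochhammer \<alpha> k" for k
  proof -
    have "\<alpha> \<notin> \<int>\<^sub>\<le>\<^sub>0" using \<alpha> by (auto elim!: nonpos_Ints_cases)
    then show ?thesis using Gamma_real_pos[OF \<alpha>] by (simp add: pochhammer_Gamma)
  qed
  have fk: "has_bochner_integral lborel (f k) ((Gamma (\<alpha> + real k) * c powr (- (\<alpha> + real k))) *\<^sub>R ((- \<eta>) ^ k / fact k))" for k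
    unfolding f_def using \<alpha> c
    by (intro has_bochner_integral_scaleR_left has_bochner_integral_powr_exp) auto
  have cpow: "c powr (- (\<alpha> + real k)) = c powr (- \<alpha>) / c ^ k" for k
    using c by (simp add: powr_diff powr_realpow powr_minus powr_add divide_simps)
  have val: "(\<integral>t. f k t \<partial>lborel) = (of_real (Gamma \<alpha> * c powr (- \<alpha>))) * (((- of_real \<alpha>) gchoose k) * (\<eta> / of_real c) ^ k)" for k
  proof -
    have "(of_real (pochhammer \<alpha> k) :: complex) = pochhammer (of_real \<alpha>) k" by (simp add: pochhammer_of_real)
    then show ?thesis
      using fk[of k] c unfolding G cpow
      by (simp add: has_bochner_integral_integral_eq gbinomial_pochhammer scaleR_conv_of_real power_minus[of \<eta>] power_divide
            mult_ac)
  qed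
  \<comment> \<open>These integrals are the terms of the binomial series of (1 - |\<eta>| / c)^(-
    \<alpha>); their summability justifies integration term by term.\<close>
  have nval: "(\<integral>t. norm (f k t) \<partial>lborel) = Gamma \<alpha> * c powr (- \<alpha>) * (((- \<alpha>) gchoose k) * (- (norm \<eta> / c)) ^ k)" for k
  proof -
    have "norm (f k t) = (indicator {0..} t * (t powr (\<alpha> + real k - 1) * exp (- c * t))) * (norm \<eta> ^ k / fact k)" for t
      by (simp add: f_def norm_divide norm_power abs_mult)
    then have "(\<integral>t. norm (f k t) \<partial>lborel) = (Gamma (\<alpha> + real k) * c powr (- (\<alpha> + real k))) * (norm \<eta> ^ k / fact k)"
      using has_bochner_integral_integral_eq[OF has_bochner_integral_mult_left[OF has_bochner_integral_powr_exp[of "\<alpha> + real k" c], of "norm \<eta> ^ k / fact k"]] \<alpha> c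
      by (simp only:)
    then show ?thesis
      unfolding G cpow by (simp add: gbinomial_pochhammer power_divide power_minus[of "norm \<eta> / c"] field_simps)
  qed
  have sum_exp: "(\<lambda>k. f k t) sums (indicator {0..} t *\<^sub>R (of_real (t powr (\<alpha> - 1)) * exp (- s * of_real t)))"
    and sum_norm: "summable (\<lambda>k. norm (f k t))" if "t \<noteq> 0" for t
  proof -
    have e: "f k t = (indicator {0..} t * (t powr (\<alpha> - 1) * exp (- c * t))) *\<^sub>R (((- \<eta> * of_real t) ^ k) /\<^sub>R fact k)" for k
      unfolding power_mult_distrib using that
      by (cases "0 < t") (auto simp: f_def indicator_def powr_add powr_realpow powr_diff scaleR_conv_of_real field_simps)
    have 1: "(\<lambda>k. ((- \<eta> * of_real t) ^ k) /\<^sub>R fact k) sums exp (- \<eta> * of_real t)" by (rule exp_converges)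
    have "exp (- s * of_real t) = exp (- \<eta> * of_real t) * of_real (exp (- c * t))"
      by (simp add: \<eta>_def exp_of_real[symmetric] exp_add[symmetric] algebra_simps)
    then show "(\<lambda>k. f k t) sums (indicator {0..} t *\<^sub>R (of_real (t powr (\<alpha> - 1)) * exp (- s * of_real t)))"
      using sums_scaleR_right[OF 1, of "indicator {0..} t * (t powr (\<alpha> - 1) * exp (- c * t))"]
      unfolding e by (simp add: scaleR_conv_of_real mult_ac)
    show "summable (\<lambda>k. norm (f k t))"
      unfolding e norm_scaleR using summable_norm_exp[of "- \<eta> * of_real t"] by (intro summable_mult) auto
  qed
  have ae: "AE t in lborel. t \<noteq> (0::real)" by (rule AE_lborel_singleton)
  have "(\<lambda>k. \<integral>t. f k t \<partial>lborel) sums (\<integral>t. (\<Sum>k. f k t) \<partial>lborel)"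
  proof (rule sums_integral)
    show "integrable lborel (f k)" for k using fk by (rule integrable.intros)
    show "AE t in lborel. summable (\<lambda>k. norm (f k t))" using ae by eventually_elim (rule sum_norm)
    have "summable (\<lambda>k. ((- \<alpha>) gchoose k) * (- (norm \<eta> / c)) ^ k)"
      using gen_binomial_real[of "- (norm \<eta> / c)" "-\<alpha>"] \<eta>c c by (auto simp: sums_iff)
    then show "summable (\<lambda>k. \<integral>t. norm (f k t) \<partial>lborel)"
      unfolding nval by (rule summable_mult)
  qed
  moreover have "(\<integral>t. (\<Sum>k. f k t) \<partial>lborel) = (LINT t:{0..}|lborel. of_real (t powr (\<alpha> - 1)) * exp (- s * of_real t))"
    unfolding set_lebesgue_integral_def
  proof (rule integral_cong_AE)
    show "AE t in lborel. (\<Sum>k. f k t) = indicator {0..} t *\<^sub>R (of_real (t powr (\<alpha> - 1)) * exp (- s * of_real t))"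
      using ae by eventually_elim (use sum_exp in \<open>auto simp: sums_iff\<close>)
    have [measurable]: "f k \<in> borel_measurable lborel" for k unfolding f_def by measurable
    show "(\<lambda>t. \<Sum>k. f k t) \<in> borel_measurable lborel" by measurable
  qed measurable
  moreover have "(\<lambda>k. \<integral>t. f k t \<partial>lborel) sums (of_real (Gamma \<alpha> * c powr (- \<alpha>)) * (1 + \<eta> / of_real c) powr (- of_real \<alpha>))"
    unfolding val using gen_binomial_complex[of "\<eta> / of_real c" "- of_real \<alpha>"] \<eta>c c
    by (intro sums_mult) (simp add: norm_divide)
  ultimately have "(LINT t:{0..}|lborel. of_real (t powr (\<alpha> - 1)) * exp (- s * of_real t)) =
     of_real (Gamma \<alpha> * c powr (- \<alpha>)) * (1 + \<eta> / of_real c) powr (- of_real \<alpha>)"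
    by (metis sums_unique2)
  also have "1 + \<eta> / of_real c = s / of_real c" using c by (simp add: \<eta>_def field_simps)
  also have "of_real (Gamma \<alpha> * c powr (- \<alpha>)) * (s / of_real c) powr (- of_real \<alpha>) = of_real (Gamma \<alpha>) * s powr (- of_real \<alpha>)"
  proof -
    have "of_real (c powr (- \<alpha>)) = exp (- of_real \<alpha> * of_real (ln c) :: complex)"
      using c by (simp add: powr_def exp_of_real[symmetric])
    moreover have "Ln (s / of_real c) = Ln s - of_real (ln c)"
      using c s0 by (rule Ln_divide_of_real)
    moreover have "exp (- of_real \<alpha> * of_real (ln c)) * exp (- of_real \<alpha> * (Ln s - of_real (ln c))) = exp (- of_real \<alpha> * Ln s)"
      unfolding exp_add[symmetric] by (rule arg_cong[of _ _ exp]) (simp add: algebra_simps)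
    ultimately show ?thesis
      using s0 c by (simp add: powr_def)
  qed
  finally show ?thesis .
qed

section \<open>The norm estimate for the calculus\<close>

context hp_semigroup
begin

lemma
  fixes G :: "complex \<Rightarrow> complex"
  assumes G: "G holomorphic_on right_half_plane w" and a: "w < - a" "0 < a"
    and bound: "\<And>u. - a \<le> Re u \<Longrightarrow> norm (G u) \<le> C / (1 + (Im u)\<^sup>2)"
  defines "k \<equiv> inverse_laplace G a"
  shows set_integrable_inverse_laplace: "set_integrable lborel {0..} k"
    and has_symbol_inverse_laplace: "has_symbol (kernel_op k) G"
proof -
  note IL = inverse_laplace[OF G a(1) bound, folded k_def]
  have [measurable]: "k \<in> borel_measurable borel" by (rule IL(3))
  define Ck where "Ck = (LINT \<xi>|lborel. C / (1 + \<xi>\<^sup>2)) / (2 * pi)"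
  have kb: "norm (k t) \<le> exp (- a * t) * Ck" for t unfolding Ck_def by (rule IL(2))
  have Ck: "0 \<le> Ck" using order_trans[OF norm_ge_zero kb[of 0]] by simp
  have "integrable lborel (\<lambda>t. indicator {0..} t *\<^sub>R k t)"
    by (rule Bochner_Integration.integrable_bound[OF integrable_mult_right[OF integrable_exp_atLeast[OF a(2)], of Ck]])
      (use kb in \<open>auto simp: indicator_def mult.commute Ck abs_mult\<close>)
  then show ks: "set_integrable lborel {0..} k" by (simp add: set_integrable_def)
  show "has_symbol (kernel_op k) G"
    by (rule has_symbol_cong[OF has_symbol_kernel_op[OF ks] IL(4)]) (use a in auto)
qed

text \<open>The weight \<open>1 = \<integral> 2 t exp (- 2 s t) ds\<close> (over \<open>s \<ge> 0\<close>) turns the kernel \<open>k\<close> into a superposition of the kernels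
  \<open>t k(t) exp (- 2 s t)\<close>, to which \<^term>\<open>norm_weighted_integral_le\<close> applies with \<open>b = s + a\<close> after moving the line of
  integration to \<open>Re z = s - a\<close>.\<close>

lemma norm_kernel_op_le:
  fixes G :: "complex \<Rightarrow> complex"
  assumes G: "G holomorphic_on right_half_plane w" and a: "w < - a" "0 < a"
    and bound: "\<And>u. - a \<le> Re u \<Longrightarrow> norm (G u) \<le> C / (1 + (Im u)\<^sup>2)"
    and E: "\<And>u. - a \<le> Re u \<Longrightarrow> norm (G u) \<le> E (Re u + a)"
    and EJ: "has_bochner_integral lborel (\<lambda>s. indicator {0..} s * (E s / (s + a))) J"
  defines "k \<equiv> inverse_laplace G a"
  shows "norm (kernel_op k x) \<le> M\<^sup>2 * J * norm x"
proof -
  note IL = inverse_laplace[OF G a(1) bound, folded k_def]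
  have [measurable]: "k \<in> borel_measurable borel" by (rule IL(3))
  have ks: "set_integrable lborel {0..} k"
    unfolding k_def by (rule set_integrable_inverse_laplace[OF G a bound])
  then have ki: "integrable lborel (\<lambda>t. indicator {0..} t *\<^sub>R k t)" by (simp add: set_integrable_def)
  have J: "0 \<le> J"
  proof -
    have "0 \<le> E s / (s + a)" if "0 \<le> s" for s
      using order_trans[OF norm_ge_zero E[of "of_real (s - a)"]] that a by simp
    then have "0 \<le> (\<integral>s. indicator {0..} s * (E s / (s + a)) \<partial>lborel)"
      by (intro integral_nonneg_AE) (auto simp: indicator_def)
    then show ?thesis using EJ by (simp add: has_bochner_integral_integral_eq)
  qed
  show ?thesis
  proof (rule norm_leI_cinner)
    fix y
    define \<phi> where "\<phi> t = cinner (T (max 0 t) x) y" for t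
    have c\<phi>: "continuous_on UNIV \<phi>" unfolding \<phi>_def by (intro continuous_intros) auto
    then have [measurable]: "\<phi> \<in> borel_measurable borel" by (rule borel_measurable_continuous_onI)
    define B where "B = M * norm x * norm y"
    have \<phi>B: "norm (\<phi> t) \<le> B" for t unfolding \<phi>_def B_def by (rule norm_cinner_T) simp
    define f where "f t s = (indicator {0..} t * (indicator {0..} s * exp (- (2 * t) * s)) * (2 * t)) *\<^sub>R (k t * \<phi> t)" for t s
    have [measurable]: "case_prod f \<in> borel_measurable (lborel \<Otimes>\<^sub>M lborel)"
      unfolding f_def[abs_def] by measurable
    have expint: "has_bochner_integral lborel (\<lambda>s. indicator {0..} s * exp (- (2 * t) * s)) (1 / (2 * t))" if t: "0 < t" for t :: real
      by (rule has_bochner_integral_exp_atLeast) (use t in simp)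
    \<comment> \<open>At t = 0 the weight 2 t exp (- 2 s t) vanishes instead of having integral 1 in
      s, hence \<open>{0<..}\<close>; the exception is a null set.\<close>
    have fs: "has_bochner_integral lborel (f t) (indicator {0<..} t *\<^sub>R (k t * \<phi> t))" for t
    proof (cases "0 < t")
      case True
      have "f t = (\<lambda>s. (indicator {0..} s * exp (- (2 * t) * s)) *\<^sub>R ((2 * t) *\<^sub>R (k t * \<phi> t)))"
        using True by (simp add: f_def fun_eq_iff mult.assoc)
      moreover have "has_bochner_integral lborel \<dots> ((1 / (2 * t)) *\<^sub>R ((2 * t) *\<^sub>R (k t * \<phi> t)))"
        by (rule has_bochner_integral_scaleR_left) (rule expint[OF True])
      ultimately show ?thesis using True by simp
    next
      case False
      then have "f t = (\<lambda>s. 0)" by (auto simp: f_def fun_eq_iff indicator_def)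
      then show ?thesis using False by (simp add: has_bochner_integral_zero)
    qed
    have nf: "(\<integral>s. norm (f t s) \<partial>lborel) = indicator {0<..} t * norm (k t * \<phi> t)" for t
    proof (cases "0 < t")
      case True
      have "norm (f t s) = (indicator {0..} s * exp (- (2 * t) * s)) * (2 * t * norm (k t * \<phi> t))" for s
        using True by (simp add: f_def abs_mult mult.assoc)
      then show ?thesis
        using has_bochner_integral_integral_eq[OF has_bochner_integral_mult_left[OF expint[OF True], of "2 * t * norm (k t * \<phi> t)"]] True
        by (simp only:) simp
    next
      case False
      then have "f t s = 0" for s by (auto simp: f_def indicator_def)
      then show ?thesis using False by simp
    qed
    have fi: "integrable (lborel \<Otimes>\<^sub>M lborel) (case_prod f)"
    proof (rule lborel_pair.Fubini_integrable)
      show "integrable lborel (\<lambda>t. \<integral>s. norm (case_prod f (t, s)) \<partial>lborel)"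
        unfolding prod.case nf
      proof (rule Bochner_Integration.integrable_bound)
        show "integrable lborel (\<lambda>t. B *\<^sub>R (indicator {0..} t *\<^sub>R k t))" by (rule integrable_scaleR_right[OF ki])
        show "AE t in lborel. norm (indicator {0<..} t * norm (k t * \<phi> t)) \<le> norm (B *\<^sub>R (indicator {0..} t *\<^sub>R k t))"
          using \<phi>B by (auto simp: indicator_def norm_mult mult.commute[of _ "norm (k _)"] intro!: AE_I2 mult_left_mono order_trans[OF \<phi>B])
      qed measurable
      show "AE t in lborel. integrable lborel (\<lambda>s. case_prod f (t, s))"
        using integrable.intros[OF fs] by simp
    qed measurable
    have "cinner (kernel_op k x) y = (\<integral>t. indicator {0..} t *\<^sub>R (k t * cinner (T t x) y) \<partial>lborel)"
      by (simp add: cinner_kernel_op[OF ks] set_lebesgue_integral_def)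
    also have "\<dots> = (\<integral>t. indicator {0<..} t *\<^sub>R (k t * \<phi> t) \<partial>lborel)"
    proof (rule integral_cong_AE)
      show "AE t in lborel. indicator {0..} t *\<^sub>R (k t * cinner (T t x) y) = indicator {0<..} t *\<^sub>R (k t * \<phi> t)"
        using AE_lborel_singleton[of 0] by eventually_elim (auto simp: indicator_def \<phi>_def)
      have "(\<lambda>t. indicator {0..} t *\<^sub>R (k t * cinner (T t x) y)) = (\<lambda>t. indicator {0..} t *\<^sub>R (k t * \<phi> t))"
        by (auto simp: indicator_def \<phi>_def fun_eq_iff)
      then show "(\<lambda>t. indicator {0..} t *\<^sub>R (k t * cinner (T t x) y)) \<in> borel_measurable lborel" by simp
    qed measurable
    also have "\<dots> = (\<integral>t. \<integral>s. f t s \<partial>lborel \<partial>lborel)"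
      unfolding has_bochner_integral_integral_eq[OF fs] ..
    also have "\<dots> = (\<integral>s. \<integral>t. f t s \<partial>lborel \<partial>lborel)"
      by (rule lborel_pair.Fubini_integral[OF fi, symmetric])
    finally have eq: "cinner (kernel_op k x) y = (\<integral>s. \<integral>t. f t s \<partial>lborel \<partial>lborel)" .
    have inner: "norm (\<integral>t. f t s \<partial>lborel) \<le> (M\<^sup>2 * (norm x * norm y)) * (indicator {0..} s * (E s / (s + a)))" for s
    proof (cases "0 \<le> s")
      case True
      define q where "q \<xi> = G (Complex (s - a) \<xi>)" for \<xi>
      \<comment> \<open>exp (- 2 s t) exp ((s - a) t) = exp (- (s + a) t): damping against the
        exponential on the shifted line leaves the exponent s + a.\<close>
      define \<kappa> where "\<kappa> t = of_real (exp (- (s + a) * t) / (2 * pi)) * (LINT \<xi>|lborel. q \<xi> * exp (\<i> * of_real (\<xi> * t)))" for t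
      have qc: "continuous_on UNIV q"
        unfolding q_def Complex_eq
        by (intro continuous_on_compose2[OF holomorphic_on_imp_continuous_on[OF G]] continuous_intros)
          (use a True in \<open>auto simp: right_half_plane_def\<close>)
      have qi: "integrable lborel q"
      proof (rule Bochner_Integration.integrable_bound[OF integrable_mult_right[OF integrable_1_div_plus_square, of C]])
        show "AE \<xi> in lborel. norm (q \<xi>) \<le> norm (C * (1 / (1 + \<xi>\<^sup>2)))"
        proof (rule AE_I2)
          fix \<xi> :: real
          have "norm (q \<xi>) \<le> C / (1 + \<xi>\<^sup>2)" using bound[of "Complex (s - a) \<xi>"] True by (simp add: q_def)
          also have "\<dots> \<le> norm (C * (1 / (1 + \<xi>\<^sup>2)))" by (simp add: abs_ge_self del: abs_divide abs_mult)
          finally show "norm (q \<xi>) \<le> norm (C * (1 / (1 + \<xi>\<^sup>2)))" .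
        qed
        show "q \<in> borel_measurable lborel" using qc by (auto intro: borel_measurable_continuous_onI)
      qed
      have \<kappa>: "k t * exp (- complex_of_real (2 * s * t)) = \<kappa> t" if "0 \<le> t" for t
      proof -
        have "k t * exp (- complex_of_real (2 * s * t)) = (exp (- complex_of_real (2 * s * t)) / (2 * pi)) * (LINT \<xi>|lborel. q \<xi> * exp (Complex (s - a) \<xi> * of_real t))"
          using IL(1)[of "s - a" t] True that by (simp add: q_def)
        also have "(LINT \<xi>|lborel. q \<xi> * exp (Complex (s - a) \<xi> * of_real t)) = (LINT \<xi>|lborel. of_real (exp ((s - a) * t)) * (q \<xi> * exp (\<i> * of_real (\<xi> * t))))"
        proof (intro Bochner_Integration.integral_cong refl)
          fix \<xi> :: real
          have "Complex (s - a) \<xi> * of_real t = of_real ((s - a) * t) + \<i> * of_real (\<xi> * t)"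
            by (simp add: Complex_eq algebra_simps)
          then have "exp (Complex (s - a) \<xi> * of_real t) = of_real (exp ((s - a) * t)) * exp (\<i> * of_real (\<xi> * t))"
            by (simp only: exp_add exp_of_real)
          then show "q \<xi> * exp (Complex (s - a) \<xi> * of_real t) = of_real (exp ((s - a) * t)) * (q \<xi> * exp (\<i> * of_real (\<xi> * t)))"
            by (simp only: mult_ac)
        qed
        also have "\<dots> = of_real (exp ((s - a) * t)) * (LINT \<xi>|lborel. q \<xi> * exp (\<i> * of_real (\<xi> * t)))"
          by (rule integral_mult_right_zero)
        also have "exp (- complex_of_real (2 * s * t)) / (2 * pi) * (of_real (exp ((s - a) * t)) * (LINT \<xi>|lborel. q \<xi> * exp (\<i> * of_real (\<xi> * t)))) = \<kappa> t"
        proof -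
          have "exp (- complex_of_real (2 * s * t)) * complex_of_real (exp ((s - a) * t)) = of_real (exp (- (s + a) * t))"
            unfolding exp_of_real[symmetric] exp_add[symmetric] by (rule arg_cong[of _ _ exp]) (simp add: algebra_simps)
          then show ?thesis unfolding \<kappa>_def by (simp add: field_simps)
        qed
        finally show ?thesis .
      qed
      have "(\<integral>t. f t s \<partial>lborel) = 2 * (LINT t:{0..}|lborel. of_real t * \<kappa> t * cinner (T t x) y)"
      proof -
        have "f t s = 2 * (indicator {0..} t *\<^sub>R (of_real t * \<kappa> t * cinner (T t x) y))" for t
          using True by (cases "0 \<le> t")
            (simp_all add: f_def \<kappa>[symmetric] \<phi>_def scaleR_conv_of_real exp_of_real[symmetric] mult_ac)
        then show ?thesis unfolding set_lebesgue_integral_def by (simp only: integral_mult_right_zero)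
      qed
      \<comment> \<open>The weighted estimate asks for a positive bound, while \<open>E s\<close>
        may be 0. It is therefore applied to every K > E s, and K then decreases to E s.\<close>
      also have "norm \<dots> \<le> M\<^sup>2 * K / (s + a) * (norm x * norm y)" if K: "E s < K" for K
      proof -
        have qK: "norm (q \<xi>) \<le> K" for \<xi> using E[of "Complex (s - a) \<xi>"] True K by (simp add: q_def)
        have K0: "0 < K" using order_trans[OF norm_ge_zero E[of "of_real (s - a)"]] True K by simp
        have "0 < s + a" using True a by simp
        from norm_weighted_integral_le[OF qc qi qK K0 this, folded \<kappa>_def, of x y]
        have "2 * norm (LINT t:{0..}|lborel. of_real t * \<kappa> t * cinner (T t x) y) \<le> 2 * (M\<^sup>2 * K / (2 * (s + a)) * (norm x * norm y))"
          by simp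
        also have "\<dots> = M\<^sup>2 * K / (s + a) * (norm x * norm y)" by (simp add: mult.commute[of 2] divide_simps)
        finally show ?thesis by (simp add: norm_mult)
      qed
      finally have K: "norm (\<integral>t. f t s \<partial>lborel) \<le> M\<^sup>2 * K / (s + a) * (norm x * norm y)" if "E s < K" for K
        using that .
      have "((\<lambda>K. M\<^sup>2 * K / (s + a) * (norm x * norm y)) \<longlongrightarrow> M\<^sup>2 * E s / (s + a) * (norm x * norm y)) (at_right (E s))"
        by (intro tendsto_intros) (use True a in auto)
      then have "norm (\<integral>t. f t s \<partial>lborel) \<le> M\<^sup>2 * E s / (s + a) * (norm x * norm y)"
      proof (rule tendsto_lowerbound)
        show "\<forall>\<^sub>F K in at_right (E s). norm (\<integral>t. f t s \<partial>lborel) \<le> M\<^sup>2 * K / (s + a) * (norm x * norm y)"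
          unfolding eventually_at_filter by (intro always_eventually allI impI K) auto
      qed simp
      then show ?thesis using True by (simp add: mult_ac)
    next
      case False
      then have "f t s = 0" for t by (simp add: f_def)
      then show ?thesis using False by simp
    qed
    have "norm (cinner (kernel_op k x) y) \<le> (\<integral>s. (M\<^sup>2 * (norm x * norm y)) * (indicator {0..} s * (E s / (s + a))) \<partial>lborel)"
      unfolding eq
    proof (rule Bochner_Integration.integral_norm_bound_integral[OF _ _ inner])
      show "integrable lborel (\<lambda>s. \<integral>t. f t s \<partial>lborel)" by (rule lborel_pair.integrable_snd[OF fi])
      show "integrable lborel (\<lambda>s. (M\<^sup>2 * (norm x * norm y)) * (indicator {0..} s * (E s / (s + a))))"
        by (rule integrable_mult_right[OF integrable.intros[OF EJ]])
    qed
    also have "\<dots> = M\<^sup>2 * (norm x * norm y) * J"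
      using EJ by (subst integral_mult_right_zero) (simp add: has_bochner_integral_integral_eq)
    finally show "norm (cinner (kernel_op k x) y) \<le> M\<^sup>2 * J * norm x * norm y" by (simp add: mult_ac)
  qed (use J in simp)
qed

end

section \<open>Regularisation\<close>

context hp_semigroup
begin

lemma
  assumes \<alpha>: "0 < \<alpha>" and \<kappa>: "Re \<kappa> < 0"
  shows set_integrable_powr_kernel: "set_integrable lborel {0..} (\<lambda>t. c * (of_real (t powr (\<alpha> - 1)) * exp (\<kappa> * of_real t)))"
    and LINT_powr_kernel: "0 < Re z \<Longrightarrow> (LINT t:{0..}|lborel. c * (of_real (t powr (\<alpha> - 1)) * exp (\<kappa> * of_real t)) * exp (- z * of_real t)) =
      c * of_real (Gamma \<alpha>) * (z - \<kappa>) powr (- of_real \<alpha>)"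
proof -
  show i: "set_integrable lborel {0..} (\<lambda>t. c * (of_real (t powr (\<alpha> - 1)) * exp (\<kappa> * of_real t)))"
    using set_integrable_powr_exp[OF \<alpha>, of "- \<kappa>"] \<kappa> by (intro set_integrable_mult_right) simp
  assume z: "0 < Re z"
  have "(LINT t:{0..}|lborel. c * (of_real (t powr (\<alpha> - 1)) * exp (\<kappa> * of_real t)) * exp (- z * of_real t))
     = (LINT t:{0..}|lborel. c * (of_real (t powr (\<alpha> - 1)) * exp (- (z - \<kappa>) * of_real t)))"
    by (intro set_lebesgue_integral_cong) (auto simp: algebra_simps simp flip: exp_add)
  also have "\<dots> = c * (LINT t:{0..}|lborel. of_real (t powr (\<alpha> - 1)) * exp (- (z - \<kappa>) * of_real t))"
    by (rule set_integral_mult_right)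
  also have "\<dots> = c * of_real (Gamma \<alpha>) * (z - \<kappa>) powr (- of_real \<alpha>)"
    using z \<kappa> by (subst LINT_powr_exp[OF \<alpha>]) auto
  finally show "(LINT t:{0..}|lborel. c * (of_real (t powr (\<alpha> - 1)) * exp (\<kappa> * of_real t)) * exp (- z * of_real t)) =
    c * of_real (Gamma \<alpha>) * (z - \<kappa>) powr (- of_real \<alpha>)" .
qed

lemma has_symbol_powr_kernel:
  assumes "0 < \<alpha>" "Re \<kappa> < 0"
  shows "has_symbol (kernel_op (\<lambda>t. c * (of_real (t powr (\<alpha> - 1)) * exp (\<kappa> * of_real t))))
    (\<lambda>z. c * of_real (Gamma \<alpha>) * (z - \<kappa>) powr (- of_real \<alpha>))"
  by (rule has_symbol_cong[OF has_symbol_kernel_op[OF set_integrable_powr_kernel[OF assms]] LINT_powr_kernel[OF assms]])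

text \<open>The density n^2 t exp (- n t) of (n / (n + z))^2; the square provides the quadratic
  decay that the inversion formula demands. The exponent \<open>2 - 1\<close> is \<alpha> - 1 for
  \<alpha> = 2, to match the general power kernel.\<close>

definition approx_kernel :: "real \<Rightarrow> real \<Rightarrow> complex" where
  "approx_kernel n t = of_real (n\<^sup>2) * (of_real (t powr (2 - 1)) * exp (- of_real n * of_real t))"

definition approx :: "real \<Rightarrow> 'h \<Rightarrow> 'h" where
  "approx n = kernel_op (approx_kernel n)"

lemma set_integrable_approx_kernel: "0 < n \<Longrightarrow> set_integrable lborel {0..} (approx_kernel n)"
  unfolding approx_kernel_def[abs_def] by (rule set_integrable_powr_kernel) auto

lemma LINT_approx_kernel:
  assumes n: "0 < n" and z: "0 < Re z"
  shows "(LINT t:{0..}|lborel. approx_kernel n t * exp (- z * of_real t)) = (of_real n / (of_real n + z))\<^sup>2"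
proof -
  have "(LINT t:{0..}|lborel. approx_kernel n t * exp (- z * of_real t)) = of_real (n\<^sup>2) * of_real (Gamma 2) * (z - (- of_real n)) powr (- of_real 2)"
    unfolding approx_kernel_def by (rule LINT_powr_kernel) (use n z in auto)
  moreover have "z + of_real n \<noteq> 0" using z n by (auto simp: complex_eq_iff)
  then have "(z + of_real n) powr (- 2) = 1 / (z + of_real n)\<^sup>2"
    by (simp add: powr_minus powr_numeral divide_inverse)
  moreover have "Gamma (2::real) = 1" using Gamma_fact[of 1, where ?'a=real] by simp
  ultimately show ?thesis by (simp add: power_divide add.commute)
qed

lemma has_symbol_approx: "0 < n \<Longrightarrow> has_symbol (approx n) (\<lambda>z. (of_real n / (of_real n + z))\<^sup>2)"
  unfolding approx_def
  by (rule has_symbol_cong[OF has_symbol_kernel_op[OF set_integrable_approx_kernel] LINT_approx_kernel])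

text \<open>The kernel is a probability density concentrating at 0. After rescaling u = n t the
  error is an average of |T(u / n) x - x| against the fixed density u exp (- u), and dominated
  convergence applies.\<close>

lemma approx_tendsto: "(\<lambda>n. approx (real n) x) \<longlonglongrightarrow> x"
proof -
  define d where "d t = norm (T (max 0 t) x - x)" for t
  define e where "e n = (\<integral>u. indicator {0..} u * (u * exp (- u)) * d (u / n) \<partial>lborel)" for n
  have "continuous_on UNIV d" unfolding d_def by (intro continuous_intros) auto
  then have [measurable]: "d \<in> borel_measurable borel" by (rule borel_measurable_continuous_onI)
  have d0: "0 \<le> d t" and dB: "d t \<le> (M + 1) * norm x" for t
    using norm_triangle_ineq4[of "T (max 0 t) x" x] norm_T[of "max 0 t" x] by (auto simp: d_def distrib_right)
  have i: "integrable lborel (\<lambda>u::real. indicator {0..} u * (u * exp (- u)))"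
    using integrable.intros[OF has_bochner_integral_powr_exp[of 2 1]]
    by (rule Bochner_Integration.integrable_cong[THEN iffD1, rotated 2]) (auto simp: indicator_def)
  have le: "norm (approx (real n) x - x) \<le> e (real n)" if n: "0 < n" for n
  proof (rule norm_leI_cinner)
    fix y
    have n': "0 < real n" using n by simp
    note k = set_integrable_approx_kernel[OF n']
    have kn: "approx_kernel (real n) t = of_real ((real n)\<^sup>2 * (t * exp (- real n * t)))" if "0 \<le> t" for t
      using that by (simp add: approx_kernel_def exp_of_real[symmetric])
    have k1: "(LINT t:{0..}|lborel. approx_kernel (real n) t * 1) = 1"
    proof -
      have "has_bochner_integral lborel (\<lambda>t. (real n)\<^sup>2 * (indicator {0..} t * (t powr (2 - 1) * exp (- real n * t)))) ((real n)\<^sup>2 * (Gamma 2 * real n powr (- 2)))"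
        by (intro has_bochner_integral_mult_right has_bochner_integral_powr_exp) (use n in auto)
      from has_bochner_integral_of_real[OF this, where 'a=complex] has_bochner_integral_integral_eq
      have "(\<integral>t. of_real ((real n)\<^sup>2 * (indicator {0..} t * (t powr (2 - 1) * exp (- real n * t)))) \<partial>lborel) = complex_of_real ((real n)\<^sup>2 * (Gamma 2 * real n powr (- 2)))"
        by blast
      also have "(real n)\<^sup>2 * (Gamma 2 * real n powr (- 2)) = 1"
        using n Gamma_fact[of 1, where ?'a=real] by (simp add: powr_minus powr_numeral)
      also have "(\<integral>t. of_real ((real n)\<^sup>2 * (indicator {0..} t * (t powr (2 - 1) * exp (- real n * t)))) \<partial>lborel) = (LINT t:{0..}|lborel. approx_kernel (real n) t * 1)"
        unfolding set_lebesgue_integral_def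
        by (intro Bochner_Integration.integral_cong) (auto simp: kn indicator_def)
      finally show ?thesis by simp
    qed
    note b = mf_integral(2)[OF sets_half_line k[folded integrable_half_line], unfolded integrable_half_line]
    have "cinner (approx (real n) x - x) y = (LINT t:{0..}|lborel. approx_kernel (real n) t * cinner (T t x) y) - cinner x y * (LINT t:{0..}|lborel. approx_kernel (real n) t * 1)"
      by (simp add: cinner_diff_left approx_def cinner_kernel_op[OF k] k1[simplified])
    also have "\<dots> = (LINT t:{0..}|lborel. approx_kernel (real n) t * cinner (T t x) y - cinner x y * (approx_kernel (real n) t * 1))"
      by (subst set_integral_diff(2)) (use b[OF orbit_bcont] k in auto)
    also have "\<dots> = (LINT t:{0..}|lborel. approx_kernel (real n) t * cinner (T t x - x) y)"
      by (intro set_lebesgue_integral_cong) (auto simp: cinner_diff_left algebra_simps)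
    also have "\<dots> = (\<integral>t. indicator {0..} t *\<^sub>R (approx_kernel (real n) t * cinner (T t x - x) y) \<partial>lborel)"
      by (simp add: set_lebesgue_integral_def)
    also have "norm \<dots> \<le> (\<integral>t. (real n * (indicator {0..} (real n * t) * (real n * t * exp (- (real n * t))) * d t)) * norm y \<partial>lborel)"
    proof (rule Bochner_Integration.integral_norm_bound_integral)
      have bd: "(\<lambda>t. cinner (T t x - x) y) \<in> bcont"
        using bcont_add[OF orbit_bcont bcont_const, of x y "- cinner x y"] by (simp add: cinner_diff_left)
      show "integrable lborel (\<lambda>t. indicator {0..} t *\<^sub>R (approx_kernel (real n) t * cinner (T t x - x) y))"
        using b[OF bd] by (simp add: set_integrable_def)
      have "integrable lborel (\<lambda>t. indicator {0..} (0 + real n * t) * ((0 + real n * t) * exp (- (0 + real n * t))))"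
        using lborel_integrable_real_affine[OF i, of "real n" 0] n by simp
      from integrable_mult_right[OF this, of "real n * ((M + 1) * norm x) * norm y"]
      show "integrable lborel (\<lambda>t. (real n * (indicator {0..} (real n * t) * (real n * t * exp (- (real n * t))) * d t)) * norm y)"
      proof (rule Bochner_Integration.integrable_bound)
        show "AE t in lborel. norm ((real n * (indicator {0..} (real n * t) * (real n * t * exp (- (real n * t))) * d t)) * norm y)
          \<le> norm (real n * ((M + 1) * norm x) * norm y * (indicator {0..} (0 + real n * t) * ((0 + real n * t) * exp (- (0 + real n * t)))))"
        proof (rule AE_I2)
          fix t
          have "\<bar>d t\<bar> \<le> \<bar>(M + 1) * norm x\<bar>" using d0[of t] dB[of t] by simp
          then show "norm ((real n * (indicator {0..} (real n * t) * (real n * t * exp (- (real n * t))) * d t)) * norm y)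
          \<le> norm (real n * ((M + 1) * norm x) * norm y * (indicator {0..} (0 + real n * t) * ((0 + real n * t) * exp (- (0 + real n * t)))))"
            unfolding real_norm_def abs_mult
            using mult_left_mono[of "\<bar>d t\<bar>" "\<bar>(M + 1) * norm x\<bar>" "\<bar>real n\<bar> * \<bar>norm y\<bar> * (\<bar>indicator {0..} (real n * t)\<bar> * (\<bar>real n\<bar> * \<bar>t\<bar> * \<bar>exp (- (real n * t))\<bar>))"]
            by (simp add: abs_mult mult_ac)
        qed
      qed measurable
      fix t
      show "norm (indicator {0..} t *\<^sub>R (approx_kernel (real n) t * cinner (T t x - x) y)) \<le> (real n * (indicator {0..} (real n * t) * (real n * t * exp (- (real n * t))) * d t)) * norm y"
      proof (cases "0 \<le> t")
        case True
        have "norm (approx_kernel (real n) t * cinner (T t x - x) y) \<le> ((real n)\<^sup>2 * (t * exp (- real n * t))) * (d t * norm y)"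
          unfolding norm_mult kn[OF True]
          using True norm_cinner_le[of "T t x - x" y] by (intro mult_mono) (auto simp: d_def norm_mult norm_power)
        then show ?thesis using True by (simp add: power2_eq_square mult_ac)
      next
        case False
        then have "\<not> 0 \<le> real n * t" using n by (simp add: zero_le_mult_iff)
        then show ?thesis using False by simp
      qed
    qed
    also have "\<dots> = (\<integral>t. real n * (indicator {0..} (real n * t) * (real n * t * exp (- (real n * t))) * d t) \<partial>lborel) * norm y"
      by (rule integral_mult_left_zero)
    also have "(\<integral>t. real n * (indicator {0..} (real n * t) * (real n * t * exp (- (real n * t))) * d t) \<partial>lborel) = e (real n)"
      unfolding e_def
      by (subst lborel_integral_real_affine[where c="real n" and t=0]) (use n in auto)
    finally show "norm (cinner (approx (real n) x - x) y) \<le> e (real n) * norm y" .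
  next
    show "0 \<le> e (real n)"
      unfolding e_def by (intro integral_nonneg_AE AE_I2) (auto simp: indicator_def d0)
  qed
  have "(\<lambda>n. e (real n)) \<longlonglongrightarrow> (\<integral>u. (0::real) \<partial>(lborel :: real measure))"
    unfolding e_def
  proof (rule integral_dominated_convergence[where w="\<lambda>u. (indicator {0..} u * (u * exp (- u))) * ((M + 1) * norm x)"])
    show "AE u in lborel. (\<lambda>n. indicator {0..} u * (u * exp (- u)) * d (u / real n)) \<longlonglongrightarrow> 0"
    proof (rule AE_I2)
      fix u :: real
      have "(\<lambda>n. d (u / real n)) \<longlonglongrightarrow> d 0"
        by (rule continuous_on_tendsto_compose[OF \<open>continuous_on UNIV d\<close>]) (auto intro: lim_const_over_n)
      then have "(\<lambda>n. indicator {0..} u * (u * exp (- u)) * d (u / real n)) \<longlonglongrightarrow> indicator {0..} u * (u * exp (- u)) * d 0"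
        by (rule tendsto_mult_left)
      then show "(\<lambda>n. indicator {0..} u * (u * exp (- u)) * d (u / real n)) \<longlonglongrightarrow> 0" by (simp add: d_def)
    qed
    show "AE u in lborel. norm (indicator {0..} u * (u * exp (- u)) * d (u / real n)) \<le> (indicator {0..} u * (u * exp (- u))) * ((M + 1) * norm x)" for n
      using d0 dB by (intro AE_I2) (auto simp: indicator_def abs_mult intro!: mult_left_mono)
  qed (auto intro: i)
  then have e0: "(\<lambda>n. e (real n)) \<longlonglongrightarrow> 0" by simp
  have "\<forall>\<^sub>F n in sequentially. norm (approx (real n) x - x) \<le> e (real n)"
    using eventually_gt_at_top[of 0] by eventually_elim (rule le)
  from Lim_null_comparison[OF this e0] show ?thesis by (rule LIM_zero_cancel)
qed

text \<open>Each \<open>approx m\<close> is a bounded operator times \<open>approx n\<close>, so a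
  vector killed by one approximant is killed by all, and they converge to the identity.\<close>

lemma approx_eq_0:
  assumes n: "0 < n" and x: "approx n x = 0"
  shows "x = 0"
proof -
  have "approx (real m) x = 0" if m: "0 < m" for m
  proof -
    define R where "R = kernel_op (\<lambda>t. 1 * (of_real (t powr (1 - 1)) * exp (- of_real (real m) * of_real t)))"
    have R: "has_symbol R (\<lambda>z. 1 * of_real (Gamma 1) * (z - (- of_real (real m))) powr (- of_real 1))"
      unfolding R_def by (rule has_symbol_powr_kernel) (use m in simp_all)
    \<comment> \<open>\<open>S\<close> is (m / n) (n + A) (m + A)^(-1), written through the
      resolvent by means of (z + n) / (z + m) = 1 + (n - m) / (z + m).\<close>
    define S where "S x = of_real (real m / n) *\<^sub>C x + of_real ((real m / n) * (n - real m)) *\<^sub>C R x" for x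
    note S = has_symbol_add[OF has_symbol_id R, of "of_real (real m / n)" "of_real ((real m / n) * (n - real m))", folded S_def]
    have "approx (real m) = (\<lambda>x. S (S (approx n x)))"
    proof (rule has_symbol_unique[OF has_symbol_approx has_symbol_comp[OF S has_symbol_comp[OF S has_symbol_approx[OF n]]]])
      show "0 < real m" using m by simp
      fix z :: complex assume z: "0 < Re z"
      have nz: "z + of_real (real m) \<noteq> 0" "z + of_real n \<noteq> 0" using z n by (auto simp: complex_eq_iff)
      have "1 * of_real (Gamma 1) * (z - - of_real (real m)) powr (- of_real 1) = 1 / (z + of_real (real m))"
        using nz by (simp add: powr_minus divide_inverse)
      moreover have "of_real (real m / n) * 1 + of_real (real m / n * (n - real m)) * (1 / (z + of_real (real m)))
          = (of_real (real m) * (z + of_real n)) / (of_real n * (z + of_real (real m)))"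
        using nz n by (simp add: divide_simps) (simp add: algebra_simps)
      ultimately show "(of_real (real m) / (of_real (real m) + z))\<^sup>2 =
         (of_real (real m / n) * 1 + of_real (real m / n * (n - real m)) * (1 * of_real (Gamma 1) * (z - - of_real (real m)) powr (- of_real 1))) *
         ((of_real (real m / n) * 1 + of_real (real m / n * (n - real m)) * (1 * of_real (Gamma 1) * (z - - of_real (real m)) powr (- of_real 1))) *
         (of_real n / (of_real n + z))\<^sup>2)"
        using nz n by (simp only:) (simp add: power2_eq_square divide_simps add.commute)
    qed
    moreover have "S 0 = 0"
    proof -
      have "R 0 = 0" using has_symbol_bounded_clinear[OF R] by (simp add: bounded_clinear_def bounded_linear.linear linear_0)
      then show ?thesis by (simp add: S_def)
    qed
    ultimately show ?thesis using x by simp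
  qed
  then have "\<forall>\<^sub>F m in sequentially. approx (real m) x = 0"
    by (intro eventually_mono[OF eventually_gt_at_top[of 0]])
  then have "(\<lambda>m. approx (real m) x) \<longlonglongrightarrow> 0" by (rule tendsto_eventually)
  with approx_tendsto[of x] show ?thesis by (rule LIMSEQ_unique)
qed

lemma has_symbol_bounded_linear: "has_symbol S \<phi> \<Longrightarrow> bounded_linear S"
  using has_symbol_bounded_clinear by (simp add: bounded_clinear_def)

lemma has_symbol_diff: "has_symbol S \<phi> \<Longrightarrow> S (x - y) = S x - S y"
  by (metis bounded_linear.linear has_symbol_bounded_linear linear_diff)

lemma inj_approx:
  assumes "0 < n"
  shows "inj (approx n)"
proof (rule injI)
  fix x y assume "approx n x = approx n y"
  then have "approx n (x - y) = 0" by (simp add: has_symbol_diff[OF has_symbol_approx[OF assms]])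
  then have "x - y = 0" by (rule approx_eq_0[OF assms])
  then show "x = y" by simp
qed

text \<open>The operators \<open>S\<^sub>n = (g \<rho>\<^sub>n)(A)\<close> satisfy \<open>S\<^sub>n P\<^sub>k = S\<^sub>k P\<^sub>n\<close>, where \<open>P\<^sub>n = \<rho>\<^sub>n(A) \<rightarrow> I\<close> strongly.
  With uniform boundedness this forces them to converge strongly.\<close>

lemma bounded_limit_operator:
  assumes n: "0 < n" and B: "has_symbol B (\<lambda>z. g z * (of_real n / (of_real n + z))\<^sup>2)"
    and S: "\<And>m. m1 \<le> m \<Longrightarrow> has_symbol (Sn m) (\<lambda>z. g z * (of_real (real m) / (of_real (real m) + z))\<^sup>2)"
    and C: "\<And>m x. m1 \<le> m \<Longrightarrow> norm (Sn m x) \<le> C * norm x" "0 \<le> C" and m1: "0 < m1"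
  shows "\<exists>S. bounded_clinear S \<and> (\<forall>x. approx n (S x) = B x) \<and> (\<forall>x. norm (S x) \<le> C * norm x)"
proof -
  note P = has_symbol_approx
  have swap: "Sn i (approx (real k) x) = Sn k (approx (real i) x)" if "m1 \<le> i" "m1 \<le> k" for i k x
  proof -
    have "(\<lambda>x. Sn i (approx (real k) x)) = (\<lambda>x. Sn k (approx (real i) x))"
      by (rule has_symbol_unique[OF has_symbol_comp[OF S P] has_symbol_comp[OF S P]]) (use that m1 in auto)
    then show ?thesis by metis
  qed
  have PS: "approx n (Sn i x) = B (approx (real i) x)" if "m1 \<le> i" for i x
  proof -
    have "(\<lambda>x. approx n (Sn i x)) = (\<lambda>x. B (approx (real i) x))"
      by (rule has_symbol_unique[OF has_symbol_comp[OF P S] has_symbol_comp[OF B P]]) (use that m1 n in auto)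
    then show ?thesis by metis
  qed
  have "\<exists>y. (\<lambda>i. Sn i x) \<longlonglongrightarrow> y" for x
  proof -
    have "Cauchy (\<lambda>i. Sn i x)"
    proof (rule metric_CauchyI)
      fix e :: real assume e: "0 < e"
      \<comment> \<open>Errors of total size 4 C \<epsilon> add up below; \<open>C + 1\<close>
        avoids a division by 0.\<close>
      define \<epsilon> where "\<epsilon> = e / (4 * (C + 1))"
      have \<epsilon>: "0 < \<epsilon>" using e C(2) by (simp add: \<epsilon>_def)
      obtain N0 where N0: "\<And>k. N0 \<le> k \<Longrightarrow> dist (approx (real k) x) x < \<epsilon>"
        using approx_tendsto[of x, unfolded lim_sequentially] \<epsilon> by blast
      define k where "k = max m1 N0"
      have Ce: "C * \<epsilon> < e / 4"
        using e C(2) by (simp add: \<epsilon>_def divide_simps)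
      show "\<exists>N. \<forall>i\<ge>N. \<forall>j\<ge>N. dist (Sn i x) (Sn j x) < e"
      proof (intro exI[of _ k] allI impI)
        fix i j assume i: "k \<le> i" and j: "k \<le> j"
        have m: "m1 \<le> i" "m1 \<le> j" "m1 \<le> k" using i j by (auto simp: k_def)
        have a: "norm (Sn l x - Sn k (approx (real l) x)) \<le> C * \<epsilon>" if l: "m1 \<le> l" for l
        proof -
          have "norm (Sn l (x - approx (real k) x)) \<le> C * norm (x - approx (real k) x)" by (rule C(1)[OF l])
          also have "\<dots> \<le> C * \<epsilon>"
            using N0[of k] C(2) by (intro mult_left_mono) (auto simp: dist_norm norm_minus_commute k_def)
          finally show ?thesis by (simp add: has_symbol_diff[OF S[OF l]] swap[OF l m(3)])
        qed
        have b: "norm (Sn k (approx (real i) x) - Sn k (approx (real j) x)) \<le> C * (\<epsilon> + \<epsilon>)"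
        proof -
          have "norm (approx (real i) x - approx (real j) x) \<le> \<epsilon> + \<epsilon>"
            using N0[of i] N0[of j] i j dist_triangle2[of "approx (real i) x" "approx (real j) x" x]
            by (simp add: k_def dist_norm)
          then have "norm (Sn k (approx (real i) x - approx (real j) x)) \<le> C * (\<epsilon> + \<epsilon>)"
            by (intro order_trans[OF C(1)[OF m(3)]] mult_left_mono C(2))
          then show ?thesis by (simp add: has_symbol_diff[OF S[OF m(3)]])
        qed
        have "Sn i x - Sn j x = (Sn i x - Sn k (approx (real i) x)) + (Sn k (approx (real i) x) - Sn k (approx (real j) x))
            - (Sn j x - Sn k (approx (real j) x))" by simp
        then have "norm (Sn i x - Sn j x) \<le> C * \<epsilon> + C * (\<epsilon> + \<epsilon>) + C * \<epsilon>"
          using a[OF m(1)] a[OF m(2)] b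
          by (smt (verit) norm_triangle_ineq norm_triangle_ineq4)
        also have "\<dots> = 4 * (C * \<epsilon>)" by (simp add: algebra_simps)
        also have "\<dots> < e" using Ce by simp
        finally show "dist (Sn i x) (Sn j x) < e" by (simp add: dist_norm)
      qed
    qed
    then show ?thesis using convergent_eq_Cauchy by blast
  qed
  then obtain S where SL: "\<And>x. (\<lambda>i. Sn i x) \<longlonglongrightarrow> S x" by metis
  have PSx: "approx n (S x) = B x" for x
  proof -
    have "(\<lambda>i. approx n (Sn i x)) \<longlonglongrightarrow> approx n (S x)"
      by (rule bounded_linear.tendsto[OF has_symbol_bounded_linear[OF P[OF n]] SL])
    moreover have "(\<lambda>i. B (approx (real i) x)) \<longlonglongrightarrow> B x"
      by (rule bounded_linear.tendsto[OF has_symbol_bounded_linear[OF B] approx_tendsto])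
    moreover have "\<forall>\<^sub>F i in sequentially. B (approx (real i) x) = approx n (Sn i x)"
      using eventually_ge_at_top[of m1] by eventually_elim (simp add: PS)
    ultimately show ?thesis by (metis LIMSEQ_unique Lim_transform_eventually)
  qed
  have nS: "norm (S x) \<le> C * norm x" for x
    by (rule tendsto_upperbound[OF tendsto_norm[OF SL]])
      (auto intro: eventually_mono[OF eventually_ge_at_top[of m1]] C)
  note Pcl = has_symbol_bounded_clinear[OF P[OF n]] and Bcl = has_symbol_bounded_clinear[OF B]
  \<comment> \<open>Linearity is checked after applying the injective \<open>approx n\<close>, where
    it is that of \<open>B\<close>.\<close>
  have "S (x + y) = S x + S y" for x y
    by (rule injD[OF inj_approx[OF n]])
      (use Pcl Bcl in \<open>simp add: PSx bounded_clinear_def bounded_linear.linear linear_add\<close>)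
  moreover have sc: "S (c *\<^sub>C x) = c *\<^sub>C S x" for c x
    by (rule injD[OF inj_approx[OF n]]) (use Pcl Bcl in \<open>simp add: PSx bounded_clinear_def\<close>)
  ultimately have "bounded_linear S"
    using nS sc[of "of_real _"] by (intro bounded_linear_intro[of S C]) (auto simp: scaleC_of_real mult.commute)
  then show ?thesis using sc PSx nS by (auto simp: bounded_clinear_def)
qed

text \<open>Independence of the regulariser. The products \<mu>(A) \<nu>'(A) and \<mu>'(A) \<nu>(A)
  have the same symbol, namely that of \<mu>(A) \<mu>'(A) times f, and injectivity of \<mu>'(A)
  removes the foreign regulariser. The existential in \<open>hp_calc\<close> thus collapses to one
  convenient pair.\<close>

lemma hp_calc_iff:
  assumes \<mu>: "complex_borel_measure \<mu>" and \<nu>: "complex_borel_measure \<nu>" and inj: "inj (hp_measure A \<mu>)"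
    and f: "\<And>z. 0 < Re z \<Longrightarrow> laplace \<mu> z * f z = laplace \<nu> z"
  shows "(x, y) \<in> hp_calc A f \<longleftrightarrow> hp_measure A \<mu> y = hp_measure A \<nu> x"
proof
  assume "hp_measure A \<mu> y = hp_measure A \<nu> x"
  then show "(x, y) \<in> hp_calc A f"
    unfolding hp_calc_def right_half_plane_def using assms by blast
next
  assume "(x, y) \<in> hp_calc A f"
  then obtain \<mu>' \<nu>' where m: "complex_borel_measure \<mu>'" "complex_borel_measure \<nu>'" "inj (hp_measure A \<mu>')"
    "\<And>z. 0 < Re z \<Longrightarrow> laplace \<mu>' z * f z = laplace \<nu>' z" "hp_measure A \<mu>' y = hp_measure A \<nu>' x"
    unfolding hp_calc_def right_half_plane_def by blast
  note s = has_symbol_hp_measure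
  have "(\<lambda>x. hp_measure A \<mu> (hp_measure A \<nu>' x)) = (\<lambda>x. hp_measure A \<mu>' (hp_measure A \<nu> x))"
    by (rule has_symbol_unique[OF has_symbol_comp[OF s[OF \<mu>] s[OF m(2)]] has_symbol_comp[OF s[OF m(1)] s[OF \<nu>]]])
      (simp add: m(4)[symmetric] f[symmetric])
  then have "hp_measure A \<mu>' (hp_measure A \<nu> x) = hp_measure A \<mu> (hp_measure A \<nu>' x)" by metis
  also have "\<dots> = hp_measure A \<mu> (hp_measure A \<mu>' y)" by (simp add: m(5))
  also have "\<dots> = hp_measure A \<mu>' (hp_measure A \<mu> y)" by (rule has_symbol_commute[OF s[OF \<mu>] s[OF m(1)]])
  finally show "hp_measure A \<mu> y = hp_measure A \<nu> x" using injD[OF m(3)] by metis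
qed

end

text \<open>\<open>resolvent_power\<close> is a gauge integral of a vector-valued function, singular
  at 0 when \<alpha> < 1. The substitution r = t^\<alpha> absorbs the singularity: (1 / \<alpha>)
  v(t^\<alpha>), with v an antiderivative of g(r^(1 / \<alpha>)), is a continuous
  antiderivative.\<close>

lemma integrable_powr_scale:
  fixes g :: "real \<Rightarrow> 'h::banach"
  assumes \<alpha>: "0 < \<alpha>" and g: "continuous_on {0..} g" and b: "0 \<le> b"
  shows "(\<lambda>t. t powr (\<alpha> - 1) *\<^sub>R g t) integrable_on {0..b}"
proof -
  define h where "h u = g (u powr (1 / \<alpha>))" for u
  define v where "v r = integral {0..r} h" for r
  define c where "c = b powr \<alpha> + 1"
  have ch: "continuous_on {0..c} h"
    unfolding h_def by (intro continuous_on_compose2[OF g] continuous_on_powr' continuous_intros) (use \<alpha> in auto)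
  have v': "(v has_vector_derivative h r) (at r)" if "0 < r" "r < c" for r
  proof -
    have "(v has_vector_derivative h r) (at r within {0..c})"
      unfolding v_def by (rule integral_has_vector_derivative[OF ch]) (use that in auto)
    then have "(v has_vector_derivative h r) (at r within {0<..<c})"
      by (rule has_vector_derivative_within_subset) auto
    then show ?thesis using that by (simp add: has_vector_derivative_within_open[of r "{0<..<c}"])
  qed
  have cv: "continuous_on {0..c} v"
    unfolding v_def by (rule indefinite_integral_continuous_1[OF integrable_continuous_real[OF ch]])
  have le: "t powr \<alpha> < c" if "0 \<le> t" "t \<le> b" for t
    using powr_mono2[of \<alpha> t b] that \<alpha> by (simp add: c_def)
  have "((\<lambda>t. t powr (\<alpha> - 1) *\<^sub>R g t) has_integral ((1 / \<alpha>) *\<^sub>R v (b powr \<alpha>) - (1 / \<alpha>) *\<^sub>R v (0 powr \<alpha>))) {0..b}"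
  proof (rule fundamental_theorem_of_calculus_interior[OF b])
    have "continuous_on {0..b} (\<lambda>t. t powr \<alpha>)"
      by (rule continuous_on_powr') (use \<alpha> in \<open>auto intro!: continuous_intros\<close>)
    then show "continuous_on {0..b} (\<lambda>t. (1 / \<alpha>) *\<^sub>R v (t powr \<alpha>))"
      by (intro continuous_on_scaleR continuous_on_const continuous_on_compose2[OF cv]) (auto intro: less_imp_le[OF le])
    fix t assume t: "t \<in> {0<..<b}"
    have d: "((\<lambda>t. t powr \<alpha>) has_vector_derivative \<alpha> * t powr (\<alpha> - 1)) (at t)"
      unfolding has_real_derivative_iff_has_vector_derivative[symmetric]
      using t by (auto intro!: derivative_eq_intros)
    have "((\<lambda>t. v (t powr \<alpha>)) has_vector_derivative (\<alpha> * t powr (\<alpha> - 1)) *\<^sub>R h (t powr \<alpha>)) (at t)"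
      using vector_diff_chain_at[OF d v'] t le[of t] by (simp add: o_def)
    then have "((\<lambda>t. (1 / \<alpha>) *\<^sub>R v (t powr \<alpha>)) has_vector_derivative (1 / \<alpha>) *\<^sub>R ((\<alpha> * t powr (\<alpha> - 1)) *\<^sub>R h (t powr \<alpha>))) (at t)"
      by (rule bounded_linear.has_vector_derivative[OF bounded_linear_scaleR_right])
    moreover have "h (t powr \<alpha>) = g t" using t \<alpha> by (simp add: h_def powr_powr)
    ultimately show "((\<lambda>t. (1 / \<alpha>) *\<^sub>R v (t powr \<alpha>)) has_vector_derivative t powr (\<alpha> - 1) *\<^sub>R g t) (at t)"
      using \<alpha> by simp
  qed
  then show ?thesis by (rule has_integral_integrable)
qed

section \<open>Resolvent powers, and the passage from regularised to bounded operators\<close>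

context hp_semigroup
begin

definition resolvent_kernel :: "complex \<Rightarrow> real \<Rightarrow> real \<Rightarrow> complex" where
  "resolvent_kernel \<kappa> \<alpha> t = of_real (1 / Gamma \<alpha>) * (of_real (t powr (\<alpha> - 1)) * exp (\<kappa> * of_real t))"

text \<open>The gauge integral of vectors and the integral against the kernel measure become the
  same scalar Lebesgue integral once tested against y.\<close>

lemma resolvent_power_eq:
  assumes \<alpha>: "0 < \<alpha>" and \<kappa>: "Re \<kappa> < 0"
  shows "resolvent_power A \<kappa> \<alpha> = kernel_op (resolvent_kernel \<kappa> \<alpha>)"
proof
  fix x
  let ?f = "\<lambda>t. (of_real (t powr (\<alpha> - 1)) * exp (\<kappa> * of_real t)) *\<^sub>C T t x"
  have k: "set_integrable lborel {0..} (resolvent_kernel \<kappa> \<alpha>)"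
    unfolding resolvent_kernel_def[abs_def] by (rule set_integrable_powr_kernel[OF \<alpha> \<kappa>])
  have k1: "set_integrable lborel {0..} (\<lambda>t. of_real (t powr (\<alpha> - 1)) * exp (\<kappa> * of_real t))"
    using set_integrable_powr_kernel[OF \<alpha> \<kappa>, of 1] by simp
  have eq: "?f t = t powr (\<alpha> - 1) *\<^sub>R (exp (\<kappa> * of_real t) *\<^sub>C T t x)" for t
    by (simp add: scaleC_of_real[symmetric] scaleC_scaleC)
  have f: "?f integrable_on {0..}"
  proof (rule integrable_on_all_intervals_integrable_bound)
    fix a b :: real
    have "?f integrable_on {0..max 0 b}"
      unfolding eq by (rule integrable_powr_scale[OF \<alpha>]) (auto intro!: continuous_intros)
    then have "?f integrable_on {max 0 a..b}"
      by (rule integrable_on_subinterval) auto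
    moreover have "{0..} \<inter> cbox a b = {max 0 a..b}" by auto
    ultimately show "(\<lambda>t. if t \<in> {0..} then ?f t else 0) integrable_on cbox a b"
      by (metis integrable_restrict_Int)
  next
    have "set_integrable lborel {0..} (\<lambda>t. M * norm x * norm (of_real (t powr (\<alpha> - 1)) * exp (\<kappa> * of_real t)))"
      by (intro set_integrable_mult_right set_integrable_norm k1)
    then show "(\<lambda>t. M * norm x * norm (of_real (t powr (\<alpha> - 1)) * exp (\<kappa> * of_real t))) integrable_on {0..}"
      by (rule set_borel_integral_eq_integral(1))
    show "norm (?f t) \<le> M * norm x * norm (of_real (t powr (\<alpha> - 1)) * exp (\<kappa> * of_real t))" if "t \<in> {0..}" for t
      using mult_left_mono[OF norm_T, of t "norm (of_real (t powr (\<alpha> - 1)) * exp (\<kappa> * of_real t))" x] that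
      by (simp add: norm_scaleC mult.commute)
  qed
  have "resolvent_power A \<kappa> \<alpha> x = (1 / Gamma \<alpha>) *\<^sub>R integral {0..} ?f"
    unfolding resolvent_power_def by (intro arg_cong[where f="scaleR _"] integral_cong) (auto simp: semigroup_of_eq)
  also have "\<dots> = kernel_op (resolvent_kernel \<kappa> \<alpha>) x"
  proof (rule cinner_eqI)
    fix y
    let ?g = "\<lambda>t. of_real (t powr (\<alpha> - 1)) * exp (\<kappa> * of_real t) * cinner (T t x) y"
    have g: "set_integrable lborel {0..} ?g"
      using mf_integral(2)[OF sets_half_line k1[folded integrable_half_line] orbit_bcont] by (simp add: integrable_half_line)
    have "cinner (integral {0..} ?f) y = integral {0..} ?g"
      using integral_linear[OF f bounded_linear_cinner_left[of y]] by (simp add: o_def cinner_scaleC_left)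
    also have "\<dots> = (LINT t:{0..}|lborel. ?g t)" by (rule set_borel_integral_eq_integral(2)[OF g, symmetric])
    finally have "cinner ((1 / Gamma \<alpha>) *\<^sub>R integral {0..} ?f) y = of_real (1 / Gamma \<alpha>) * (LINT t:{0..}|lborel. ?g t)"
      by (simp add: cinner_scaleR_left scaleR_conv_of_real)
    also have "\<dots> = cinner (kernel_op (resolvent_kernel \<kappa> \<alpha>) x) y"
      unfolding cinner_kernel_op[OF k] set_integral_mult_right[symmetric] by (simp add: resolvent_kernel_def mult.assoc)
    finally show "cinner ((1 / Gamma \<alpha>) *\<^sub>R integral {0..} ?f) y = cinner (kernel_op (resolvent_kernel \<kappa> \<alpha>) x) y" .
  qed
  finally show "resolvent_power A \<kappa> \<alpha> x = kernel_op (resolvent_kernel \<kappa> \<alpha>) x" .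
qed

lemma has_symbol_resolvent_power:
  assumes \<alpha>: "0 < \<alpha>" and \<kappa>: "Re \<kappa> < 0"
  shows "has_symbol (resolvent_power A \<kappa> \<alpha>) (\<lambda>z. (z - \<kappa>) powr (- of_real \<alpha>))"
proof -
  have "has_symbol (resolvent_power A \<kappa> \<alpha>) (\<lambda>z. of_real (1 / Gamma \<alpha>) * of_real (Gamma \<alpha>) * (z - \<kappa>) powr (- of_real \<alpha>))"
    unfolding resolvent_power_eq[OF assms] resolvent_kernel_def[abs_def] by (rule has_symbol_powr_kernel[OF assms])
  then show ?thesis using Gamma_real_pos[OF \<alpha>] by (simp flip: of_real_mult)
qed

text \<open>From 2 a \<le> n follows n + Re u \<ge> n / 2, hence the constant 4, uniform in n; from
  2 \<le> n follows (n / 2)^2 \<ge> 1, which provides the 1 in the quadratic decay. The decay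
  constant may grow with n because it does not enter the norm estimate.\<close>

lemma
  assumes a: "0 < a" and n: "2 \<le> n" "2 * a \<le> n" and u: "- a \<le> Re u"
  shows norm_approx_symbol_le: "norm ((of_real n / (of_real n + u))\<^sup>2) \<le> 4"
    and norm_approx_symbol_decay: "norm ((of_real n / (of_real n + u))\<^sup>2) \<le> n\<^sup>2 / (1 + (Im u)\<^sup>2)"
proof -
  have re: "n / 2 \<le> n + Re u" using n u by simp
  have "(n / 2)\<^sup>2 \<le> (n + Re u)\<^sup>2" using re n by (intro power_mono) auto
  moreover have "1 \<le> (n / 2)\<^sup>2" using power_mono[of 1 "n / 2" 2] n by simp
  moreover have nn: "(norm (of_real n + u))\<^sup>2 = (n + Re u)\<^sup>2 + (Im u)\<^sup>2" by (simp add: cmod_power2)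
  ultimately have 1: "1 + (Im u)\<^sup>2 \<le> (norm (of_real n + u))\<^sup>2" and 2: "(n / 2)\<^sup>2 \<le> (norm (of_real n + u))\<^sup>2"
    by (auto intro: order_trans)
  have e: "norm ((of_real n / (of_real n + u))\<^sup>2) = n\<^sup>2 / (norm (of_real n + u))\<^sup>2"
    using n by (simp add: norm_power norm_divide power_divide)
  have p: "0 < 1 + (Im u)\<^sup>2" by (rule add_pos_nonneg) auto
  show "norm ((of_real n / (of_real n + u))\<^sup>2) \<le> n\<^sup>2 / (1 + (Im u)\<^sup>2)"
    unfolding e using 1 p by (intro divide_left_mono mult_pos_pos) auto
  have "n\<^sup>2 / (norm (of_real n + u))\<^sup>2 \<le> n\<^sup>2 / (n / 2)\<^sup>2"
    using 1 2 p n by (intro divide_left_mono mult_pos_pos) auto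
  then show "norm ((of_real n / (of_real n + u))\<^sup>2) \<le> 4"
    unfolding e using n by (simp add: power_divide)
qed

text \<open>The common form of the three estimates: \<open>B\<close> is a semigroup operator, a
  resolvent power or the identity, with symbol \<beta>, and \<open>g\<close> continues f \<beta>
  across the imaginary axis. The factor 4 bounds the regularising symbols.\<close>

lemma bounded_regularisation:
  fixes f g :: "complex \<Rightarrow> complex"
  assumes a: "w < - a" "0 < a"
    and f: "f holomorphic_on right_half_plane w" "\<And>u. - a \<le> Re u \<Longrightarrow> norm (f u) \<le> Bf"
    and g: "g holomorphic_on right_half_plane w" "\<And>u. - a \<le> Re u \<Longrightarrow> norm (g u) \<le> Bg"
    and B: "has_symbol B \<beta>" "\<And>z. 0 < Re z \<Longrightarrow> g z = f z * \<beta> z"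
    and E: "\<And>u. - a \<le> Re u \<Longrightarrow> norm (g u) \<le> E (Re u + a)"
    and EJ: "has_bochner_integral lborel (\<lambda>s. indicator {0..} s * (E s / (s + a))) J"
  shows "\<exists>S. graph B O hp_calc A f = graph S \<and> bounded_clinear S \<and> (\<forall>x. norm (S x) \<le> 4 * M\<^sup>2 * J * norm x)"
proof -
  define \<rho> where "\<rho> n u = (of_real n / (of_real n + u))\<^sup>2" for n :: real and u :: complex
  \<comment> \<open>Large enough that every m \<ge> n1 meets both size conditions on the
    regularising symbol.\<close>
  define n1 where "n1 = nat \<lceil>2 * a\<rceil> + 2"
  have n1: "2 \<le> real m" "2 * a \<le> real m" if "n1 \<le> m" for m using that by (auto simp: n1_def) linarith+
  have \<rho>: "\<rho> (real m) holomorphic_on right_half_plane (- real m)" for m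
    unfolding \<rho>_def by (intro holomorphic_intros) (auto simp: right_half_plane_def complex_eq_iff)
  \<comment> \<open>The symbol \<rho> m has its pole at - m \<le> - 2 a; the half-plane is shrunk to
    avoid all these poles while still containing the line Re u = - a.\<close>
  define w' where "w' = max w (- 2 * a)"
  have w': "w' < - a" using a by (simp add: w'_def)
  have \<rho>': "\<rho> (real m) holomorphic_on right_half_plane w'" if "n1 \<le> m" for m
    by (rule holomorphic_on_subset[OF \<rho>]) (use n1[OF that] in \<open>auto simp: right_half_plane_def w'_def\<close>)
  have sub: "right_half_plane w' \<subseteq> right_half_plane w" by (auto simp: right_half_plane_def w'_def)
  have hol: "(\<lambda>u. q u * \<rho> (real m) u) holomorphic_on right_half_plane w'"
    if "n1 \<le> m" "q holomorphic_on right_half_plane w" for q m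
    by (intro holomorphic_intros \<rho>' holomorphic_on_subset[OF that(2) sub] that(1))
  have bd: "norm (q u * \<rho> (real m) u) \<le> (C * (real m)\<^sup>2) / (1 + (Im u)\<^sup>2)"
    if m: "n1 \<le> m" and u: "- a \<le> Re u" and q: "\<And>u. - a \<le> Re u \<Longrightarrow> norm (q u) \<le> C" for q C m u
  proof -
    have "norm (q u * \<rho> (real m) u) \<le> C * ((real m)\<^sup>2 / (1 + (Im u)\<^sup>2))"
      unfolding norm_mult \<rho>_def using q[OF u]
      by (intro mult_mono norm_approx_symbol_decay[OF a(2) n1[OF m] u]) (auto intro: order_trans[OF norm_ge_zero])
    then show ?thesis by simp
  qed
  have fb: "norm (f u * \<rho> (real m) u) \<le> (Bf * (real m)\<^sup>2) / (1 + (Im u)\<^sup>2)" if "n1 \<le> m" "- a \<le> Re u" for m u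
    by (rule bd[OF that]) (rule f(2))
  have gb: "norm (g u * \<rho> (real m) u) \<le> (Bg * (real m)\<^sup>2) / (1 + (Im u)\<^sup>2)" if "n1 \<le> m" "- a \<le> Re u" for m u
    by (rule bd[OF that]) (rule g(2))
  \<comment> \<open>f without \<open>B\<close>, regularised once: the pair \<open>approx n1\<close>,
    \<open>kernel_op h\<close> represents f(A) through \<open>hp_calc_iff\<close>.\<close>
  define h where "h = inverse_laplace (\<lambda>u. f u * \<rho> (real n1) u) a"
  have h: "set_integrable lborel {0..} h" "has_symbol (kernel_op h) (\<lambda>u. f u * \<rho> (real n1) u)"
    using set_integrable_inverse_laplace[OF hol[OF order_refl f(1)] w' a(2) fb[OF order_refl]]
      has_symbol_inverse_laplace[OF hol[OF order_refl f(1)] w' a(2) fb[OF order_refl]]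
    unfolding h_def by blast+
  have n1': "0 < real n1" using n1[OF order_refl] by simp
  have J: "0 \<le> J"
  proof -
    have "0 \<le> E s / (s + a)" if "0 \<le> s" for s
      using order_trans[OF norm_ge_zero E[of "of_real (s - a)"]] that a by simp
    then have "0 \<le> (\<integral>s. indicator {0..} s * (E s / (s + a)) \<partial>lborel)"
      by (intro integral_nonneg_AE) (auto simp: indicator_def)
    then show ?thesis using EJ by (simp add: has_bochner_integral_integral_eq)
  qed
  have "\<exists>S. bounded_clinear S \<and> (\<forall>x. approx (real n1) (S x) = kernel_op h (B x)) \<and> (\<forall>x. norm (S x) \<le> (M\<^sup>2 * (4 * J)) * norm x)"
  proof (rule bounded_limit_operator[OF n1', where g=g and ?m1.0=n1 and Sn="\<lambda>m. kernel_op (inverse_laplace (\<lambda>u. g u * \<rho> (real m) u) a)"])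
    show "has_symbol (\<lambda>x. kernel_op h (B x)) (\<lambda>z. g z * (of_real (real n1) / (of_real (real n1) + z))\<^sup>2)"
      by (rule has_symbol_cong[OF has_symbol_comp[OF h(2) B(1)]]) (simp add: B(2) \<rho>_def)
    fix m assume m: "n1 \<le> m"
    note G = hol[OF m g(1)] w' a(2) gb[OF m]
    show "has_symbol (kernel_op (inverse_laplace (\<lambda>u. g u * \<rho> (real m) u) a)) (\<lambda>z. g z * (of_real (real m) / (of_real (real m) + z))\<^sup>2)"
      using has_symbol_inverse_laplace[OF G] unfolding \<rho>_def .
    show "norm (kernel_op (inverse_laplace (\<lambda>u. g u * \<rho> (real m) u) a) x) \<le> (M\<^sup>2 * (4 * J)) * norm x" for x
    proof (rule norm_kernel_op_le[OF G])
      show "norm (g u * \<rho> (real m) u) \<le> 4 * E (Re u + a)" if u: "- a \<le> Re u" for u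
        using mult_mono[OF E[OF u] norm_approx_symbol_le[OF a(2) n1[OF m] u]] order_trans[OF norm_ge_zero E[OF u]]
        by (simp add: norm_mult \<rho>_def mult.commute)
      show "has_bochner_integral lborel (\<lambda>s. indicator {0..} s * (4 * E s / (s + a))) (4 * J)"
        using has_bochner_integral_mult_right[OF EJ, of 4] by (simp add: mult.left_commute)
    qed
  qed (use J n1' in auto)
  then obtain S where S: "bounded_clinear S" "\<And>x. approx (real n1) (S x) = kernel_op h (B x)"
    "\<And>x. norm (S x) \<le> (M\<^sup>2 * (4 * J)) * norm x" by blast
  note ak = set_integrable_approx_kernel[OF n1']
  have iff: "(x, y) \<in> hp_calc A f \<longleftrightarrow> approx (real n1) y = kernel_op h x" for x y
    unfolding approx_def kernel_op_def
  proof (rule hp_calc_iff[OF complex_borel_measure_kernel[OF ak] complex_borel_measure_kernel[OF h(1)]])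
    show "inj (hp_measure A (kernel_cmeasure (approx_kernel (real n1))))"
      using inj_approx[OF n1'] by (simp add: approx_def kernel_op_def)
    fix z :: complex assume z: "0 < Re z"
    have "laplace (kernel_cmeasure h) z = f z * \<rho> (real n1) z"
      by (subst laplace_kernel[OF h(1) z], unfold h_def,
          rule laplace_inverse_laplace[OF hol[OF order_refl f(1)] w' fb[OF order_refl]]) (use a z in auto)
    then show "laplace (kernel_cmeasure (approx_kernel (real n1))) z * f z = laplace (kernel_cmeasure h) z"
      unfolding laplace_kernel[OF ak z] LINT_approx_kernel[OF n1' z] by (simp add: \<rho>_def)
  qed
  have "graph B O hp_calc A f = graph S"
  proof -
    have "(x, z) \<in> graph B O hp_calc A f \<longleftrightarrow> approx (real n1) z = approx (real n1) (S x)" for x z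
      by (auto simp: graph_def relcomp_unfold iff S(2))
    then have "(x, z) \<in> graph B O hp_calc A f \<longleftrightarrow> (x, z) \<in> graph S" for x z
      using inj_approx[OF n1'] by (simp add: inj_eq graph_def)
    then show ?thesis by (intro subset_antisym subrelI) blast+
  qed
  then show ?thesis using S by (auto simp: mult_ac)
qed

end

section \<open>Consequences for bounded holomorphic functions\<close>

text \<open>The value of J for E(s) = c (s + a)^(- \<alpha>), used for resolvent powers and, with
  \<alpha> = m, for derivatives.\<close>

lemma has_bochner_integral_powr_shift:
  assumes "0 < a" "0 < (\<alpha>::real)"
  shows "has_bochner_integral lborel (\<lambda>s. indicator {0..} s * (c * (s + a) powr (- \<alpha>) / (s + a))) (c * a powr (- \<alpha>) / \<alpha>)"
proof -
  have "filterlim (\<lambda>s. s + a) at_top at_top"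
    by (rule filterlim_tendsto_add_at_top[OF tendsto_const filterlim_ident, of a, simplified add.commute])
  then have "((\<lambda>s. (s + a) powr (- \<alpha>)) \<longlongrightarrow> 0) at_top"
    by (intro tendsto_neg_powr) (use assms in auto)
  then have "((\<lambda>s. - ((s + a) powr (- \<alpha>) / \<alpha>)) \<longlongrightarrow> - (0 / \<alpha>)) at_top"
    by (intro tendsto_intros) (use assms in auto)
  then have "has_bochner_integral lborel (\<lambda>s. indicator {0..} s * ((s + a) powr (- \<alpha>) / (s + a))) (- (0 / \<alpha>) - (- ((0 + a) powr (- \<alpha>) / \<alpha>)))"
  proof (rule has_bochner_integral_FTC_atLeast[rotated 3])
    fix s :: real assume s: "0 \<le> s"
    show "((\<lambda>s. - ((s + a) powr (- \<alpha>) / \<alpha>)) has_real_derivative (s + a) powr (- \<alpha>) / (s + a)) (at s)"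
      using s assms by (auto intro!: derivative_eq_intros simp: powr_diff)
  qed (use assms in auto)
  from has_bochner_integral_mult_right[OF this, of c] show ?thesis
    by (simp add: mult.left_commute)
qed

text \<open>Partial fractions for E(s) = c / (1 + \<tau> s), the rational majorant of the symbol of
  the semigroup. The condition a \<tau> < 1 keeps the two poles apart and 1 - a \<tau>
  positive.\<close>

lemma has_bochner_integral_log:
  assumes "0 < a" "0 < (\<tau>::real)" "a * \<tau> < 1"
  shows "has_bochner_integral lborel (\<lambda>s. indicator {0..} s * (c / (1 + \<tau> * s) / (s + a))) (c * ln (1 / (a * \<tau>)) / (1 - a * \<tau>))"
proof -
  define F where "F s = ln ((s + a) / (1 + \<tau> * s)) / (1 - a * \<tau>)" for s
  have "((\<lambda>s. (s + a) / (1 + \<tau> * s)) \<longlongrightarrow> inverse \<tau>) at_top"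
    using assms by real_asymp
  then have lim0: "((\<lambda>s. (s + a) / (1 + \<tau> * s)) \<longlongrightarrow> 1 / \<tau>) at_top"
    by (simp add: inverse_eq_divide)
  have lim: "(F \<longlongrightarrow> ln (1 / \<tau>) / (1 - a * \<tau>)) at_top"
    unfolding F_def by (rule tendsto_divide[OF tendsto_ln[OF lim0] tendsto_const]) (use assms in auto)
  have "has_bochner_integral lborel (\<lambda>s. indicator {0..} s * (1 / (1 + \<tau> * s) / (s + a))) (ln (1 / \<tau>) / (1 - a * \<tau>) - F 0)"
  proof (rule has_bochner_integral_FTC_atLeast[OF _ _ _ lim])
    fix s :: real assume s: "0 \<le> s"
    have pos: "0 < 1 + \<tau> * s" "0 < s + a" using s assms by (auto intro: add_pos_nonneg)
    have "((\<lambda>s. (ln (s + a) - ln (1 + \<tau> * s)) / (1 - a * \<tau>)) has_real_derivative (1 / (s + a) - \<tau> / (1 + \<tau> * s)) / (1 - a * \<tau>)) (at s)"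
      using pos assms by (auto intro!: derivative_eq_intros)
    also have "(1 / (s + a) - \<tau> / (1 + \<tau> * s)) / (1 - a * \<tau>) = 1 / (1 + \<tau> * s) / (s + a)"
    proof -
      have "1 / (s + a) - \<tau> / (1 + \<tau> * s) = (1 - a * \<tau>) / ((1 + \<tau> * s) * (s + a))"
        using pos by (simp add: divide_simps) (simp add: algebra_simps)
      then show ?thesis using assms by simp
    qed
    finally show "(F has_real_derivative 1 / (1 + \<tau> * s) / (s + a)) (at s)"
    proof (rule has_field_derivative_transform_within_open)
      show "open {s. 0 < 1 + \<tau> * s \<and> 0 < s + a}"
        by (intro open_Collect_conj open_Collect_less continuous_intros)
    qed (use pos in \<open>auto simp: F_def ln_div\<close>)
    show "0 \<le> 1 / (1 + \<tau> * s) / (s + a)" using pos by simp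
  qed measurable
  from has_bochner_integral_mult_right[OF this, of c]
  have "has_bochner_integral lborel (\<lambda>s. indicator {0..} s * (c / (1 + \<tau> * s) / (s + a))) (c * (ln (1 / \<tau>) / (1 - a * \<tau>) - F 0))"
    by (simp add: mult_ac)
  moreover have "c * (ln (1 / \<tau>) / (1 - a * \<tau>) - F 0) = c * ln (1 / (a * \<tau>)) / (1 - a * \<tau>)"
  proof -
    have "F 0 = ln a / (1 - a * \<tau>)" by (simp add: F_def)
    moreover have "ln (1 / (a * \<tau>)) = ln (1 / \<tau>) - ln a" using assms by (simp add: ln_div ln_mult)
    ultimately show ?thesis by (simp only: diff_divide_distrib times_divide_eq_right[symmetric])
  qed
  ultimately show ?thesis by simp
qed

lemma norm_powr_of_real: "(w::complex) \<noteq> 0 \<Longrightarrow> norm (w powr of_real x) = norm w powr x"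
  by (simp add: powr_def)

lemma Hinf_norm_ge:
  assumes "f \<in> Hinf w" "w < Re u"
  shows "norm (f u) \<le> Hinf_norm w f"
proof -
  have "bdd_above ((\<lambda>z. norm (f z)) ` right_half_plane w)"
    using assms(1) by (auto simp: Hinf_def bounded_iff bdd_above_def)
  then show ?thesis
    unfolding Hinf_norm_def by (intro cSUP_upper) (use assms in \<open>auto simp: right_half_plane_def\<close>)
qed

lemma Hinf_norm_nonneg: "f \<in> Hinf w \<Longrightarrow> 0 \<le> Hinf_norm w f"
  using order_trans[OF norm_ge_zero Hinf_norm_ge[of f w "of_real (w + 1)"]] by simp

lemma op_norm_graph_le:
  assumes "\<And>x. norm (S x) \<le> c * norm x" "0 \<le> c"
  shows "op_norm (graph S) \<le> c"
proof -
  have "(\<lambda>x. THE y. (x, y) \<in> graph S) = S" by (auto simp: graph_def)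
  then show ?thesis unfolding op_norm_def using onorm_bound[OF assms(2,1)] by simp
qed

lemma in_L_op_norm_le:
  assumes "\<exists>S. G = graph S \<and> bounded_clinear S \<and> (\<forall>x. norm (S x) \<le> c * norm x)" "c \<le> d" "0 \<le> d"
  shows "in_L G \<and> op_norm G \<le> d"
proof -
  from assms(1) obtain S where S: "G = graph S" "bounded_clinear S" "\<And>x. norm (S x) \<le> c * norm x" by blast
  have "norm (S x) \<le> d * norm x" for x
    using S(3)[of x] mult_right_mono[OF assms(2), of "norm x"] by simp
  then have "op_norm G \<le> d" unfolding S(1) by (rule op_norm_graph_le[OF _ assms(3)])
  then show ?thesis using S by (auto simp: in_L_def)
qed

section \<open>The three norm estimates\<close>

context hp_semigroup
begin

text \<open>The constant 16 is 4 times 2 times 2: the regularisation, exp (a \<tau>) \<le> 2, and 1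
  / (1 - a \<tau>) \<le> 2.\<close>

lemma calculus_times_semigroup:
  assumes w: "w < 0" and \<tau>: "0 < \<tau>" and f: "f \<in> Hinf w"
  shows "in_L (graph (T \<tau>) O hp_calc A f) \<and> op_norm (graph (T \<tau>) O hp_calc A f) \<le> 16 * ln (max 2 (- 2 / w / \<tau>)) * M\<^sup>2 * Hinf_norm w f"
proof -
  \<comment> \<open>The first entry keeps the line Re z = - a inside the domain of f; the second
    gives a \<tau> \<le> 1 / 2, which for large \<tau> stops exp (a \<tau>) from growing. As a
    result 1 / (a \<tau>) is exactly the maximum in the statement.\<close>
  define a where "a = min (- w / 2) (1 / (2 * \<tau>))"
  define K where "K = Hinf_norm w f"
  have K: "0 \<le> K" unfolding K_def by (rule Hinf_norm_nonneg[OF f])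
  have a: "w < - a" "0 < a" using w \<tau> by (auto simp: a_def min_less_iff_disj)
  have "a \<le> 1 / (2 * \<tau>)" by (simp add: a_def)
  then have a\<tau>: "a * \<tau> \<le> 1 / 2" using \<tau> by (simp add: field_simps)
  have inv: "1 / (a * \<tau>) = max 2 (- 2 / w / \<tau>)"
  proof -
    define p where "p = - w * \<tau>"
    have p: "0 < p" using w \<tau> by (simp add: p_def mult_neg_pos)
    have a: "a = (if p \<le> 1 then - w / 2 else 1 / (2 * \<tau>))"
      using \<tau> by (auto simp: a_def p_def min_def field_simps)
    have "- 2 / w / \<tau> = 2 / p" using w \<tau> by (simp add: p_def field_simps)
    moreover have "1 / (a * \<tau>) = (if p \<le> 1 then 2 / p else 2)" using \<tau> w by (simp add: a p_def field_simps)
    moreover have "max 2 (2 / p) = (if p \<le> 1 then 2 / p else 2)" using p by (auto simp: max_def field_simps)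
    ultimately show ?thesis by (simp only:)
  qed
  have fb: "norm (f u) \<le> K" if "- a \<le> Re u" for u
    unfolding K_def using that a by (intro Hinf_norm_ge[OF f]) simp
  \<comment> \<open>exp (- \<tau> s) \<le> 1 / (1 + \<tau> s) trades the exponential for a function
    whose J is elementary and still of logarithmic size in \<tau>.\<close>
  have e: "norm (exp (- u * of_real \<tau>)) \<le> 2 * (1 / (1 + \<tau> * (Re u + a)))" if u: "- a \<le> Re u" for u
  proof -
    have "norm (exp (- u * of_real \<tau>)) = exp (a * \<tau>) * exp (- (\<tau> * (Re u + a)))"
      by (simp add: exp_add[symmetric] algebra_simps)
    also have "\<dots> \<le> 2 * (1 / (1 + \<tau> * (Re u + a)))"
    proof (intro mult_mono)
      have "exp (a * \<tau>) \<le> exp (1 / 2)" using a\<tau> by simp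
      also have "exp (1 / 2) \<le> (2::real)"
      proof -
        have "(exp (1 / 2))\<^sup>2 = exp (1::real)" by (simp add: power2_eq_square exp_add[symmetric])
        also have "\<dots> \<le> 2\<^sup>2" using exp_le by simp
        finally show ?thesis by (rule power2_le_imp_le) simp
      qed
      finally show "exp (a * \<tau>) \<le> 2" .
      have "0 \<le> \<tau> * (Re u + a)" using u \<tau> by simp
      moreover have "1 + \<tau> * (Re u + a) \<le> exp (\<tau> * (Re u + a))" by (rule exp_ge_add_one_self)
      ultimately show "exp (- (\<tau> * (Re u + a))) \<le> 1 / (1 + \<tau> * (Re u + a))"
        by (simp add: exp_minus inverse_eq_divide divide_left_mono)
    qed auto
    finally show ?thesis .
  qed
  have gE: "norm (f u * exp (- u * of_real \<tau>)) \<le> 2 * K / (1 + \<tau> * (Re u + a))" if u: "- a \<le> Re u" for u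
    using mult_mono[OF fb[OF u] e[OF u] K] by (simp add: norm_mult mult_ac)
  have gB: "norm (f u * exp (- u * of_real \<tau>)) \<le> 2 * K" if u: "- a \<le> Re u" for u
  proof -
    have "1 \<le> 1 + \<tau> * (Re u + a)" using u \<tau> by simp
    then have "2 * K / (1 + \<tau> * (Re u + a)) \<le> 2 * K / 1" using K by (intro divide_left_mono) auto
    then show ?thesis using gE[OF u] by simp
  qed
  have hol: "f holomorphic_on right_half_plane w" using f by (simp add: Hinf_def)
  have "\<exists>S. graph (T \<tau>) O hp_calc A f = graph S \<and> bounded_clinear S \<and> (\<forall>x. norm (S x) \<le> 4 * M\<^sup>2 * (2 * K * ln (1 / (a * \<tau>)) / (1 - a * \<tau>)) * norm x)"
  proof (rule bounded_regularisation[OF a hol fb _ gB has_symbol_T[OF less_imp_le[OF \<tau>]] refl gE])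
    show "(\<lambda>u. f u * exp (- u * of_real \<tau>)) holomorphic_on right_half_plane w"
      by (intro holomorphic_intros hol)
    show "has_bochner_integral lborel (\<lambda>s. indicator {0..} s * (2 * K / (1 + \<tau> * s) / (s + a))) (2 * K * ln (1 / (a * \<tau>)) / (1 - a * \<tau>))"
      by (rule has_bochner_integral_log) (use a \<tau> a\<tau> in auto)
  qed
  then show ?thesis
  proof (rule in_L_op_norm_le)
    have l: "0 \<le> ln (1 / (a * \<tau>))" unfolding inv by simp
    have "2 * K * ln (1 / (a * \<tau>)) / (1 - a * \<tau>) \<le> 2 * K * ln (1 / (a * \<tau>)) / (1 / 2)"
      using a\<tau> l K by (intro divide_left_mono) auto
    then have "4 * M\<^sup>2 * (2 * K * ln (1 / (a * \<tau>)) / (1 - a * \<tau>)) \<le> 4 * M\<^sup>2 * (2 * K * ln (1 / (a * \<tau>)) / (1 / 2))"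
      by (intro mult_left_mono) auto
    then show "4 * M\<^sup>2 * (2 * K * ln (1 / (a * \<tau>)) / (1 - a * \<tau>)) \<le> 16 * ln (max 2 (- 2 / w / \<tau>)) * M\<^sup>2 * Hinf_norm w f"
      unfolding inv[symmetric] K_def[symmetric] by (simp add: mult_ac)
    show "0 \<le> 16 * ln (max 2 (- 2 / w / \<tau>)) * M\<^sup>2 * Hinf_norm w f"
      using K l unfolding inv[symmetric] K_def[symmetric] by simp
  qed
qed

text \<open>By the choice of \<open>a\<close>, both w and Re \<kappa> are at most - 2 a. Hence |u -
  \<kappa>| \<ge> Re u + 2 a, the branch cut of the power is avoided, and E(s) = K (s + a)^(-
  \<alpha>) is admissible.\<close>

lemma calculus_times_resolvent_power:
  assumes w: "w < 0" and \<alpha>: "0 < \<alpha>" and \<kappa>: "Re \<kappa> < 0"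
  defines "a \<equiv> min (- w) (- Re \<kappa>) / 2"
  assumes f: "f \<in> Hinf w"
  shows "\<exists>S. graph (resolvent_power A \<kappa> \<alpha>) O hp_calc A f = graph S \<and> bounded_clinear S \<and>
    (\<forall>x. norm (S x) \<le> 4 * M\<^sup>2 * (Hinf_norm w f * a powr (- \<alpha>) / \<alpha>) * norm x)"
proof -
  define K where "K = Hinf_norm w f"
  have K: "0 \<le> K" unfolding K_def by (rule Hinf_norm_nonneg[OF f])
  have a: "- 2 * a < - a" "0 < a" "w \<le> - 2 * a" "Re \<kappa> \<le> - 2 * a" using w \<kappa> by (auto simp: a_def min_def)
  have hol: "f holomorphic_on right_half_plane (- 2 * a)"
    by (rule holomorphic_on_subset[of f "right_half_plane w"]) (use f a in \<open>auto simp: Hinf_def right_half_plane_def\<close>)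
  have fb: "norm (f u) \<le> K" if "- a \<le> Re u" for u
    unfolding K_def using that a by (intro Hinf_norm_ge[OF f]) simp
  have gE: "norm (f u * (u - \<kappa>) powr (- of_real \<alpha>)) \<le> K * (Re u + a + a) powr (- \<alpha>)" if u: "- a \<le> Re u" for u
  proof -
    have le: "Re u + a + a \<le> norm (u - \<kappa>)" "0 < Re u + a + a"
      using complex_Re_le_cmod[of "u - \<kappa>"] a u by auto
    then have "u - \<kappa> \<noteq> 0" by auto
    then have "norm ((u - \<kappa>) powr (- of_real \<alpha>)) = norm (u - \<kappa>) powr (- \<alpha>)"
      using norm_powr_of_real[of "u - \<kappa>" "- \<alpha>"] by simp
    also have "\<dots> \<le> (Re u + a + a) powr (- \<alpha>)"
      using le \<alpha> by (intro powr_mono2') auto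
    finally show ?thesis unfolding norm_mult using fb[OF u] K by (intro mult_mono) auto
  qed
  have gB: "norm (f u * (u - \<kappa>) powr (- of_real \<alpha>)) \<le> K * a powr (- \<alpha>)" if u: "- a \<le> Re u" for u
  proof -
    have "(Re u + a + a) powr (- \<alpha>) \<le> a powr (- \<alpha>)" using u a \<alpha> by (intro powr_mono2') auto
    then show ?thesis using gE[OF u] mult_left_mono[OF _ K] order_trans by blast
  qed
  show ?thesis
    unfolding K_def[symmetric]
  proof (rule bounded_regularisation[OF a(1,2) hol fb _ gB has_symbol_resolvent_power[OF \<alpha> \<kappa>] refl gE])
    show "(\<lambda>u. f u * (u - \<kappa>) powr (- of_real \<alpha>)) holomorphic_on right_half_plane (- 2 * a)"
      using a(4) by (intro holomorphic_intros hol) (auto simp: right_half_plane_def complex_nonpos_Reals_iff)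
  qed (use has_bochner_integral_powr_shift[OF a(2) \<alpha>, of K] in simp_all)
qed

text \<open>Cauchy's inequality on discs reaching half-way to the boundary makes the m-th derivative
  decay like (s + a)^(- m), which is integrable against 1 / (s + a) because m \<ge> 1. The decay is
  already in the function, so \<open>B\<close> is the identity. The powers 2^m from the radius and
  from a = |w| / 2 combine to 4^m.\<close>

lemma calculus_derivative:
  assumes w: "w < 0" and m: "1 \<le> m" and f: "f \<in> Hinf w"
  shows "in_L (hp_calc A ((deriv ^^ m) f)) \<and>
     op_norm (hp_calc A ((deriv ^^ m) f)) \<le> (4 * M\<^sup>2 * (fact m * 4 ^ m)) / \<bar>w\<bar> ^ m * Hinf_norm w f"
proof -
  define K where "K = Hinf_norm w f"
  have K: "0 \<le> K" unfolding K_def by (rule Hinf_norm_nonneg[OF f])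
  define a where "a = - w / 2"
  have a: "w < - a" "0 < a" "w = - 2 * a" using w by (auto simp: a_def)
  have hol: "f holomorphic_on right_half_plane w" using f by (simp add: Hinf_def)
  define C where "C = fact m * 2 ^ m * K"
  have C: "0 \<le> C" using K by (simp add: C_def)
  let ?g = "(deriv ^^ m) f"
  have holg: "?g holomorphic_on right_half_plane w"
    by (rule holomorphic_higher_deriv[OF hol open_right_half_plane])
  have gE: "norm (?g u) \<le> C * (Re u + a + a) powr (- real m)" if u: "- a \<le> Re u" for u
  proof -
    define r where "r = (Re u + a + a) / 2"
    have r: "0 < r" using u a by (simp add: r_def)
    have sub: "w < Re v" if "norm (u - v) \<le> r" for v
    proof -
      have "Re u - Re v \<le> r" using complex_Re_le_cmod[of "u - v"] that by simp
      then show ?thesis using u a r by (simp add: r_def)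
    qed
    then have cb: "cball u r \<subseteq> right_half_plane w" by (auto simp: right_half_plane_def dist_norm)
    have "norm (?g u) \<le> fact m * K / r ^ m"
    proof (rule Cauchy_inequality[OF _ _ r])
      show "f holomorphic_on ball u r" by (rule holomorphic_on_subset[OF hol]) (use cb ball_subset_cball in blast)
      show "continuous_on (cball u r) f" by (rule continuous_on_subset[OF holomorphic_on_imp_continuous_on[OF hol] cb])
      show "norm (f v) \<le> K" if "norm (u - v) = r" for v
        unfolding K_def by (rule Hinf_norm_ge[OF f]) (use sub that in auto)
    qed
    also have "\<dots> = C * (Re u + a + a) powr (- real m)"
    proof -
      have "(Re u + a + a) powr (- real m) = 1 / (Re u + a + a) ^ m"
        using u a(2) powr_realpow[of "Re u + a + a" m] by (simp add: powr_minus divide_inverse)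
      then show ?thesis by (simp only: C_def r_def power_divide) simp
    qed
    finally show ?thesis .
  qed
  have gB: "norm (?g u) \<le> C * a powr (- real m)" if u: "- a \<le> Re u" for u
  proof -
    have "(Re u + a + a) powr (- real m) \<le> a powr (- real m)" using u a by (intro powr_mono2') auto
    then show ?thesis using gE[OF u] mult_left_mono[OF _ C] order_trans by blast
  qed
  have "\<exists>S. graph (\<lambda>x. x) O hp_calc A ?g = graph S \<and> bounded_clinear S \<and>
    (\<forall>x. norm (S x) \<le> 4 * M\<^sup>2 * (C * a powr (- real m) / real m) * norm x)"
    by (rule bounded_regularisation[OF a(1,2) holg gB holg gB has_symbol_id _ gE has_bochner_integral_powr_shift[OF a(2)]])
      (use m in auto)
  moreover have "graph (\<lambda>x. x) O hp_calc A ?g = hp_calc A ?g" by (auto simp: graph_def)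
  ultimately have "\<exists>S. hp_calc A ?g = graph S \<and> bounded_clinear S \<and>
    (\<forall>x. norm (S x) \<le> 4 * M\<^sup>2 * (C * a powr (- real m) / real m) * norm x)" by simp
  then show ?thesis
  proof (rule in_L_op_norm_le)
    have "C * a powr (- real m) / real m \<le> C * a powr (- real m) / 1"
      using m C by (intro divide_left_mono) auto
    also have "\<dots> = fact m * 4 ^ m / \<bar>w\<bar> ^ m * K"
    proof -
      have "\<bar>w\<bar> = 2 * a" using a by simp
      moreover have "(4::real) ^ m = 2 ^ m * 2 ^ m" by (simp add: power_mult_distrib[symmetric])
      moreover have "a powr (- real m) = 1 / a ^ m"
        using a(2) powr_realpow[of a m] by (simp add: powr_minus divide_inverse)
      ultimately show ?thesis by (simp only: C_def power_mult_distrib) simp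
    qed
    finally have "4 * M\<^sup>2 * (C * a powr (- real m) / real m) \<le> 4 * M\<^sup>2 * (fact m * 4 ^ m / \<bar>w\<bar> ^ m * K)"
      by (intro mult_left_mono) auto
    then show "4 * M\<^sup>2 * (C * a powr (- real m) / real m) \<le> (4 * M\<^sup>2 * (fact m * 4 ^ m)) / \<bar>w\<bar> ^ m * Hinf_norm w f"
      by (simp add: K_def mult_ac)
    show "0 \<le> (4 * M\<^sup>2 * (fact m * 4 ^ m)) / \<bar>w\<bar> ^ m * Hinf_norm w f"
      using K by (simp add: K_def)
  qed
qed

end

text \<open>For \<tau> below 1 and 1 / k one has ln k \<le> |ln \<tau>|, so ln (k / \<tau>) \<le> 2
  |ln \<tau>|, whence the constant 32; for \<tau> \<ge> k / 2 the maximum is 2.\<close>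

lemma bigo_log_max:
  fixes k :: real
  assumes k: "0 < k"
  shows "(\<lambda>\<tau>. 16 * ln (max 2 (k / \<tau>))) \<in> O[at_right 0](\<lambda>\<tau>. \<bar>ln \<tau>\<bar>)"
    and "(\<lambda>\<tau>. 16 * ln (max 2 (k / \<tau>))) \<in> O[at_top](\<lambda>\<tau>. 1)"
proof -
  show "(\<lambda>\<tau>. 16 * ln (max 2 (k / \<tau>))) \<in> O[at_right 0](\<lambda>\<tau>. \<bar>ln \<tau>\<bar>)"
  proof (rule bigoI[of _ 32])
    have "\<forall>\<^sub>F \<tau> in at_right 0. \<tau> \<in> {0<..<min (k / 2) (min 1 (1 / k))}"
      using k by (intro eventually_at_rightI[of 0 "min (k / 2) (min 1 (1 / k))"]) auto
    then show "\<forall>\<^sub>F \<tau> in at_right 0. norm (16 * ln (max 2 (k / \<tau>))) \<le> 32 * norm \<bar>ln \<tau>\<bar>"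
    proof eventually_elim
      case (elim \<tau>)
      then have t: "0 < \<tau>" "\<tau> < k / 2" "\<tau> < 1" "\<tau> < 1 / k" by auto
      have k2: "2 \<le> k / \<tau>" using t by (simp add: field_simps)
      have "k \<le> 1 / \<tau>" using t k by (simp add: field_simps)
      then have "ln k \<le> ln (1 / \<tau>)" using k t by (subst ln_le_cancel_iff) auto
      moreover have "ln (k / \<tau>) = ln k - ln \<tau>" using k t by (simp add: ln_div)
      moreover have "ln \<tau> < 0" using t by simp
      ultimately have "ln (k / \<tau>) \<le> 2 * \<bar>ln \<tau>\<bar>" using t by (simp add: ln_div)
      moreover have "0 \<le> ln (k / \<tau>)" using k2 by simp
      ultimately show ?case using k2 by (simp add: max_def)
    qed
  qed
  show "(\<lambda>\<tau>. 16 * ln (max 2 (k / \<tau>))) \<in> O[at_top](\<lambda>\<tau>. 1)"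
  proof (rule bigoI[of _ "16 * ln 2"])
    show "\<forall>\<^sub>F \<tau> in at_top. norm (16 * ln (max 2 (k / \<tau>))) \<le> 16 * ln 2 * norm (1::real)"
      using eventually_ge_at_top[of "max 1 (k / 2)"]
    proof eventually_elim
      case (elim \<tau>)
      then have "k / \<tau> \<le> 2" by (simp add: field_simps)
      then show ?case by (simp add: max_def)
    qed
  qed
qed

section \<open>Domains of fractional powers\<close>

text \<open>The coefficients are O(n^(- \<alpha> - 1)). Absolute summability is what turns the power
  series of (1 - w)^\<alpha> into the Laplace transform of an integrable kernel, up to its constant
  term.\<close>

lemma summable_abs_gbinomial:
  fixes \<alpha> :: real
  assumes "0 < \<alpha>"
  shows "summable (\<lambda>k. \<bar>\<alpha> gchoose k\<bar>)"
proof -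
  have "Bseq (\<lambda>n. (\<alpha> gchoose n) / ((- 1) ^ n / exp ((\<alpha> + 1) * of_real (ln (real n)))))"
    by (rule convergent_imp_Bseq, rule convergentI, rule gbinomial_asymptotic)
  then obtain B where B: "\<And>n. norm ((\<alpha> gchoose n) / ((- 1) ^ n / exp ((\<alpha> + 1) * of_real (ln (real n))))) \<le> B"
    by (elim BseqE) blast
  have "summable (\<lambda>n. B * real n powr (- (\<alpha> + 1)))"
    by (intro summable_mult) (subst summable_real_powr_iff, use assms in simp)
  moreover have "\<forall>\<^sub>F n in sequentially. norm \<bar>\<alpha> gchoose n\<bar> \<le> B * real n powr (- (\<alpha> + 1))"
    using eventually_gt_at_top[of 0]
  proof eventually_elim
    case (elim n)
    define X where "X = exp ((\<alpha> + 1) * ln (real n))"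
    have "\<bar>\<alpha> gchoose n\<bar> * X \<le> B"
      using B[of n] by (simp add: X_def abs_mult abs_divide power_abs)
    then have "\<bar>\<alpha> gchoose n\<bar> * X * inverse X \<le> B * inverse X"
      by (rule mult_right_mono) (simp add: X_def)
    moreover have "X \<noteq> 0" by (simp add: X_def)
    moreover have "real n powr (- (\<alpha> + 1)) = inverse X"
      using elim by (simp add: X_def powr_def exp_minus[symmetric] algebra_simps)
    ultimately show ?case by (simp add: mult.assoc)
  qed
  ultimately show ?thesis by (rule summable_comparison_test_ev[rotated])
qed

text \<open>The principal logarithms of z and 1 / (1 + z) both have imaginary part in (- pi / 2, pi
  / 2), so they add without a jump of 2 pi i.\<close>

lemma powr_divide_one_plus:
  assumes z: "0 < Re z"
  shows "z powr of_real \<alpha> * (1 + z) powr (- of_real \<alpha>) = (z / (1 + z)) powr of_real \<alpha>"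
proof -
  have nz: "z \<noteq> 0" "1 + z \<noteq> 0" using z by (auto simp: complex_eq_iff)
  have "0 < (1 + Re z) / ((1 + Re z)\<^sup>2 + (Im z)\<^sup>2)"
    using z by (intro divide_pos_pos add_pos_nonneg zero_less_power) auto
  then have re: "0 < Re (inverse (1 + z))" by (simp add: Re_divide inverse_eq_divide)
  have "\<bar>Im (Ln z)\<bar> < pi / 2" "\<bar>Im (Ln (inverse (1 + z)))\<bar> < pi / 2"
    using Re_Ln_pos_lt[of z] Re_Ln_pos_lt[of "inverse (1 + z)"] z re nz by auto
  then have "Ln (z * inverse (1 + z)) = Ln z + Ln (inverse (1 + z))"
    using nz by (intro Ln_times_simple) auto
  also have "Ln (inverse (1 + z)) = - Ln (1 + z)"
    using z by (intro Ln_inverse) (auto simp: complex_nonpos_Reals_iff)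
  finally have Ln: "Ln (z / (1 + z)) = Ln z - Ln (1 + z)" by (simp add: divide_inverse)
  show ?thesis using nz by (simp add: powr_def Ln exp_add[symmetric] right_diff_distrib)
qed

context hp_semigroup
begin

text \<open>The density t^k exp (- t) / k! has mass 1 and Laplace transform (1 + z)^(- k - 1), so
  absolutely summable coefficients give an integrable kernel. The exponent
  \<open>real k + 1 - 1\<close> is \<alpha> - 1 for \<alpha> = k + 1.\<close>

lemma
  fixes c :: "nat \<Rightarrow> real"
  assumes c: "summable (\<lambda>k. \<bar>c k\<bar>)"
  defines "\<kappa> \<equiv> \<lambda>t. \<Sum>k. of_real (c k / fact k) * (of_real (t powr (real k + 1 - 1)) * exp (- 1 * of_real t))"
  shows set_integrable_power_series_kernel: "set_integrable lborel {0..} \<kappa>"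
    and LINT_power_series_kernel: "0 < Re z \<Longrightarrow>
      (\<lambda>k. of_real (c k) * (1 / (1 + z)) ^ Suc k) sums (LINT t:{0..}|lborel. \<kappa> t * exp (- z * of_real t))"
proof -
  define h where "h k t = of_real (c k / fact k) * (of_real (t powr (real k + 1 - 1)) * exp (- 1 * of_real t) :: complex)" for k t
  have \<kappa>: "\<kappa> t = (\<Sum>k. h k t)" for t by (simp add: \<kappa>_def h_def)
  have Gk: "Gamma (real k + 1) = fact k" for k using Gamma_fact[of k, where ?'a=real] by (simp add: add.commute)
  have hi: "set_integrable lborel {0..} (h k)" for k
    unfolding h_def by (rule set_integrable_powr_kernel) auto
  have nh: "(\<integral>t. norm (indicator {0..} t *\<^sub>R h k t) \<partial>lborel) = \<bar>c k\<bar>" for k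
  proof -
    have "has_bochner_integral lborel (\<lambda>t. \<bar>c k\<bar> / fact k * (indicator {0..} t * (t powr (real k + 1 - 1) * exp (- 1 * t)))) (\<bar>c k\<bar> / fact k * (Gamma (real k + 1) * 1 powr (- (real k + 1))))"
      by (intro has_bochner_integral_mult_right has_bochner_integral_powr_exp) auto
    moreover have "(\<lambda>t. \<bar>c k\<bar> / fact k * (indicator {0..} t * (t powr (real k + 1 - 1) * exp (- 1 * t)))) = (\<lambda>t. norm (indicator {0..} t *\<^sub>R h k t))"
      by (simp add: h_def norm_mult norm_divide fun_eq_iff)
    moreover have "\<bar>c k\<bar> / fact k * (Gamma (real k + 1) * 1 powr (- (real k + 1))) = \<bar>c k\<bar>" by (simp add: Gk)
    ultimately show ?thesis using has_bochner_integral_integral_eq by metis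
  qed
  have sum_norm: "summable (\<lambda>k. norm (indicator {0..} t *\<^sub>R h k t))" if "t \<noteq> 0" for t
  proof (cases "0 < t")
    case True
    obtain B where B: "\<And>k. norm (c k) \<le> B"
      using summable_imp_Bseq[OF summable_rabs_cancel[OF c]] by (elim BseqE) blast
    have "summable (\<lambda>k. B * exp (- t) * (t ^ k / fact k))"
      using summable_exp[of t] by (intro summable_mult) (simp add: divide_inverse mult.commute)
    then show ?thesis
    proof (rule summable_comparison_test[rotated], intro exI allI impI)
      fix k
      have "norm (h k t) = \<bar>c k\<bar> * (exp (- t) * (t ^ k / fact k))"
        using True by (simp add: h_def norm_mult norm_divide norm_power powr_realpow)
      also have "\<dots> \<le> B * (exp (- t) * (t ^ k / fact k))"
        using B[of k] True by (intro mult_right_mono) auto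
      finally show "norm (norm (indicator {0..} t *\<^sub>R h k t)) \<le> B * exp (- t) * (t ^ k / fact k)"
        using True by (simp add: mult.assoc)
    qed
  qed (use that in simp)
  have ae: "AE t in lborel. t \<noteq> (0::real)" by (rule AE_lborel_singleton)
  have ind: "indicator {0..} t *\<^sub>R \<kappa> t = (\<Sum>k. indicator {0..} t *\<^sub>R h k t)" for t
    by (simp add: \<kappa> indicator_def)
  show "set_integrable lborel {0..} \<kappa>"
    unfolding set_integrable_def ind
  proof (rule integrable_suminf)
    show "integrable lborel (\<lambda>t. indicator {0..} t *\<^sub>R h k t)" for k using hi by (simp add: set_integrable_def)
    show "AE t in lborel. summable (\<lambda>k. norm (indicator {0..} t *\<^sub>R h k t))"
      using ae by eventually_elim (rule sum_norm)
    show "summable (\<lambda>k. \<integral>t. norm (indicator {0..} t *\<^sub>R h k t) \<partial>lborel)" unfolding nh by (rule c)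
  qed
  assume z: "0 < Re z"
  let ?e = "\<lambda>t. exp (- z * of_real t)"
  have e1: "norm (?e t) \<le> 1" if "0 \<le> t" for t using z that by simp
  have le: "norm (indicator {0..} t *\<^sub>R (h k t * ?e t)) \<le> norm (indicator {0..} t *\<^sub>R h k t)" for k t
    using e1[of t] by (auto simp: indicator_def norm_mult intro: mult_left_le)
  have hei: "integrable lborel (\<lambda>t. indicator {0..} t *\<^sub>R (h k t * ?e t))" for k
    using mf_integral(2)[OF sets_half_line hi[folded integrable_half_line] bcont_exp[OF less_imp_le[OF z]]]
    by (simp add: integrable_half_line set_integrable_def)
  have hev: "(\<integral>t. indicator {0..} t *\<^sub>R (h k t * ?e t) \<partial>lborel) = of_real (c k) * (1 / (1 + z)) ^ Suc k" for k
  proof -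
    have "(\<integral>t. indicator {0..} t *\<^sub>R (h k t * ?e t) \<partial>lborel) = of_real (c k / fact k) * of_real (Gamma (real k + 1)) * (z - (- 1)) powr (- of_real (real k + 1))"
      unfolding h_def
      by (rule LINT_powr_kernel[of "real k + 1" "- 1" z "of_real (c k / fact k)", unfolded set_lebesgue_integral_def])
        (use z in auto)
    moreover have "(z - (- 1)) powr (- of_real (real k + 1)) = (1 / (1 + z)) ^ Suc k"
    proof -
      have "1 + z \<noteq> 0" using z by (auto simp: complex_eq_iff)
      then have "(1 + z) powr (- of_nat (Suc k)) = inverse ((1 + z) ^ Suc k)"
        using powr_nat'[of "1 + z" "Suc k"] by (simp add: powr_minus del: of_nat_Suc power_Suc)
      then show ?thesis by (simp add: add.commute power_one_over inverse_eq_divide)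
    qed
    ultimately show ?thesis by (simp add: Gk)
  qed
  have "(\<lambda>k. \<integral>t. indicator {0..} t *\<^sub>R (h k t * ?e t) \<partial>lborel) sums (\<integral>t. (\<Sum>k. indicator {0..} t *\<^sub>R (h k t * ?e t)) \<partial>lborel)"
  proof (rule sums_integral[OF hei])
    show "AE t in lborel. summable (\<lambda>k. norm (indicator {0..} t *\<^sub>R (h k t * ?e t)))"
      using ae
    proof eventually_elim
      case (elim t)
      show ?case by (rule summable_comparison_test[OF _ sum_norm[OF elim]]) (use le in auto)
    qed
    show "summable (\<lambda>k. \<integral>t. norm (indicator {0..} t *\<^sub>R (h k t * ?e t)) \<partial>lborel)"
    proof (rule summable_comparison_test[OF _ c], intro exI allI impI)
      fix k
      have "(\<integral>t. norm (indicator {0..} t *\<^sub>R (h k t * ?e t)) \<partial>lborel) \<le> (\<integral>t. norm (indicator {0..} t *\<^sub>R h k t) \<partial>lborel)"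
        by (intro integral_mono integrable_norm hei le) (use hi in \<open>simp add: set_integrable_def\<close>)
      then show "norm (\<integral>t. norm (indicator {0..} t *\<^sub>R (h k t * ?e t)) \<partial>lborel) \<le> \<bar>c k\<bar>"
        unfolding nh by simp
    qed
  qed
  moreover have "(\<integral>t. (\<Sum>k. indicator {0..} t *\<^sub>R (h k t * ?e t)) \<partial>lborel) = (LINT t:{0..}|lborel. \<kappa> t * ?e t)"
    unfolding set_lebesgue_integral_def
  proof (rule integral_cong_AE)
    have [measurable]: "h k \<in> borel_measurable lborel" for k unfolding h_def by measurable
    show "(\<lambda>t. \<Sum>k. indicator {0..} t *\<^sub>R (h k t * ?e t)) \<in> borel_measurable lborel" by measurable
    show "(\<lambda>t. indicator {0..} t *\<^sub>R (\<kappa> t * ?e t)) \<in> borel_measurable lborel" unfolding \<kappa> by measurable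
    show "AE t in lborel. (\<Sum>k. indicator {0..} t *\<^sub>R (h k t * ?e t)) = indicator {0..} t *\<^sub>R (\<kappa> t * ?e t)"
      using ae
    proof eventually_elim
      case (elim t)
      show ?case
      proof (cases "0 \<le> t")
        case True
        then have "summable (\<lambda>k. norm (h k t))" using sum_norm[OF elim] by simp
        then have "summable (\<lambda>k. h k t)" by (rule summable_norm_cancel)
        from suminf_mult2[OF this, of "?e t"] show ?thesis using True by (simp add: \<kappa>)
      qed simp
    qed
  qed
  ultimately show "(\<lambda>k. of_real (c k) * (1 / (1 + z)) ^ Suc k) sums (LINT t:{0..}|lborel. \<kappa> t * exp (- z * of_real t))"
    unfolding hev by simp
qed

text \<open>With \<open>w = 1 / (1 + z)\<close> one has \<open>z\<^sup>\<alpha> (1 + z)\<^sup>-\<^sup>\<alpha> = (1 - w)\<^sup>\<alpha> = 1 + w r\<close>, where \<open>r\<close> is an absolutely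
  convergent power series in \<open>w\<close>. Hence \<open>x = W A\<^sup>\<alpha> x - w(A) r(A) x\<close> with \<open>W = (1 + A)\<^sup>-\<^sup>\<alpha>\<close>, and iterating this
  \<open>n > \<alpha>\<close> times replaces \<open>w\<close> by \<open>w\<^sup>n\<close>, which factors through \<open>W\<close>.\<close>

lemma Domain_frac_power_subset_range:
  assumes \<alpha>: "0 < \<alpha>" and x: "x \<in> Domain (frac_power A \<alpha>)"
  shows "x \<in> range (resolvent_power A (- 1) \<alpha>)"
proof -
  define W where "W = resolvent_power A (- 1) \<alpha>"
  have W: "has_symbol W (\<lambda>z. (1 + z) powr (- of_real \<alpha>))"
    using has_symbol_resolvent_power[OF \<alpha>, of "- 1"] by (simp add: W_def add.commute)
  define c where "c k = (- 1) ^ k * (\<alpha> gchoose k)" for k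
  have "summable (\<lambda>k. \<bar>c k\<bar>)"
    using summable_abs_gbinomial[OF \<alpha>] by (simp add: c_def abs_mult power_abs)
  then have c2: "summable (\<lambda>k. \<bar>c (k + 2)\<bar>)"
    by (subst summable_iff_shift)
  \<comment> \<open>The shift by 2: \<open>c 0 = 1\<close> is the leading identity,
    \<open>c 1\<close> the constant term of r, and after division by w the rest starts with w
    itself, the lowest power represented by an integrable density.\<close>
  define \<kappa> where "\<kappa> = (\<lambda>t. \<Sum>k. of_real (c (k + 2) / fact k) * (of_real (t powr (real k + 1 - 1)) * exp (- 1 * of_real t)) :: complex)"
  have \<kappa>: "set_integrable lborel {0..} \<kappa>" unfolding \<kappa>_def by (rule set_integrable_power_series_kernel[OF c2])
  define \<phi> where "\<phi> z = (LINT t:{0..}|lborel. \<kappa> t * exp (- z * of_real t))" for z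
  have \<phi>: "(\<lambda>k. of_real (c (k + 2)) * (1 / (1 + z)) ^ Suc k) sums \<phi> z" if "0 < Re z" for z
    unfolding \<phi>_def \<kappa>_def by (rule LINT_power_series_kernel[OF c2 that])
  define r where "r y = of_real (c 1) *\<^sub>C y + 1 *\<^sub>C kernel_op \<kappa> y" for y
  define \<rho> where "\<rho> z = of_real (c 1) * 1 + 1 * \<phi> z" for z
  have r: "has_symbol r \<rho>"
    using has_symbol_add[OF has_symbol_id has_symbol_kernel_op[OF \<kappa>], of "of_real (c 1)" 1]
    unfolding r_def[abs_def] \<rho>_def[abs_def] \<phi>_def .
  have key: "z powr of_real \<alpha> * (1 + z) powr (- of_real \<alpha>) = 1 + 1 / (1 + z) * \<rho> z" if z: "0 < Re z" for z
  proof -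
    define w where "w = 1 / (1 + z)"
    have nz: "1 + z \<noteq> 0" using z by (auto simp: complex_eq_iff)
    have "1 < norm (1 + z)" using complex_Re_le_cmod[of "1 + z"] z by simp
    then have w1: "norm (- w) < 1" by (simp add: w_def norm_divide divide_simps)
    have cw: "((of_real \<alpha> :: complex) gchoose k) * (- w) ^ k = of_real (c k) * w ^ k" for k
    proof -
      have "(of_real \<alpha> :: complex) gchoose k = of_real (\<alpha> gchoose k)"
        by (simp add: gbinomial_pochhammer pochhammer_of_real[symmetric])
      then show ?thesis by (simp add: c_def power_minus[of w])
    qed
    have "(\<lambda>k. of_real (c k) * w ^ k) sums (1 + - w) powr of_real \<alpha>"
      using gen_binomial_complex[OF w1, of "of_real \<alpha>"] unfolding cw .
    then have "(\<lambda>k. of_real (c (k + 2)) * w ^ (k + 2)) sums ((1 + - w) powr of_real \<alpha> - (\<Sum>k<2. of_real (c k) * w ^ k))"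
      by (rule sums_split_initial_segment)
    moreover have "(\<lambda>k. w * (of_real (c (k + 2)) * w ^ Suc k)) sums (w * \<phi> z)"
      using \<phi>[OF z] unfolding w_def by (rule sums_mult)
    moreover have "w * (of_real (c (k + 2)) * w ^ Suc k) = of_real (c (k + 2)) * w ^ (k + 2)" for k by simp
    ultimately have "w * \<phi> z = (1 + - w) powr of_real \<alpha> - (\<Sum>k<2. of_real (c k) * w ^ k)"
      by (metis (no_types, lifting) sums_unique2 sums_cong)
    moreover have "(\<Sum>k<2. of_real (c k) * w ^ k) = 1 + of_real (c 1) * w"
      by (simp add: numeral_2_eq_2 c_def)
    moreover have zw: "z / (1 + z) = 1 + - w" using nz by (simp add: w_def divide_simps)
    ultimately show ?thesis
      unfolding powr_divide_one_plus[OF z] \<rho>_def w_def[symmetric] zw by (simp add: algebra_simps)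
  qed
  define R where "R = kernel_op (\<lambda>t. 1 * (of_real (t powr (1 - 1)) * exp (- 1 * of_real t)))"
  have R: "has_symbol R (\<lambda>z. 1 / (1 + z))"
  proof (rule has_symbol_cong)
    show "has_symbol R (\<lambda>z. 1 * of_real (Gamma 1) * (z - (- 1)) powr (- of_real 1))"
      unfolding R_def by (rule has_symbol_powr_kernel) auto
    show "1 * of_real (Gamma 1) * (z - (- 1)) powr (- of_real 1) = 1 / (1 + z)" if "0 < Re z" for z
    proof -
      have "z + 1 \<noteq> 0" using that by (auto simp: complex_eq_iff)
      then show ?thesis by (simp add: powr_minus divide_inverse add.commute)
    qed
  qed
  \<comment> \<open>The term with coefficient 0 casts E = - R r into the shape of
    \<open>has_symbol_add\<close>.\<close>
  define E where "E y = 0 *\<^sub>C y + (- 1) *\<^sub>C R (r y)" for y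
  define \<epsilon> where "\<epsilon> z = 0 * 1 + (- 1) * (1 / (1 + z) * \<rho> z)" for z
  have E: "has_symbol E \<epsilon>"
    using has_symbol_add[OF has_symbol_id has_symbol_comp[OF R r], of 0 "- 1"]
    unfolding E_def[abs_def] \<epsilon>_def[abs_def] .
  have Q: "has_symbol (\<lambda>y. 1 *\<^sub>C y + (- 1) *\<^sub>C E y) (\<lambda>z. 1 * 1 + (- 1) * \<epsilon> z)"
    by (rule has_symbol_add[OF has_symbol_id E])
  from x obtain y where "(x, y) \<in> hp_calc A (\<lambda>z. z powr of_real \<alpha>)" by (auto simp: frac_power_def)
  then obtain \<mu> \<nu> where m: "complex_borel_measure \<mu>" "complex_borel_measure \<nu>" "inj (hp_measure A \<mu>)"
    "\<And>z. 0 < Re z \<Longrightarrow> laplace \<mu> z * z powr of_real \<alpha> = laplace \<nu> z" "hp_measure A \<mu> y = hp_measure A \<nu> x"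
    unfolding hp_calc_def right_half_plane_def by blast
  note s = has_symbol_hp_measure
  \<comment> \<open>Regularised by \<mu>, the identity reads \<mu>(A) (x - E x) = W \<nu>(A) x =
    \<mu>(A) W y; injectivity of \<mu>(A) removes the regulariser.\<close>
  have xW: "x = W y + E x"
  proof -
    have "(\<lambda>x. hp_measure A \<mu> (1 *\<^sub>C x + (- 1) *\<^sub>C E x)) = (\<lambda>x. W (hp_measure A \<nu> x))"
    proof (rule has_symbol_unique[OF has_symbol_comp[OF s[OF m(1)] Q] has_symbol_comp[OF W s[OF m(2)]]])
      fix z :: complex assume z: "0 < Re z"
      show "laplace \<mu> z * (1 * 1 + (- 1) * \<epsilon> z) = (1 + z) powr (- of_real \<alpha>) * laplace \<nu> z"
        using key[OF z] by (simp add: \<epsilon>_def m(4)[OF z, symmetric] mult_ac)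
    qed
    then have "hp_measure A \<mu> (1 *\<^sub>C x + (- 1) *\<^sub>C E x) = W (hp_measure A \<nu> x)" by metis
    also have "\<dots> = W (hp_measure A \<mu> y)" by (simp add: m(5))
    also have "\<dots> = hp_measure A \<mu> (W y)" by (rule has_symbol_commute[OF W s[OF m(1)]])
    finally have "1 *\<^sub>C x + (- 1) *\<^sub>C E x = W y" using injD[OF m(3)] by blast
    moreover have "(- 1) *\<^sub>C E x = - E x" using scaleC_of_real[of "- 1" "E x"] by simp
    ultimately show ?thesis by (simp add: algebra_simps)
  qed
  have Ej: "has_symbol (E ^^ j) (\<lambda>z. \<epsilon> z ^ j)" for j
  proof (induction j)
    case 0 then show ?case using has_symbol_id by (simp add: id_def)
  next
    case (Suc j)
    then show ?case using has_symbol_comp[OF E Suc] by (simp add: o_def)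
  qed
  have iter: "\<exists>v. x = W v + (E ^^ j) x" for j
  proof (induction j)
    case 0
    have "W 0 = 0" using has_symbol_bounded_linear[OF W] by (simp add: bounded_linear.linear linear_0)
    then show ?case by (intro exI[of _ 0]) simp
  next
    case (Suc j)
    then obtain v where v: "x = W v + (E ^^ j) x" by blast
    have "(E ^^ j) x = (E ^^ j) (W y) + (E ^^ j) (E x)"
      using arg_cong[OF xW, of "E ^^ j"] has_symbol_bounded_linear[OF Ej[of j]]
      by (simp add: bounded_linear.linear linear_add)
    also have "(E ^^ j) (W y) = W ((E ^^ j) y)" by (rule has_symbol_commute[OF Ej W])
    also have "(E ^^ j) (E x) = (E ^^ Suc j) x" by (simp add: funpow_swap1)
    finally have "W v + (E ^^ j) x = W v + W ((E ^^ j) y) + (E ^^ Suc j) x"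
      by (simp only: add.assoc)
    moreover have "W (v + (E ^^ j) y) = W v + W ((E ^^ j) y)"
      using has_symbol_bounded_linear[OF W] by (simp add: bounded_linear.linear linear_add)
    ultimately have "x = W (v + (E ^^ j) y) + (E ^^ Suc j) x" using v by metis
    then show ?case by blast
  qed
  \<comment> \<open>n > \<alpha> makes n - \<alpha> a legitimate order for the resolvent power V,
    and then (1 + A)^(- n) = W V.\<close>
  obtain n :: nat where n: "\<alpha> < real n" using reals_Archimedean2 by blast
  define V where "V = resolvent_power A (- 1) (real n - \<alpha>)"
  have V: "has_symbol V (\<lambda>z. (1 + z) powr (- of_real (real n - \<alpha>)))"
    using has_symbol_resolvent_power[of "real n - \<alpha>" "- 1"] n by (simp add: V_def add.commute)
  define r' where "r' y = 0 *\<^sub>C y + (- 1) *\<^sub>C r y" for y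
  have "has_symbol r' (\<lambda>z. 0 * 1 + (- 1) * \<rho> z)"
    unfolding r'_def by (rule has_symbol_add[OF has_symbol_id r])
  then have r': "has_symbol (r' ^^ j) (\<lambda>z. (- \<rho> z) ^ j)" for j
  proof (induction j)
    case 0 then show ?case using has_symbol_id by (simp add: id_def)
  next
    case (Suc j)
    then show ?case using has_symbol_comp[OF Suc.prems Suc.IH[OF Suc.prems]] by (simp add: o_def)
  qed
  have "E ^^ n = (\<lambda>x. W (V ((r' ^^ n) x)))"
  proof (rule has_symbol_unique[OF Ej has_symbol_comp[OF W has_symbol_comp[OF V r']]])
    fix z :: complex assume z: "0 < Re z"
    have nz: "1 + z \<noteq> 0" using z by (auto simp: complex_eq_iff)
    have "(1 + z) powr (- of_real \<alpha>) * (1 + z) powr (- of_real (real n - \<alpha>)) = (1 + z) powr (- of_nat n)"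
      by (simp add: powr_add[symmetric])
    also have "\<dots> = (1 / (1 + z)) ^ n"
      using nz by (simp add: powr_minus powr_nat' power_one_over inverse_eq_divide)
    finally have "(1 + z) powr (- of_real \<alpha>) * (1 + z) powr (- of_real (real n - \<alpha>)) = (1 / (1 + z)) ^ n" .
    moreover have "\<epsilon> z = 1 / (1 + z) * (- \<rho> z)" by (simp add: \<epsilon>_def)
    ultimately show "\<epsilon> z ^ n = (1 + z) powr (- of_real \<alpha>) * ((1 + z) powr (- of_real (real n - \<alpha>)) * (- \<rho> z) ^ n)"
      by (simp only: power_mult_distrib mult.assoc[symmetric])
  qed
  then obtain v where "x = W v + W (V ((r' ^^ n) x))" using iter[of n] by metis
  also have "\<dots> = W (v + V ((r' ^^ n) x))"
    using has_symbol_bounded_linear[OF W] by (simp add: bounded_linear.linear linear_add)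
  finally show ?thesis by (simp add: W_def)
qed

text \<open>The inclusion does not mention \<kappa>, so a single choice suffices: at \<kappa> = - 1
  the operator f(A) (1 + A)^(- \<alpha>) is everywhere defined, which places the range of (1 + A)^(-
  \<alpha>) inside the domain of f(A).\<close>

lemma Domain_frac_power_subset:
  assumes w: "w < 0" and \<alpha>: "0 < \<alpha>" and f: "f \<in> Hinf w"
  shows "Domain (frac_power A \<alpha>) \<subseteq> Domain (hp_calc A f)"
proof
  fix x assume "x \<in> Domain (frac_power A \<alpha>)"
  then obtain v where v: "x = resolvent_power A (- 1) \<alpha> v"
    using Domain_frac_power_subset_range[OF \<alpha>] by blast
  obtain S where "graph (resolvent_power A (- 1) \<alpha>) O hp_calc A f = graph S"
    using calculus_times_resolvent_power[OF w \<alpha> _ f, of "- 1"] by auto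
  then have "(v, S v) \<in> graph (resolvent_power A (- 1) \<alpha>) O hp_calc A f" by (simp add: graph_def)
  then show "x \<in> Domain (hp_calc A f)" by (auto simp: graph_def v)
qed

end

theorem theorem1p1:
  fixes A :: "('h::chilbert_space \<times> 'h) set"
    and T :: "real \<Rightarrow> 'h \<Rightarrow> 'h"
    and M :: real
  assumes semigroup: "bounded_C0_semigroup T"
    and generator: "neg_generates A T"
    and M_def: "M = (SUP t\<in>{0..}. onorm (T t))"
  shows
    "(\<forall>\<omega><0. \<exists>c :: real \<Rightarrow> real.
        (\<forall>\<tau>>0. c \<tau> \<ge> 0) \<and>
        c \<in> O[at_right 0](\<lambda>\<tau>. \<bar>ln \<tau>\<bar>) \<and>
        c \<in> O[at_top](\<lambda>\<tau>. 1) \<and>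
        (\<forall>\<tau>>0. \<forall>f\<in>Hinf \<omega>.
           in_L (graph (T \<tau>) O hp_calc A f) \<and>
           op_norm (graph (T \<tau>) O hp_calc A f) \<le> c \<tau> * M\<^sup>2 * Hinf_norm \<omega> f))
     \<and>
     (\<forall>\<omega><0. \<forall>\<alpha>>0.
        (\<forall>\<kappa>. Re \<kappa> < 0 \<longrightarrow> (\<exists>C\<ge>0. \<forall>f\<in>Hinf \<omega>.
           in_L (graph (resolvent_power A \<kappa> \<alpha>) O hp_calc A f) \<and>
           op_norm (graph (resolvent_power A \<kappa> \<alpha>) O hp_calc A f) \<le> C * M\<^sup>2 * Hinf_norm \<omega> f)) \<and>
        (\<forall>f\<in>Hinf \<omega>. Domain (frac_power A \<alpha>) \<subseteq> Domain (hp_calc A f)))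
     \<and>
     (\<forall>m\<ge>1. strong_m_bounded_calculus m A)"
proof -
  interpret hp_semigroup T M A
    unfolding M_def by (rule hp_semigroup_SUP[OF semigroup generator])
  have a: "\<exists>c :: real \<Rightarrow> real.
        (\<forall>\<tau>>0. c \<tau> \<ge> 0) \<and> c \<in> O[at_right 0](\<lambda>\<tau>. \<bar>ln \<tau>\<bar>) \<and> c \<in> O[at_top](\<lambda>\<tau>. 1) \<and>
        (\<forall>\<tau>>0. \<forall>f\<in>Hinf \<omega>.
           in_L (graph (T \<tau>) O hp_calc A f) \<and>
           op_norm (graph (T \<tau>) O hp_calc A f) \<le> c \<tau> * M\<^sup>2 * Hinf_norm \<omega> f)" if \<omega>: "\<omega> < 0" for \<omega>
  \<comment> \<open>\<open>max 2\<close> keeps the logarithm at least ln 2, so the witness stays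
    positive for large \<tau> as well.\<close>
  proof (intro exI[of _ "\<lambda>\<tau>. 16 * ln (max 2 (- 2 / \<omega> / \<tau>))"] conjI allI impI ballI)
    show "0 \<le> 16 * ln (max 2 (- 2 / \<omega> / \<tau>))" for \<tau> by simp
    have "0 < - 2 / \<omega>" using \<omega> by (simp add: divide_neg_neg)
    from bigo_log_max[OF this]
    show "(\<lambda>\<tau>. 16 * ln (max 2 (- 2 / \<omega> / \<tau>))) \<in> O[at_right 0](\<lambda>\<tau>. \<bar>ln \<tau>\<bar>)"
      "(\<lambda>\<tau>. 16 * ln (max 2 (- 2 / \<omega> / \<tau>))) \<in> O[at_top](\<lambda>\<tau>. 1)" .
  qed (use calculus_times_semigroup[OF \<omega>] in blast)+
  have b: "\<exists>C\<ge>0. \<forall>f\<in>Hinf \<omega>.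
           in_L (graph (resolvent_power A \<kappa> \<alpha>) O hp_calc A f) \<and>
           op_norm (graph (resolvent_power A \<kappa> \<alpha>) O hp_calc A f) \<le> C * M\<^sup>2 * Hinf_norm \<omega> f"
    if "\<omega> < 0" "0 < \<alpha>" "Re \<kappa> < 0" for \<omega> \<alpha> \<kappa>
  proof -
    \<comment> \<open>4 from the regularisation; the rest is J with its factor
      \<open>Hinf_norm\<close> removed.\<close>
    define C where "C = 4 * (min (- \<omega>) (- Re \<kappa>) / 2) powr (- \<alpha>) / \<alpha>"
    have C: "0 \<le> C" using that by (simp add: C_def)
    show ?thesis
    proof (intro exI[of _ C] conjI[OF C] ballI)
      fix f assume f: "f \<in> Hinf \<omega>"
      show "in_L (graph (resolvent_power A \<kappa> \<alpha>) O hp_calc A f) \<and>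
           op_norm (graph (resolvent_power A \<kappa> \<alpha>) O hp_calc A f) \<le> C * M\<^sup>2 * Hinf_norm \<omega> f"
      proof (rule in_L_op_norm_le[OF calculus_times_resolvent_power[OF that f]])
        show "0 \<le> C * M\<^sup>2 * Hinf_norm \<omega> f" using C Hinf_norm_nonneg[OF f] by simp
      qed (simp add: C_def mult_ac)
    qed
  qed
  have c: "strong_m_bounded_calculus m A" if m: "1 \<le> m" for m
    unfolding strong_m_bounded_calculus_def
    using calculus_derivative[OF _ m] by (intro exI[of _ "4 * M\<^sup>2 * (fact m * 4 ^ m)"] conjI) auto
  show ?thesis
    by (intro conjI allI impI ballI) (rule a b c Domain_frac_power_subset; assumption)+
qed

end
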